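(* Assume the setting described in the context, and suppose that $\bar\Phi$ can be decomposed as $\bar\Phi f=\Phi_0 f+Bf+V Lf$ for all $f\in\mathrm{W}^{1,p}(\mathbb{R}_+,\mathbb{C}^\ell)\times\mathrm{W}^{1,p}([0,1],\mathbb{C}^m)$, where $\Phi_0\in\mathcal{L}(\mathrm{C}_0(\mathbb{R}_+,\mathbb{C}^\ell)\times\mathrm{C}([0,1],\mathbb{C}^m),\partial X)$, $B\in\mathcal{L}(X,\partial X)$ and $V\in\mathcal{L}(\partial X)$ is non-invertible. If $G$ generates a $C_0$-semigroup on $X$, then \[ \lim_{\lambda\to+\infty}\lambda^{1/p}\,\|\Phi_0L_\lambda\|=+\infty, \] where $L_\lambda:\partial X\to X$ is given for $x=(x^e,x^i)\in\partial X$ by $(L_\lambda x)(r,s)=\bigl(e^{-\lambda r}x^e,\ (P^i_+e^{\lambda(s-1)\bar C^{-1}}+P^i_-e^{\lambda s\bar C^{-1}})x^i\bigr)$, $r\in\mathbb{R}_+$, $s\in[0,1]$.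
   Context: Fix $p\in[1,\infty)$ and $\ell,m\in\mathbb{N}_0$ with $\ell+m>0$; $\mathbb{R}_+=[0,\infty)$. All subspaces of $\mathbb{C}^k$ carry the maximum norm. $X=\mathrm{L}^p(\mathbb{R}_+,\mathbb{C}^\ell)\times\mathrm{L}^p([0,1],\mathbb{C}^m)$. Let $\lambda^e(r)=\operatorname{diag}(\lambda^e_k(r))_{k=1}^\ell$, $\lambda^i(s)=\operatorname{diag}(\lambda^i_j(s))_{j=1}^m$ with real-valued bounded measurable functions for which there is $\varepsilon>0$ with $\varepsilon\le\lambda^e_k(0)\lambda^e_k(r)$ and $\varepsilon\le\lambda^i_j(0)\lambda^i_j(s)$ for all $k,j,r\in\mathbb{R}_+,s\in[0,1]$. Let $q^e:\mathbb{R}_+\to\mathrm{M}_\ell(\mathbb{C})$, $q^i:[0,1]\to\mathrm{M}_m(\mathbb{C})$ be Lipschitz continuous, pointwise invertible, with $q^e,(q^e)^{-1},q^i,(q^i)^{-1}$ essentially bounded; $c=\operatorname{diag}(q^e\lambda^e(q^e)^{-1},q^i\lambda^i(q^i)^{-1})$. $P^e_\pm$, $P^i_\pm$ are the diagonal coordinate projections onto coordinates with $\pm\lambda^e_k>0$, resp. $\pm\lambda^i_j>0$. $\partial X=\operatorname{rg}(P^e_-)\times\mathbb{C}^m$. $\Phi=(\Phi^e,\Phi^i)$ is a bounded linear operator from $\mathrm{C}_0(\mathbb{R}_+,\mathbb{C}^\ell)\times\mathrm{C}([0,1],\mathbb{C}^m)$ to $\partial X$, $\Phi(f^e,f^i)=\Phi^ef^e+\Phi^if^i$.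 $Gf=c\cdot f'$ with $D(G)=\{f\in\mathrm{W}^{1,p}(\mathbb{R}_+,\mathbb{C}^\ell)\times\mathrm{W}^{1,p}([0,1],\mathbb{C}^m):\Phi f=0\}$. Notation: $\phi_k(r)=\int_0^r\frac{d\sigma}{|\lambda^e_k(\sigma)|}$; $\varphi_j(s)=\int_0^s\frac{d\sigma}{\lambda^i_j(\sigma)}$, $\bar c_j=1/\varphi_j(1)$, $\bar\varphi_j=\bar c_j\varphi_j$, $\bar C=\operatorname{diag}(\bar c_1,\dots,\bar c_m)$; $J_\phi f^e=(f^e_k\circ\phi_k)_k$, $J_{\bar\varphi}f^i=(f^i_j\circ\bar\varphi_j)_j$. Then $\bar\Phi(f^e,f^i):=\Phi^e\bigl(q^e(\cdot)(J_\phi f^e)(\cdot)\bigr)+\Phi^i\bigl(q^i(\cdot)(J_{\bar\varphi}f^i)(\cdot)\bigr)$, and $L(f^e,f^i):=\bigl(P^e_-f^e(0),\ P^i_+f^i(1)+P^i_-f^i(0)\bigr)\in\partial X$. $\|\Phi_0L_\lambda\|$ is the operator norm in $\mathcal{L}(\partial X)$. *)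

theory Defs
  imports "HOL-Analysis.Analysis"
begin

(* Vectors in C^n are modelled as nat => complex, only indices < n matter.
   Functions R_+ -> C^l and [0,1] -> C^m are modelled as real => nat => complex;
   values outside R_+ resp. [0,1] and indices >= l resp. >= m are irrelevant. *)

type_synonym cvec = "nat \<Rightarrow> complex"
type_synonym cfun = "real \<Rightarrow> cvec"
type_synonym cmat = "nat \<Rightarrow> nat \<Rightarrow> complex"

definition vnorm :: "nat \<Rightarrow> cvec \<Rightarrow> real" where
  "vnorm n v = Max (insert 0 ((\<lambda>k. cmod (v k)) ` {..<n}))"

definition mv :: "nat \<Rightarrow> cmat \<Rightarrow> cvec \<Rightarrow> cvec" where
  "mv n A v = (\<lambda>i. if i < n then (\<Sum>j<n. A i j * v j) else 0)"

definition xadd :: "cfun \<times> cfun \<Rightarrow> cfun \<times> cfun \<Rightarrow> cfun \<times> cfun" where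
  "xadd f g = ((\<lambda>r k. fst f r k + fst g r k), (\<lambda>s j. snd f s j + snd g s j))"

definition xscale :: "complex \<Rightarrow> cfun \<times> cfun \<Rightarrow> cfun \<times> cfun" where
  "xscale c f = ((\<lambda>r k. c * fst f r k), (\<lambda>s j. c * snd f s j))"

definition xdiff :: "cfun \<times> cfun \<Rightarrow> cfun \<times> cfun \<Rightarrow> cfun \<times> cfun" where
  "xdiff f g = xadd f (xscale (-1) g)"

definition badd :: "cvec \<times> cvec \<Rightarrow> cvec \<times> cvec \<Rightarrow> cvec \<times> cvec" where
  "badd x y = ((\<lambda>k. fst x k + fst y k), (\<lambda>j. snd x j + snd y j))"

definition bscale :: "complex \<Rightarrow> cvec \<times> cvec \<Rightarrow> cvec \<times> cvec" where
  "bscale c x = ((\<lambda>k. c * fst x k), (\<lambda>j. c * snd x j))"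

definition bzero :: "cvec \<times> cvec" where
  "bzero = ((\<lambda>k. 0), (\<lambda>j. 0))"

text \<open>The space X = L^p(R_+,C^l) x L^p([0,1],C^m), norm
  (||f^e||_p^p + ||f^i||_p^p)^(1/p); elements are represented by functions,
  equality in X is equality up to a null function (normX of the difference is 0).\<close>
definition Xint :: "nat \<Rightarrow> nat \<Rightarrow> real \<Rightarrow> cfun \<times> cfun \<Rightarrow> ennreal" where
  "Xint l m p f =
     (\<integral>\<^sup>+ r. ennreal (vnorm l (fst f r) powr p) \<partial>(lebesgue_on {0..}))
   + (\<integral>\<^sup>+ s. ennreal (vnorm m (snd f s) powr p) \<partial>(lebesgue_on {0..1}))"

definition inX :: "nat \<Rightarrow> nat \<Rightarrow> real \<Rightarrow> cfun \<times> cfun \<Rightarrow> bool" where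
  "inX l m p f \<longleftrightarrow>
     (\<forall>k<l. (\<lambda>r. fst f r k) \<in> borel_measurable (lebesgue_on {0..})) \<and>
     (\<forall>j<m. (\<lambda>s. snd f s j) \<in> borel_measurable (lebesgue_on {0..1})) \<and>
     Xint l m p f < \<infinity>"

definition normX :: "nat \<Rightarrow> nat \<Rightarrow> real \<Rightarrow> cfun \<times> cfun \<Rightarrow> real" where
  "normX l m p f = enn2real (Xint l m p f) powr (1 / p)"

text \<open>Boundary space dX = rg(P^e_-) x C^m with the maximum norm.
  (The sign of lambda^e_k is constant, determined by lambda^e_k(0).)\<close>
definition dX :: "nat \<Rightarrow> nat \<Rightarrow> (nat \<Rightarrow> real \<Rightarrow> real) \<Rightarrow> (cvec \<times> cvec) set" where
  "dX l m lame = {x. (\<forall>k. fst x k \<noteq> 0 \<longrightarrow> k < l \<and> lame k 0 < 0) \<and>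
                     (\<forall>j. snd x j \<noteq> 0 \<longrightarrow> j < m)}"

definition normdX :: "nat \<Rightarrow> nat \<Rightarrow> cvec \<times> cvec \<Rightarrow> real" where
  "normdX l m x = max (vnorm l (fst x)) (vnorm m (snd x))"

definition C0C :: "nat \<Rightarrow> nat \<Rightarrow> cfun \<times> cfun \<Rightarrow> bool" where
  "C0C l m f \<longleftrightarrow>
     (\<forall>k<l. continuous_on {0..} (\<lambda>r. fst f r k) \<and> ((\<lambda>r. fst f r k) \<longlongrightarrow> 0) at_top) \<and>
     (\<forall>j<m. continuous_on {0..1} (\<lambda>s. snd f s j))"

definition supnorm :: "nat \<Rightarrow> nat \<Rightarrow> cfun \<times> cfun \<Rightarrow> real" where
  "supnorm l m f = max (SUP r\<in>{0..}. vnorm l (fst f r)) (SUP s\<in>{0..1::real}. vnorm m (snd f s))"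

definition blin_C :: "nat \<Rightarrow> nat \<Rightarrow> (nat \<Rightarrow> real \<Rightarrow> real) \<Rightarrow> (cfun \<times> cfun \<Rightarrow> cvec \<times> cvec) \<Rightarrow> bool" where
  "blin_C l m lame A \<longleftrightarrow>
     (\<forall>f g. C0C l m f \<longrightarrow> C0C l m g \<longrightarrow> A (xadd f g) = badd (A f) (A g)) \<and>
     (\<forall>c f. C0C l m f \<longrightarrow> A (xscale c f) = bscale c (A f)) \<and>
     (\<forall>f. C0C l m f \<longrightarrow> A f \<in> dX l m lame) \<and>
     (\<exists>M. \<forall>f. C0C l m f \<longrightarrow> normdX l m (A f) \<le> M * supnorm l m f)"

definition blin_X :: "nat \<Rightarrow> nat \<Rightarrow> real \<Rightarrow> (nat \<Rightarrow> real \<Rightarrow> real) \<Rightarrow> (cfun \<times> cfun \<Rightarrow> cvec \<times> cvec) \<Rightarrow> bool" where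
  "blin_X l m p lame A \<longleftrightarrow>
     (\<forall>f g. inX l m p f \<longrightarrow> inX l m p g \<longrightarrow> A (xadd f g) = badd (A f) (A g)) \<and>
     (\<forall>c f. inX l m p f \<longrightarrow> A (xscale c f) = bscale c (A f)) \<and>
     (\<forall>f. inX l m p f \<longrightarrow> A f \<in> dX l m lame) \<and>
     (\<exists>M. \<forall>f. inX l m p f \<longrightarrow> normdX l m (A f) \<le> M * normX l m p f)"

definition lin_dX :: "nat \<Rightarrow> nat \<Rightarrow> (nat \<Rightarrow> real \<Rightarrow> real) \<Rightarrow> (cvec \<times> cvec \<Rightarrow> cvec \<times> cvec) \<Rightarrow> bool" where
  "lin_dX l m lame V \<longleftrightarrow>
     (\<forall>x\<in>dX l m lame. V x \<in> dX l m lame) \<and>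
     (\<forall>x\<in>dX l m lame. \<forall>y\<in>dX l m lame. V (badd x y) = badd (V x) (V y)) \<and>
     (\<forall>c. \<forall>x\<in>dX l m lame. V (bscale c x) = bscale c (V x))"

text \<open>W^{1,p} x W^{1,p}: f is the (absolutely) continuous representative,
  g in X its derivative: f(t) = f(0) + integral_0^t g.\<close>
definition W1pair :: "nat \<Rightarrow> nat \<Rightarrow> real \<Rightarrow> cfun \<times> cfun \<Rightarrow> cfun \<times> cfun \<Rightarrow> bool" where
  "W1pair l m p f g \<longleftrightarrow> inX l m p f \<and> inX l m p g \<and>
     (\<forall>k<l. \<forall>t\<ge>0. ((\<lambda>s. fst g s k) has_integral (fst f t k - fst f 0 k)) {0..t}) \<and>
     (\<forall>j<m. \<forall>t\<in>{0..1}. ((\<lambda>s. snd g s j) has_integral (snd f t j - snd f 0 j)) {0..t})"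

definition C0_semigroup :: "nat \<Rightarrow> nat \<Rightarrow> real \<Rightarrow> (real \<Rightarrow> cfun \<times> cfun \<Rightarrow> cfun \<times> cfun) \<Rightarrow> bool" where
  "C0_semigroup l m p T \<longleftrightarrow>
     (\<forall>t\<ge>0. \<forall>f. inX l m p f \<longrightarrow> inX l m p (T t f)) \<and>
     (\<forall>t\<ge>0. \<forall>f g. inX l m p f \<longrightarrow> inX l m p g \<longrightarrow>
         normX l m p (xdiff (T t (xadd f g)) (xadd (T t f) (T t g))) = 0) \<and>
     (\<forall>t\<ge>0. \<forall>c f. inX l m p f \<longrightarrow> normX l m p (xdiff (T t (xscale c f)) (xscale c (T t f))) = 0) \<and>
     (\<forall>t\<ge>0. \<exists>M. \<forall>f. inX l m p f \<longrightarrow> normX l m p (T t f) \<le> M * normX l m p f) \<and>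
     (\<forall>f. inX l m p f \<longrightarrow> normX l m p (xdiff (T 0 f) f) = 0) \<and>
     (\<forall>t\<ge>0. \<forall>s\<ge>0. \<forall>f. inX l m p f \<longrightarrow> normX l m p (xdiff (T (t + s) f) (T t (T s f))) = 0) \<and>
     (\<forall>f. inX l m p f \<longrightarrow> ((\<lambda>t. normX l m p (xdiff (T t f) f)) \<longlongrightarrow> 0) (at_right 0))"

text \<open>The operator given by the graph relation A (A f y: f in the domain and y = A f)
  is the generator of T.\<close>
definition is_generator :: "nat \<Rightarrow> nat \<Rightarrow> real \<Rightarrow> (real \<Rightarrow> cfun \<times> cfun \<Rightarrow> cfun \<times> cfun)
     \<Rightarrow> (cfun \<times> cfun \<Rightarrow> cfun \<times> cfun \<Rightarrow> bool) \<Rightarrow> bool" where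
  "is_generator l m p T A \<longleftrightarrow>
     (\<forall>f. inX l m p f \<longrightarrow>
        ((\<exists>y. inX l m p y \<and>
              ((\<lambda>h. normX l m p (xdiff (xscale (complex_of_real (1 / h)) (xdiff (T h f) f)) y))
                 \<longlongrightarrow> 0) (at_right 0))
         \<longleftrightarrow> (\<exists>f' y. A f' y \<and> normX l m p (xdiff f f') = 0))) \<and>
     (\<forall>f f' y. inX l m p f \<longrightarrow> A f' y \<longrightarrow> normX l m p (xdiff f f') = 0 \<longrightarrow>
        ((\<lambda>h. normX l m p (xdiff (xscale (complex_of_real (1 / h)) (xdiff (T h f) f)) y))
           \<longlongrightarrow> 0) (at_right 0))"

definition generates_C0 :: "nat \<Rightarrow> nat \<Rightarrow> real \<Rightarrow> (cfun \<times> cfun \<Rightarrow> cfun \<times> cfun \<Rightarrow> bool) \<Rightarrow> bool" where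
  "generates_C0 l m p A \<longleftrightarrow> (\<exists>T. C0_semigroup l m p T \<and> is_generator l m p T A)"

definition phie :: "(nat \<Rightarrow> real \<Rightarrow> real) \<Rightarrow> nat \<Rightarrow> real \<Rightarrow> real" where
  "phie lame k r = integral {0..r} (\<lambda>\<sigma>. 1 / \<bar>lame k \<sigma>\<bar>)"

definition phii :: "(nat \<Rightarrow> real \<Rightarrow> real) \<Rightarrow> nat \<Rightarrow> real \<Rightarrow> real" where
  "phii lami j s = integral {0..s} (\<lambda>\<sigma>. 1 / lami j \<sigma>)"

definition Je :: "nat \<Rightarrow> (nat \<Rightarrow> real \<Rightarrow> real) \<Rightarrow> cfun \<Rightarrow> cfun" where
  "Je l lame fe = (\<lambda>r k. if k < l then fe (phie lame k r) k else 0)"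

definition Ji :: "nat \<Rightarrow> (nat \<Rightarrow> real \<Rightarrow> real) \<Rightarrow> cfun \<Rightarrow> cfun" where
  "Ji m lami fi = (\<lambda>s j. if j < m then fi (phii lami j s / phii lami j 1) j else 0)"

text \<open>Phi-bar f = Phi^e(q^e J_phi f^e) + Phi^i(q^i J_varphibar f^i),
  where Phi^e h = Phi(h,0) and Phi^i h = Phi(0,h).\<close>
definition Phibar :: "nat \<Rightarrow> nat \<Rightarrow> (nat \<Rightarrow> real \<Rightarrow> real) \<Rightarrow> (nat \<Rightarrow> real \<Rightarrow> real)
     \<Rightarrow> (real \<Rightarrow> cmat) \<Rightarrow> (real \<Rightarrow> cmat) \<Rightarrow> (cfun \<times> cfun \<Rightarrow> cvec \<times> cvec) \<Rightarrow> cfun \<times> cfun \<Rightarrow> cvec \<times> cvec" where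
  "Phibar l m lame lami qe qi Phi f =
     badd (Phi ((\<lambda>r. mv l (qe r) (Je l lame (fst f) r)), (\<lambda>s j. 0)))
          (Phi ((\<lambda>r k. 0), (\<lambda>s. mv m (qi s) (Ji m lami (snd f) s))))"

text \<open>L f = (P^e_- f^e(0), P^i_+ f^i(1) + P^i_- f^i(0)).\<close>
definition Lop :: "nat \<Rightarrow> nat \<Rightarrow> (nat \<Rightarrow> real \<Rightarrow> real) \<Rightarrow> (nat \<Rightarrow> real \<Rightarrow> real) \<Rightarrow> cfun \<times> cfun \<Rightarrow> cvec \<times> cvec" where
  "Lop l m lame lami f =
     ((\<lambda>k. if k < l \<and> lame k 0 < 0 then fst f 0 k else 0),
      (\<lambda>j. if j < m then (if lami j 0 > 0 then snd f 1 j else if lami j 0 < 0 then snd f 0 j else 0) else 0))"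

text \<open>L_lambda x = (e^{-lambda r} x^e, (P^i_+ e^{lambda (s-1) Cbar^{-1}} + P^i_- e^{lambda s Cbar^{-1}}) x^i),
  where Cbar^{-1} = diag(varphi_j(1)).\<close>
definition Llam :: "(nat \<Rightarrow> real \<Rightarrow> real) \<Rightarrow> real \<Rightarrow> cvec \<times> cvec \<Rightarrow> cfun \<times> cfun" where
  "Llam lami la x =
     ((\<lambda>r k. complex_of_real (exp (- la * r)) * fst x k),
      (\<lambda>s j. (if lami j 0 > 0 then complex_of_real (exp (la * (s - 1) * phii lami j 1))
              else if lami j 0 < 0 then complex_of_real (exp (la * s * phii lami j 1)) else 0) * snd x j))"

definition cmatr :: "nat \<Rightarrow> (nat \<Rightarrow> real \<Rightarrow> real) \<Rightarrow> (real \<Rightarrow> cmat) \<Rightarrow> (real \<Rightarrow> cmat) \<Rightarrow> real \<Rightarrow> cmat" where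
  "cmatr n lam q qinv r = (\<lambda>a b. \<Sum>k<n. q r a k * complex_of_real (lam k r) * qinv r k b)"

definition Grel :: "nat \<Rightarrow> nat \<Rightarrow> real \<Rightarrow> (nat \<Rightarrow> real \<Rightarrow> real) \<Rightarrow> (nat \<Rightarrow> real \<Rightarrow> real)
     \<Rightarrow> (real \<Rightarrow> cmat) \<Rightarrow> (real \<Rightarrow> cmat) \<Rightarrow> (real \<Rightarrow> cmat) \<Rightarrow> (real \<Rightarrow> cmat)
     \<Rightarrow> (cfun \<times> cfun \<Rightarrow> cvec \<times> cvec) \<Rightarrow> cfun \<times> cfun \<Rightarrow> cfun \<times> cfun \<Rightarrow> bool" where
  "Grel l m p lame lami qe qeinv qi qiinv Phi f y \<longleftrightarrow>
     (\<exists>g. W1pair l m p f g \<and> Phi f = bzero \<and>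
          y = ((\<lambda>r. mv l (cmatr l lame qe qeinv r) (fst g r)),
               (\<lambda>s. mv m (cmatr m lami qi qiinv s) (snd g s))))"

end

(*
If the conclusion failed, a nonzero x in the kernel of V would satisfy
|Phi0 (L_la x)| = O(la^(-1/p)) along arbitrarily large la. The substituted boundary layer
h = (q^e J_phi, q^i J_phibar) (L_la x) then satisfies |Phi h| = O(la^(-1/p)), by the decomposition of
Phi-bar and V x = 0. Freezing q at the end points turns h into a function u in W^{1,p} whose norm is
of exact order la^(-1/p), with |la u - c u'| = O(la^(-1/p)) and |Phi u| = O(la^(-1/p)).
Since the domain ker Phi of the generator G is dense, Phi has right inverses w of arbitrarily small
norm in X, so u is corrected to v = u - w in D(G) with |w| <= delta la^(-1/p). The resolvent estimate
|v| <= (2M/la) |la v - G v| yields |v| <= C (1/la + delta) la^(-1/p), contradicting the size of u.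
*)
theory Submission
  imports Defs "HOL-Library.Function_Algebras"
begin

text \<open>The order of the choices closes the estimate. Making w small in X costs a bound on |c
  w'| that may explode as delta shrinks. In the resolvent estimate |c w'| is divided by la, whereas
  la |w| only returns to order delta la^(-1/p). So delta is fixed first, from M, the bound on Phi u
  and the lower bound for u alone, and la afterwards; for this the corrections w must be uniform in
  u and linear in |Phi u|, with a second seminorm under control. That M bounds T only on {0..1} is
  enough: for large la the term M exp(-la) is absorbed. The operator B is harmless because |L_la x|
  in X is itself of order la^(-1/p).

  Elements of X are represented by functions, and the semigroup laws hold only up to null functions.
  The abstract part therefore works with a seminorm on a subset of a vector space, and it replaces
  integrals of orbits by finite sums: geometric sums in the resolvent estimate, dyadic means in the
  density of the domain.\<close>

instantiation "fun" :: (type, real_vector) real_vector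
begin

definition scaleR_fun :: "real \<Rightarrow> ('a \<Rightarrow> 'b) \<Rightarrow> 'a \<Rightarrow> 'b"
  where "scaleR_fun c f = (\<lambda>x. c *\<^sub>R f x)"

instance
  by standard (simp_all add: scaleR_fun_def fun_eq_iff scaleR_add_right scaleR_add_left)

end

lemma scaleR_fun_apply [simp]: "(c *\<^sub>R f) x = c *\<^sub>R f x"
  by (simp add: scaleR_fun_def)

section \<open>Seminormed spaces and uniform boundedness\<close>

text \<open>The carrier is a subset because only functions representing elements of X are
  controlled. Functions that agree almost everywhere remain distinct elements at distance 0, so an
  identity in X takes the form \<open>N (x - y) = 0\<close>.\<close>

locale seminormed =
  fixes S :: "'a::real_vector set" and N :: "'a \<Rightarrow> real"
  assumes subspace_S: "subspace S"
    and triangle: "x \<in> S \<Longrightarrow> y \<in> S \<Longrightarrow> N (x + y) \<le> N x + N y"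
    and scale: "x \<in> S \<Longrightarrow> N (c *\<^sub>R x) = \<bar>c\<bar> * N x"
begin

lemma S_zero [simp, intro]: "0 \<in> S"
  using subspace_S by (simp add: subspace_def)

lemma S_add [intro, simp]: "x \<in> S \<Longrightarrow> y \<in> S \<Longrightarrow> x + y \<in> S"
  using subspace_S by (simp add: subspace_def)

lemma S_scale [intro, simp]: "x \<in> S \<Longrightarrow> c *\<^sub>R x \<in> S"
  using subspace_S by (simp add: subspace_def)

lemma S_diff [intro, simp]: "x \<in> S \<Longrightarrow> y \<in> S \<Longrightarrow> x - y \<in> S"
  using subspace_S by (simp add: subspace_diff)

lemma S_sum [intro]: "(\<And>i. i \<in> I \<Longrightarrow> f i \<in> S) \<Longrightarrow> sum f I \<in> S"
  using subspace_S by (simp add: subspace_sum)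

lemma N_zero [simp]: "N 0 = 0"
  using scale[of 0 0] by simp

lemma N_minus: "x \<in> S \<Longrightarrow> N (- x) = N x"
  using scale[of x "-1"] by simp

lemma N_commute: "x \<in> S \<Longrightarrow> y \<in> S \<Longrightarrow> N (x - y) = N (y - x)"
  using N_minus[of "y - x"] by simp

lemma N_nonneg: assumes "x \<in> S" shows "0 \<le> N x"
proof -
  have "- x \<in> S" using S_scale[OF assms, of "-1"] by simp
  from triangle[OF assms this] show ?thesis using N_minus[OF assms] by simp
qed

lemma N_diff: "x \<in> S \<Longrightarrow> y \<in> S \<Longrightarrow> N (x - y) \<le> N x + N y"
  using triangle[of x "- y"] N_minus[of y] S_scale[of y "-1"] by simp

lemma N_diff_ge: "x \<in> S \<Longrightarrow> y \<in> S \<Longrightarrow> N x - N y \<le> N (x - y)"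
  using triangle[of "x - y" y] by simp

lemma N_trans: "x \<in> S \<Longrightarrow> y \<in> S \<Longrightarrow> z \<in> S \<Longrightarrow> N (x - z) \<le> N (x - y) + N (y - z)"
  using triangle[of "x - y" "y - z"] by simp

text \<open>This and the next two rules stand in for substitution of equals: under \<open>N\<close>,
  an element may be exchanged for one at distance 0.\<close>

lemma N_null_right: "x \<in> S \<Longrightarrow> y \<in> S \<Longrightarrow> z \<in> S \<Longrightarrow> N (y - z) = 0 \<Longrightarrow> N (x - y) = N (x - z)"
  using N_trans[of x y z] N_trans[of x z y] N_commute[of y z] by simp

lemma N_null_left: "x \<in> S \<Longrightarrow> y \<in> S \<Longrightarrow> z \<in> S \<Longrightarrow> N (y - z) = 0 \<Longrightarrow> N (y - x) = N (z - x)"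
  using N_null_right[of x y z] N_commute by simp

lemma N_null: "y \<in> S \<Longrightarrow> z \<in> S \<Longrightarrow> N (y - z) = 0 \<Longrightarrow> N y = N z"
  using N_null_left[of 0 y z] by simp

lemma N_sum_le: "finite I \<Longrightarrow> (\<And>i. i \<in> I \<Longrightarrow> f i \<in> S) \<Longrightarrow> N (sum f I) \<le> (\<Sum>i\<in>I. N (f i))"
proof (induction I rule: finite_induct)
  case (insert a I)
  have "N (sum f (insert a I)) \<le> N (f a) + N (sum f I)"
    using insert by (simp add: triangle S_sum)
  then show ?case using insert by fastforce
qed simp

lemma N_sum_diff_le:
  assumes "finite I" "\<And>i. i \<in> I \<Longrightarrow> f i \<in> S" "\<And>i. i \<in> I \<Longrightarrow> g i \<in> S" "\<And>i. i \<in> I \<Longrightarrow> N (f i - g i) \<le> b"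
  shows "N (sum f I - sum g I) \<le> real (card I) * b"
proof -
  have "N (sum f I - sum g I) = N (\<Sum>i\<in>I. f i - g i)" by (simp add: sum_subtractf)
  also have "\<dots> \<le> (\<Sum>i\<in>I. N (f i - g i))" using assms by (intro N_sum_le) auto
  also have "\<dots> \<le> (\<Sum>i\<in>I. b)" using assms by (intro sum_mono) auto
  finally show ?thesis by simp
qed

end

locale complete_seminormed = seminormed +
  assumes complete: "(\<And>n::nat. X n \<in> S) \<Longrightarrow>
    (\<And>e. e > 0 \<Longrightarrow> \<exists>n0. \<forall>m\<ge>n0. \<forall>n\<ge>n0. N (X m - X n) < e) \<Longrightarrow>
    \<exists>x\<in>S. (\<lambda>n. N (X n - x)) \<longlonglongrightarrow> 0"
begin

lemma limit_dist_le:
  assumes X: "\<And>n::nat. X n \<in> S" and x: "x \<in> S" and y: "y \<in> S" and lim: "(\<lambda>n. N (X n - x)) \<longlonglongrightarrow> 0"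
    and le: "eventually (\<lambda>n. N (X n - y) \<le> b) sequentially"
  shows "N (x - y) \<le> b"
proof -
  have "(\<lambda>n. N (X n - x) + b) \<longlonglongrightarrow> 0 + b" by (intro tendsto_intros lim)
  moreover have "eventually (\<lambda>n. N (x - y) \<le> N (X n - x) + b) sequentially"
    using le proof eventually_elim
    case (elim n)
    then show ?case using N_trans[OF x X y, of n] N_commute[OF x X, of n] by simp
  qed
  ultimately show ?thesis by (simp add: tendsto_lowerbound)
qed

text \<open>Banach-Steinhaus by nested balls. Without a common bound, every ball contains a smaller
  one on which some \<open>q i\<close> is at least \<open>n\<close>; by completeness the balls
  shrink to a point at which the \<open>q i\<close> are unbounded.\<close>

lemma uniform_boundedness:
  fixes q :: "'i \<Rightarrow> 'a \<Rightarrow> real"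
  assumes tri: "\<And>i x y. i \<in> I \<Longrightarrow> x \<in> S \<Longrightarrow> y \<in> S \<Longrightarrow> q i (x + y) \<le> q i x + q i y"
    and sc: "\<And>i x c. i \<in> I \<Longrightarrow> x \<in> S \<Longrightarrow> q i (c *\<^sub>R x) = \<bar>c\<bar> * q i x"
    and cont: "\<And>i. i \<in> I \<Longrightarrow> \<exists>M. \<forall>x\<in>S. q i x \<le> M * N x"
    and ptw: "\<And>x. x \<in> S \<Longrightarrow> \<exists>C. \<forall>i\<in>I. q i x \<le> C"
  shows "\<exists>M. \<forall>i\<in>I. \<forall>x\<in>S. q i x \<le> M * N x"
proof (rule ccontr)
  assume contr: "\<not> ?thesis"
  \<comment> \<open>A large quotient becomes a large value on a small vector by rescaling to
    seminorm \<open>r\<close>. Continuity of \<open>q i\<close> rules out \<open>N z = 0\<close>,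
    where rescaling would fail.\<close>
  have big: "\<exists>i\<in>I. \<exists>z\<in>S. N z \<le> r \<and> q i z > A" if r: "r > 0" for A r
  proof -
    obtain i z where i: "i \<in> I" and z: "z \<in> S" and gt: "q i z > (\<bar>A\<bar> + 1) / r * N z"
      using contr by (meson not_le)
    interpret q: seminormed S "q i"
      using subspace_S tri sc i by unfold_locales auto
    obtain M where M: "\<forall>x\<in>S. q i x \<le> M * N x" using cont i by blast
    have "0 \<le> N z" using N_nonneg z by simp
    have "N z \<noteq> 0"
    proof
      assume "N z = 0" then show False using gt M z by fastforce
    qed
    with \<open>0 \<le> N z\<close> have pos: "N z > 0" by simp
    define z' where "z' = (r / N z) *\<^sub>R z"
    have "N z' = r" using pos r z by (simp add: z'_def scale)
    moreover have "q i z' = r / N z * q i z" using pos r z i by (simp add: z'_def sc)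
    moreover have "r / N z * q i z > r / N z * ((\<bar>A\<bar> + 1) / r * N z)"
      using gt pos r by (intro mult_strict_left_mono) auto
    moreover have "r / N z * ((\<bar>A\<bar> + 1) / r * N z) = \<bar>A\<bar> + 1" using pos r by simp
    ultimately have "q i z' > A" by linarith
    moreover have "z' \<in> S" using z by (simp add: z'_def)
    ultimately show ?thesis using i \<open>N z' = r\<close> by force
  qed
  \<comment> \<open>A pair is a centre with a radius. The two halves in the first two conditions
    place the ball \<open>b\<close> inside the ball \<open>a\<close>.\<close>
  define good where "good = (\<lambda>n (a::'a \<times> real) b. N (fst b - fst a) \<le> snd a / 2 \<and> snd b \<le> snd a / 2 \<and>
      (\<exists>i\<in>I. \<forall>y\<in>S. N (y - fst b) \<le> snd b \<longrightarrow> q i y \<ge> real n))"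
  define P where "P = (\<lambda>(n::nat) (a::'a \<times> real). fst a \<in> S \<and> snd a > 0)"
  have step: "\<exists>b. P (Suc n) b \<and> good n a b" if "P n a" for n a
  proof -
    obtain x r where a: "a = (x, r)" by force
    with that have x: "x \<in> S" and r: "r > 0" by (auto simp: P_def)
    obtain i z where i: "i \<in> I" and z: "z \<in> S" "N z \<le> r / 2" and gt: "q i z > real n + 1"
      using big[of "r/2" "real n + 1"] r by auto
    interpret q: seminormed S "q i"
      using subspace_S tri sc i by unfold_locales auto
    obtain M where M: "\<forall>x\<in>S. q i x \<le> M * N x" using cont i by blast
    \<comment> \<open>\<open>2 z\<close> is the difference of \<open>x + z\<close> and
      \<open>x - z\<close>, both within \<open>r / 2\<close> of \<open>x\<close>, so
      \<open>q i\<close> exceeds \<open>n + 1\<close> at one of them.\<close>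
    have "2 * q i z = q i ((x + z) - (x - z))" using sc[OF i z(1), of 2] by (simp add: scaleR_2)
    also have "\<dots> \<le> q i (x + z) + q i (x - z)" using x z by (intro q.N_diff) auto
    finally have "q i (x + z) > real n + 1 \<or> q i (x - z) > real n + 1" using gt by linarith
    then obtain x' where x': "x' \<in> S" "N (x' - x) \<le> r / 2" "q i x' > real n + 1"
    proof
      assume *: "q i (x + z) > real n + 1" show thesis
        by (rule that[OF _ _ *]) (use x z in auto)
    next
      assume *: "q i (x - z) > real n + 1" show thesis
        by (rule that[OF _ _ *]) (use x z in \<open>auto simp: N_minus\<close>)
    qed
    \<comment> \<open>Within this radius continuity of \<open>q i\<close> costs at most 1, which
      lowers \<open>n + 1\<close> to \<open>n\<close>.\<close>
    define r' where "r' = min (r/2) (1 / (\<bar>M\<bar> + 1))"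
    have r': "r' > 0" "r' \<le> r/2" "r' \<le> 1 / (\<bar>M\<bar> + 1)" using r by (auto simp: r'_def)
    have "q i y \<ge> real n" if "y \<in> S" "N (y - x') \<le> r'" for y
    proof -
      have "q i x' - q i y \<le> q i (x' - y)" using x' that by (intro q.N_diff_ge) auto
      also have "\<dots> \<le> M * N (y - x')" using M x' that N_commute[of y x'] by fastforce
      also have "\<dots> \<le> (\<bar>M\<bar> + 1) * N (y - x')" using x' that by (intro mult_right_mono N_nonneg) auto
      also have "\<dots> \<le> (\<bar>M\<bar> + 1) * (1 / (\<bar>M\<bar> + 1))" using that r' by (intro mult_left_mono) auto
      also have "\<dots> = 1" by (simp add: field_simps)
      finally show ?thesis using x' by linarith
    qed
    then show ?thesis using x' r' i by (intro exI[of _ "(x', r')"]) (auto simp: P_def good_def a)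
  qed
  have "\<exists>a. P 0 a" by (intro exI[of _ "(0, 1)"]) (auto simp: P_def)
  then obtain f where f: "\<And>n. P n (f n)" "\<And>n. good n (f n) (f (Suc n))"
    using dependent_nat_choice[of P good] step by blast
  define X where "X = (\<lambda>n. fst (f n))"
  define r where "r = (\<lambda>n. snd (f n))"
  have XS: "X n \<in> S" and rpos: "r n > 0" for n using f(1) by (auto simp: P_def X_def r_def)
  have st: "N (X (Suc n) - X n) \<le> r n / 2" "r (Suc n) \<le> r n / 2"
    "\<exists>i\<in>I. \<forall>y\<in>S. N (y - X (Suc n)) \<le> r (Suc n) \<longrightarrow> q i y \<ge> real n" for n
    using f(2)[of n] by (auto simp: good_def X_def r_def)
  \<comment> \<open>Subtracting \<open>r (n + k)\<close> leaves room for the next induction step;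
    all later centres still lie in the \<open>n\<close>-th ball.\<close>
  have nest: "N (X (n + k) - X n) \<le> r n - r (n + k)" for n k
  proof (induction k)
    case (Suc k)
    have "N (X (n + Suc k) - X n) \<le> N (X (Suc (n + k)) - X (n + k)) + N (X (n + k) - X n)"
      using N_trans[OF XS XS XS] by simp
    also have "\<dots> \<le> r (n + k) / 2 + (r n - r (n + k))" using st Suc by (intro add_mono) auto
    also have "\<dots> \<le> r n - r (n + Suc k)" using st(2)[of "n + k"] by simp
    finally show ?case .
  qed simp
  have rsmall: "r n \<le> r 0 / 2 ^ n" for n
  proof (induction n)
    case (Suc n)
    have "r (Suc n) \<le> r 0 / 2 ^ n / 2" using st(2)[of n] Suc by simp
    then show ?case by (simp add: mult.commute)
  qed simp
  have "(\<lambda>n. r 0 * (1/2) ^ n) \<longlonglongrightarrow> r 0 * 0" by (intro tendsto_intros LIMSEQ_power_zero) auto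
  then have r0: "(\<lambda>n. r 0 * (1/2) ^ n) \<longlonglongrightarrow> 0" by simp
  have "\<exists>x\<in>S. (\<lambda>n. N (X n - x)) \<longlonglongrightarrow> 0"
  proof (rule complete[OF XS])
    fix e :: real assume e: "e > 0"
    obtain n0 where n0: "r 0 * (1/2) ^ n0 < e / 2"
      using order_tendstoD(2)[OF r0, of "e/2"] e by (auto simp: eventually_sequentially)
    have "N (X n - X n0) < e / 2" if "n \<ge> n0" for n
    proof -
      have "r 0 * (1/2) ^ n0 = r 0 / 2 ^ n0" by (simp add: power_one_over)
      then have "r n0 < e / 2" using n0 rsmall[of n0] by linarith
      then show ?thesis using nest[of n0 "n - n0"] that rpos[of n] by simp
    qed
    then have "N (X m - X n) < e" if "m \<ge> n0" "n \<ge> n0" for m n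
      using N_trans[OF XS[of m] XS[of n0] XS[of n]] N_commute[OF XS[of n0] XS[of n]] that
      by (smt (verit) field_sum_of_halves)
    then show "\<exists>n0. \<forall>m\<ge>n0. \<forall>n\<ge>n0. N (X m - X n) < e" by blast
  qed
  then obtain x where x: "x \<in> S" "(\<lambda>n. N (X n - x)) \<longlonglongrightarrow> 0" by blast
  have inball: "N (x - X n) \<le> r n" for n
  proof (rule limit_dist_le[OF XS x(1) XS x(2)])
    have "N (X m - X n) \<le> r n" if "m \<ge> n" for m
      using nest[of n "m - n"] that rpos[of m] by simp
    then show "\<forall>\<^sub>F m in sequentially. N (X m - X n) \<le> r n"
      using eventually_sequentially by blast
  qed
  obtain C where C: "\<forall>i\<in>I. q i x \<le> C" using ptw x by blast
  obtain n where "real n > C" using reals_Archimedean2 by blast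
  then show False using st(3)[of n] inball[of "Suc n"] x C by fastforce
qed

end

section \<open>Strongly continuous semigroups on seminormed spaces\<close>

locale strong_semigroup = complete_seminormed S N for S :: "'a::real_vector set" and N +
  fixes T :: "real \<Rightarrow> 'a \<Rightarrow> 'a"
  assumes closed: "t \<ge> 0 \<Longrightarrow> x \<in> S \<Longrightarrow> T t x \<in> S"
    and add: "t \<ge> 0 \<Longrightarrow> x \<in> S \<Longrightarrow> y \<in> S \<Longrightarrow> N (T t (x + y) - (T t x + T t y)) = 0"
    and homogeneous: "t \<ge> 0 \<Longrightarrow> x \<in> S \<Longrightarrow> N (T t (c *\<^sub>R x) - c *\<^sub>R T t x) = 0"
    and bounded: "t \<ge> 0 \<Longrightarrow> \<exists>M. \<forall>x\<in>S. N (T t x) \<le> M * N x"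
    and T_0: "x \<in> S \<Longrightarrow> N (T 0 x - x) = 0"
    and T_add: "t \<ge> 0 \<Longrightarrow> s \<ge> 0 \<Longrightarrow> x \<in> S \<Longrightarrow> N (T (t + s) x - T t (T s x)) = 0"
    and continuous: "x \<in> S \<Longrightarrow> ((\<lambda>t. N (T t x - x)) \<longlongrightarrow> 0) (at_right 0)"
begin

definition generator_at :: "'a \<Rightarrow> 'a \<Rightarrow> bool" where
  "generator_at x y \<longleftrightarrow> ((\<lambda>h. N ((1 / h) *\<^sub>R (T h x - x) - y)) \<longlongrightarrow> 0) (at_right 0)"

lemma N_T_diff: assumes "t \<ge> 0" "x \<in> S" "y \<in> S" shows "N (T t x - T t y) = N (T t (x - y))"
proof -
  have "N (T t (x + (-1) *\<^sub>R y) - (T t x + T t ((-1) *\<^sub>R y))) = 0"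
    using assms add[of t x "(-1) *\<^sub>R y"] S_scale[of y "-1"] by simp
  then have 1: "N (T t (x - y)) = N (T t x + T t ((-1) *\<^sub>R y))"
    using assms closed S_scale[of y "-1"] N_null[of "T t (x - y)" "T t x + T t (- y)"] by simp
  have "N (T t ((-1) *\<^sub>R y) - (-1) *\<^sub>R T t y) = 0" using homogeneous assms by blast
  then have "N ((T t x + T t ((-1) *\<^sub>R y)) - (T t x - T t y)) = 0" by (simp add: algebra_simps)
  then have "N (T t x + T t ((-1) *\<^sub>R y)) = N (T t x - T t y)"
    using assms closed S_scale[of y "-1"] by (intro N_null) auto
  with 1 show ?thesis by simp
qed

lemma N_T_sum: assumes t: "t \<ge> 0" and f: "\<And>i::nat. i < n \<Longrightarrow> f i \<in> S"
  shows "N (T t (\<Sum>i<n. f i) - (\<Sum>i<n. T t (f i))) = 0"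
  using f
proof (induction n)
  case 0
  have "N (T t (0 *\<^sub>R 0) - 0 *\<^sub>R T t 0) = 0" using homogeneous t S_zero by blast
  then show ?case by simp
next
  case (Suc n)
  have S: "(\<Sum>i<n. f i) \<in> S" "f n \<in> S" "(\<Sum>i<n. T t (f i)) \<in> S" "T t (\<Sum>i<n. f i) \<in> S" "T t (f n) \<in> S"
    using Suc.prems t by (auto intro!: closed S_sum)
  have IH: "N (T t (\<Sum>i<n. f i) - (\<Sum>i<n. T t (f i))) = 0" using Suc by simp
  have "N (T t ((\<Sum>i<n. f i) + f n) - ((\<Sum>i<n. T t (f i)) + T t (f n)))
      = N (T t ((\<Sum>i<n. f i) + f n) - (T t (\<Sum>i<n. f i) + T t (f n)))"
    using S t closed IH N_commute[OF S(3,4)] by (intro N_null_right) auto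
  also have "\<dots> = 0" using add[OF t S(1,2)] .
  finally show ?case by simp
qed

lemma N_T_scale_sum: assumes "t \<ge> 0" and "\<And>i::nat. i < n \<Longrightarrow> f i \<in> S"
  shows "N (T t (c *\<^sub>R (\<Sum>i<n. f i)) - c *\<^sub>R (\<Sum>i<n. T t (f i))) = 0"
proof -
  have S: "(\<Sum>i<n. f i) \<in> S" "(\<Sum>i<n. T t (f i)) \<in> S" using assms by (auto intro!: closed S_sum)
  have "N (T t (c *\<^sub>R (\<Sum>i<n. f i)) - c *\<^sub>R (\<Sum>i<n. T t (f i)))
     \<le> N (T t (c *\<^sub>R (\<Sum>i<n. f i)) - c *\<^sub>R T t (\<Sum>i<n. f i)) + N (c *\<^sub>R T t (\<Sum>i<n. f i) - c *\<^sub>R (\<Sum>i<n. T t (f i)))"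
    using S assms closed by (intro N_trans) auto
  also have "\<dots> = 0" using homogeneous[OF assms(1) S(1)] scale[of "T t (\<Sum>i<n. f i) - (\<Sum>i<n. T t (f i))" c]
      N_T_sum[OF assms] S assms closed by (simp add: scaleR_diff_right)
  finally show ?thesis using N_nonneg S assms closed by (metis S_diff S_scale order_antisym)
qed

lemma N_T_shift: assumes "t \<ge> 0" "s \<ge> 0" "x \<in> S" "y \<in> S"
  shows "N (T (t + s) x - T t y) = N (T t (T s x - y))"
  using N_null_left[OF _ _ _ T_add[OF assms(1-3)], of "T t y"] N_T_diff[of t "T s x" y] assms closed by simp

section \<open>Bounds for the semigroup and its resolvent\<close>

text \<open>Otherwise there are times \<open>t n\<close> tending to 0 for which no bound below
  \<open>n\<close> holds. By strong continuity each orbit along \<open>t n\<close> converges and is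
  bounded, so uniform boundedness yields a contradiction.\<close>

lemma bounded_near_0: "\<exists>M\<ge>1. \<exists>d>0. \<forall>t\<in>{0..d}. \<forall>x\<in>S. N (T t x) \<le> M * N x"
proof (rule ccontr)
  assume contr: "\<not> ?thesis"
  have unbounded: "\<exists>t\<in>{0..d}. \<exists>x\<in>S. N (T t x) > M * N x" if "M \<ge> 1" "d > 0" for M d
  proof (rule ccontr)
    assume "\<not> ?thesis"
    then have "\<forall>t\<in>{0..d}. \<forall>x\<in>S. N (T t x) \<le> M * N x" by (simp add: not_less)
    with that have "\<exists>M\<ge>1. \<exists>d>0. \<forall>t\<in>{0..d}. \<forall>x\<in>S. N (T t x) \<le> M * N x"
      by (intro exI[of _ M] exI[of _ d] conjI)
    with contr show False by contradiction
  qed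
  have "\<exists>t. 0 < t \<and> t \<le> 1 / real (Suc n) \<and> (\<exists>x\<in>S. N (T t x) > real (Suc n) * N x)" for n
  proof -
    obtain t x where t: "0 \<le> t" "t \<le> 1 / real (Suc n)" and x: "x \<in> S" "N (T t x) > real (Suc n) * N x"
      using unbounded[of "real (Suc n)" "1 / real (Suc n)"] by auto
    \<comment> \<open>\<open>T 0\<close> is the identity up to null elements and cannot enlarge the
      seminorm. Positivity is needed because continuity is stated along
      \<open>at_right 0\<close>.\<close>
    have "t \<noteq> 0"
    proof
      assume "t = 0"
      then have "N (T t x) = N x" using T_0[OF x(1)] x closed by (intro N_null) auto
      moreover have "N x \<le> real (Suc n) * N x" using N_nonneg[OF x(1)] by (simp add: algebra_simps)
      ultimately show False using x by simp
    qed
    then have "0 < t" using t by simp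
    then show ?thesis using t x by blast
  qed
  then obtain t where t: "\<And>n. 0 < t n" "\<And>n. t n \<le> 1 / real (Suc n)"
    "\<And>n. \<exists>x\<in>S. N (T (t n) x) > real (Suc n) * N x" by metis
  have t0: "t \<longlonglongrightarrow> 0"
    by (rule tendsto_sandwich[OF _ _ tendsto_const LIMSEQ_Suc[OF lim_1_over_n]]) (use t(1,2) in \<open>auto intro!: always_eventually less_imp_le\<close>)
  have "t n \<in> {0<..} \<and> t n \<noteq> 0" for n using t(1)[of n] by auto
  with t0 have tr: "filterlim t (at_right 0) sequentially"
    by (simp only: filterlim_at eventually_True simp_thms)
  have "\<exists>M. \<forall>n\<in>UNIV. \<forall>x\<in>S. N (T (t n) x) \<le> M * N x"
  proof (rule uniform_boundedness)
    fix i x y assume x: "x \<in> S" "y \<in> S"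
    have *: "t i \<ge> 0" using t(1) less_imp_le by blast
    have "N (T (t i) (x + y)) = N (T (t i) x + T (t i) y)"
      by (rule N_null) (use * x add closed in auto)
    then show "N (T (t i) (x + y)) \<le> N (T (t i) x) + N (T (t i) y)"
      using triangle closed x * by simp
  next
    fix i x c assume x: "x \<in> S"
    have *: "t i \<ge> 0" using t(1) less_imp_le by blast
    have "N (T (t i) (c *\<^sub>R x)) = N (c *\<^sub>R T (t i) x)"
      by (rule N_null) (use * x homogeneous closed in auto)
    then show "N (T (t i) (c *\<^sub>R x)) = \<bar>c\<bar> * N (T (t i) x)"
      using scale closed x * by simp
  next
    fix i show "\<exists>M. \<forall>x\<in>S. N (T (t i) x) \<le> M * N x" using bounded t(1) less_imp_le by blast
  next
    fix x assume x: "x \<in> S"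
    have "(\<lambda>n. N (T (t n) x - x)) \<longlonglongrightarrow> 0" using filterlim_compose[OF continuous[OF x] tr] .
    then have "Bseq (\<lambda>n. N (T (t n) x - x))" by (intro convergent_imp_Bseq convergentI)
    then obtain C where C: "\<And>n. norm (N (T (t n) x - x)) \<le> C" by (auto simp: Bseq_def)
    have "N (T (t n) x) \<le> C + N x" for n
      using C[of n] N_diff_ge[of "T (t n) x" x] x closed[of "t n" x] t(1)[of n] by simp
    then show "\<exists>C. \<forall>n\<in>UNIV. N (T (t n) x) \<le> C" by blast
  qed
  then obtain M where M: "\<And>n x. x \<in> S \<Longrightarrow> N (T (t n) x) \<le> M * N x" by blast
  obtain n where n: "real n > M" using reals_Archimedean2 by blast
  obtain x where x: "x \<in> S" "N (T (t n) x) > real (Suc n) * N x" using t(3) by blast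
  have "M * N x \<le> real (Suc n) * N x" using n N_nonneg[OF x(1)] by (intro mult_right_mono) auto
  with x M[OF x(1), of n] show False by linarith
qed

text \<open>Every time in {0..1} splits into \<open>k + 1\<close> equal steps of length at most
  \<open>d\<close>, each costing a factor \<open>M\<close>.\<close>

lemma bounded_on_unit: "\<exists>M\<ge>1. \<forall>t\<in>{0..1}. \<forall>x\<in>S. N (T t x) \<le> M * N x"
proof -
  obtain M d where M: "M \<ge> 1" and d: "d > 0" and b: "\<forall>t\<in>{0..d}. \<forall>x\<in>S. N (T t x) \<le> M * N x"
    using bounded_near_0 by blast
  have pow: "N (T (real (Suc k) * t) x) \<le> M ^ Suc k * N x" if "t \<in> {0..d}" "x \<in> S" for k t x
  proof (induction k)
    case 0 then show ?case using that b by simp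
  next
    case (Suc k)
    have t: "t \<ge> 0" using that by simp
    have e: "real (Suc (Suc k)) * t = t + real (Suc k) * t" by (simp add: algebra_simps)
    have "N (T (real (Suc (Suc k)) * t) x) = N (T t (T (real (Suc k) * t) x))"
      unfolding e using that t closed by (intro N_null T_add) auto
    also have "\<dots> \<le> M * N (T (real (Suc k) * t) x)" using b that closed by auto
    also have "\<dots> \<le> M * (M ^ Suc k * N x)" using Suc M by (intro mult_left_mono) auto
    finally show ?case by simp
  qed
  obtain k where k: "real k > 1 / d" using reals_Archimedean2 by blast
  have "N (T t x) \<le> M ^ Suc k * N x" if "t \<in> {0..1}" "x \<in> S" for t x
  proof -
    have "t / real (Suc k) \<le> 1 / real (Suc k)" using that by (simp add: divide_right_mono)
    also have "\<dots> \<le> d" using k d by (simp add: field_simps)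
    finally show ?thesis using pow[of "t / real (Suc k)" x k] that by simp
  qed
  then show ?thesis using M by (intro exI[of _ "M ^ Suc k"]) (auto simp: one_le_power simp del: power_Suc)
qed

text \<open>A discrete form of the identity that writes \<open>x - exp (- la) T 1 x\<close> as the
  integral over {0..1} of \<open>exp (- la s) T s (la x - y)\<close>. The integral has seminorm at
  most \<open>M / la * N (la x - y)\<close>, and \<open>M * exp (- la) <= 1 / 2\<close> leaves at
  least \<open>N x / 2\<close> on the left.\<close>

lemma resolvent_estimate:
  assumes M: "M \<ge> 1" "\<forall>t\<in>{0..1}. \<forall>x\<in>S. N (T t x) \<le> M * N x"
    and x: "x \<in> S" and y: "y \<in> S" and gen: "generator_at x y"
    and la: "la > 0" "M * exp (- la) \<le> 1 / 2"
  shows "N x \<le> 2 * M / la * N (la *\<^sub>R x - y)"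
proof -
  have main: "N x / 2 \<le> M / la * (N (la *\<^sub>R x - y) + \<bar>(exp (la * h) - 1) / h - la\<bar> * N x
      + N ((1 / h) *\<^sub>R (T h x - x) - y))" if h: "h = 1 / real n" and n: "n > 0" for h n
  proof -
    have hp: "h > 0" using h n by simp
    define q where "q = exp (- la * h)"
    have q: "0 < q" "q < 1" using la hp by (auto simp: q_def)
    define D where "D = x - q *\<^sub>R T h x"
    have Th: "T h x \<in> S" using closed x hp by simp
    have DS: "D \<in> S" using Th x by (simp add: D_def)
    \<comment> \<open>Telescoping along the grid: passing from \<open>k\<close> to
      \<open>k + 1\<close> contributes \<open>q ^ k\<close> times \<open>T (k h) D\<close>, and
      \<open>k h <= 1\<close> makes the bound \<open>M\<close> available.\<close>
    have tel: "N (x - q ^ k *\<^sub>R T (real k * h) x) \<le> (\<Sum>i<k. q ^ i) * (M * N D)" if "k \<le> n" for k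
      using that
    proof (induction k)
      case 0
      have "N (x - T 0 x) = 0" using T_0[OF x] N_commute x closed by simp
      then show ?case by simp
    next
      case (Suc k)
      have kh: "real k * h \<ge> 0" "real k * h \<le> 1" using Suc.prems hp n by (auto simp: h field_simps)
      have eq: "real (Suc k) * h = real k * h + h" by (simp add: algebra_simps)
      have Tk: "T (real k * h) x \<in> S" "T (real (Suc k) * h) x \<in> S" "T (real k * h) (q *\<^sub>R T h x) \<in> S"
          "T (real k * h) (T h x) \<in> S"
        using closed x kh hp Th by auto
      have n1: "N (T (real k * h) (q *\<^sub>R T h x) - q *\<^sub>R T (real k * h) (T h x)) = 0"
        using homogeneous kh Th by blast
      have n2: "N (q *\<^sub>R T (real (Suc k) * h) x - q *\<^sub>R T (real k * h) (T h x)) = 0"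
        using T_add[of "real k * h" h x] kh hp x Tk scale[of "T (real (Suc k) * h) x - T (real k * h) (T h x)" q]
        unfolding eq by (simp add: scaleR_diff_right)
      have "N (T (real k * h) x - q *\<^sub>R T (real (Suc k) * h) x) = N (T (real k * h) x - q *\<^sub>R T (real k * h) (T h x))"
        using n2 Tk by (intro N_null_right) auto
      also have "\<dots> = N (T (real k * h) x - T (real k * h) (q *\<^sub>R T h x))"
        using n1 Tk by (intro N_null_right[symmetric]) auto
      also have "\<dots> = N (T (real k * h) D)" using N_T_diff[of "real k * h" x "q *\<^sub>R T h x"] kh x Th by (simp add: D_def)
      also have "\<dots> \<le> M * N D" using M kh DS by auto
      finally have 1: "N (T (real k * h) x - q *\<^sub>R T (real (Suc k) * h) x) \<le> M * N D" .
      have "N (x - q ^ Suc k *\<^sub>R T (real (Suc k) * h) x) =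
          N ((x - q ^ k *\<^sub>R T (real k * h) x) + q ^ k *\<^sub>R (T (real k * h) x - q *\<^sub>R T (real (Suc k) * h) x))"
        by (simp add: algebra_simps)
      also have "\<dots> \<le> N (x - q ^ k *\<^sub>R T (real k * h) x) + N (q ^ k *\<^sub>R (T (real k * h) x - q *\<^sub>R T (real (Suc k) * h) x))"
        using Tk x by (intro triangle) auto
      also have "N (q ^ k *\<^sub>R (T (real k * h) x - q *\<^sub>R T (real (Suc k) * h) x)) = q ^ k * N (T (real k * h) x - q *\<^sub>R T (real (Suc k) * h) x)"
        using Tk q by (subst scale) auto
      also have "\<dots> \<le> q ^ k * (M * N D)" using 1 q by (intro mult_left_mono) auto
      finally show ?case using Suc by (simp add: algebra_simps)
    qed
    have qn: "q ^ n = exp (- la)" using n by (simp add: q_def h flip: exp_of_nat_mult)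
    have nh: "real n * h = 1" using n h by simp
    have T1: "T 1 x \<in> S" using closed x by simp
    have "N x / 2 \<le> N x - exp (- la) * (M * N x)" 
      using mult_right_mono[OF la(2) N_nonneg[OF x]] by (simp add: algebra_simps)
    also have "\<dots> \<le> N x - exp (- la) * N (T 1 x)" using M x by (intro diff_mono mult_left_mono) auto
    also have "\<dots> = N x - N (exp (- la) *\<^sub>R T 1 x)" using T1 by (simp add: scale)
    also have "\<dots> \<le> N (x - exp (- la) *\<^sub>R T 1 x)" using x T1 by (intro N_diff_ge) auto
    also have "\<dots> \<le> (\<Sum>i<n. q ^ i) * (M * N D)" using tel[of n] qn nh by simp
    also have "(\<Sum>i<n. q ^ i) \<le> 1 / (1 - q)" using q by (simp add: sum_gp_strict divide_right_mono)
    finally have a: "N x / 2 \<le> 1 / (1 - q) * (M * N D)"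
      using M N_nonneg[OF DS] by (simp add: mult_right_mono)
    \<comment> \<open>\<open>c\<close> is the difference quotient of \<open>exp (la h)\<close> at 0.
      It makes the decomposition of \<open>D\<close> below exact: \<open>q h\<close> times
      \<open>la x - y\<close>, plus one error that vanishes because \<open>c\<close> tends to
      \<open>la\<close> and one that vanishes because \<open>y\<close> is the generator's value at
      \<open>x\<close>.\<close>
    define c where "c = (exp (la * h) - 1) / h"
    have qe: "q * exp (la * h) = 1" by (simp add: q_def flip: exp_add)
    have "(q * h) *\<^sub>R ((la *\<^sub>R x - y) + (c - la) *\<^sub>R x - ((1 / h) *\<^sub>R (T h x - x) - y))
        = (q * h * c) *\<^sub>R x - q *\<^sub>R (T h x - x)" using hp by (simp add: algebra_simps)
    also have "q * h * c = q * (h * c)" by simp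
    also have "h * c = exp (la * h) - 1" using hp by (simp add: c_def)
    also have "q * (exp (la * h) - 1) = 1 - q" using qe by (simp add: algebra_simps)
    finally have D: "D = (q * h) *\<^sub>R ((la *\<^sub>R x - y) + (c - la) *\<^sub>R x - ((1 / h) *\<^sub>R (T h x - x) - y))"
      by (simp add: D_def algebra_simps)
    have "N ((la *\<^sub>R x - y) + (c - la) *\<^sub>R x - ((1 / h) *\<^sub>R (T h x - x) - y))
        \<le> N ((la *\<^sub>R x - y) + (c - la) *\<^sub>R x) + N ((1 / h) *\<^sub>R (T h x - x) - y)"
      using x y Th by (intro N_diff) auto
    also have "N ((la *\<^sub>R x - y) + (c - la) *\<^sub>R x) \<le> N (la *\<^sub>R x - y) + N ((c - la) *\<^sub>R x)"
      using x y by (intro triangle) auto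
    also have "N ((c - la) *\<^sub>R x) = \<bar>c - la\<bar> * N x" using x by (simp add: scale)
    finally have "N D \<le> q * h * (N (la *\<^sub>R x - y) + \<bar>c - la\<bar> * N x + N ((1 / h) *\<^sub>R (T h x - x) - y))"
      (is "_ \<le> _ * ?R") unfolding D using x y Th q hp by (subst scale) (auto intro!: mult_left_mono)
    then have "1 / (1 - q) * (M * N D) \<le> 1 / (1 - q) * (M * (q * h * ?R))"
      using q M by (intro mult_left_mono) auto
    also have "\<dots> = (q * h / (1 - q)) * (M * ?R)" by simp
    also have "q * h / (1 - q) \<le> 1 / la"
    proof -
      have "1 + la * h \<le> exp (la * h)" by (rule exp_ge_add_one_self)
      then have "q * (1 + la * h) \<le> 1" using q mult_left_mono[of "1 + la * h" "exp (la * h)" q] qe by simp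
      then show ?thesis using q la by (simp add: field_simps)
    qed
    then have "(q * h / (1 - q)) * (M * ?R) \<le> 1 / la * (M * ?R)"
      using M N_nonneg x y Th by (intro mult_right_mono) auto
    finally have "1 / (1 - q) * (M * N D) \<le> 1 / la * (M * ?R)" .
    from order_trans[OF a this] show ?thesis by (simp add: c_def)
  qed
  have tr: "filterlim (\<lambda>n. 1 / real n) (at_right 0) sequentially"
    using lim_1_over_n by (auto simp: filterlim_at eventually_sequentially intro!: exI[of _ 1])
  have "((\<lambda>h::real. (exp (la * h) - 1) / h) \<longlongrightarrow> la) (at 0)"
  proof -
    have "((\<lambda>h. exp (la * h)) has_real_derivative la) (at 0)"
      by (auto intro!: derivative_eq_intros)
    then show ?thesis by (simp add: DERIV_def)
  qed
  then have "((\<lambda>h::real. (exp (la * h) - 1) / h) \<longlongrightarrow> la) (at_right 0)"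
    using filterlim_at_split by blast
  then have l1: "((\<lambda>h::real. \<bar>(exp (la * h) - 1) / h - la\<bar> * N x) \<longlongrightarrow> \<bar>la - la\<bar> * N x) (at_right 0)"
    by (intro tendsto_intros)
  have "((\<lambda>h. M / la * (N (la *\<^sub>R x - y) + \<bar>(exp (la * h) - 1) / h - la\<bar> * N x
      + N ((1 / h) *\<^sub>R (T h x - x) - y))) \<longlongrightarrow> M / la * (N (la *\<^sub>R x - y) + \<bar>la - la\<bar> * N x + 0)) (at_right 0)"
    by (intro tendsto_intros l1 gen[unfolded generator_at_def])
  from filterlim_compose[OF this tr]
  have "(\<lambda>n. M / la * (N (la *\<^sub>R x - y) + \<bar>(exp (la * (1 / real n)) - 1) / (1 / real n) - la\<bar> * N x
      + N ((1 / (1 / real n)) *\<^sub>R (T (1 / real n) x - x) - y))) \<longlonglongrightarrow> M / la * N (la *\<^sub>R x - y)" by simp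
  moreover have "eventually (\<lambda>n. N x / 2 \<le> M / la * (N (la *\<^sub>R x - y) + \<bar>(exp (la * (1 / real n)) - 1) / (1 / real n) - la\<bar> * N x
      + N ((1 / (1 / real n)) *\<^sub>R (T (1 / real n) x - x) - y))) sequentially"
    using eventually_gt_at_top[of 0] by eventually_elim (rule main[OF refl])
  ultimately have "N x / 2 \<le> M / la * N (la *\<^sub>R x - y)"
    by (rule tendsto_lowerbound) simp
  then show ?thesis using la by (simp add: field_simps)
qed

end

section \<open>Dyadic means of orbits and density of the domain\<close>

lemma sum_lessThan_add: "(\<Sum>i<m + n. g i) = (\<Sum>i<m. g i) + (\<Sum>i<n. g (m + i :: nat))"
  for g :: "nat \<Rightarrow> 'b::comm_monoid_add"
  by (induction n) (simp_all add: add.assoc)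

context strong_semigroup
begin

text \<open>A left Riemann sum for \<open>1 / t\<close> times the integral of the orbit
  \<open>T s f\<close> over {0..t}.\<close>

definition dyadic_mean :: "real \<Rightarrow> 'a \<Rightarrow> nat \<Rightarrow> 'a" where
  "dyadic_mean t f n = (1 / 2 ^ n) *\<^sub>R (\<Sum>i<2 ^ n. T (real i * (t / 2 ^ n)) f)"

lemma N_dyadic_diff_le:
  assumes "\<And>i. i < (2::nat) ^ n \<Longrightarrow> g i \<in> S" "\<And>i. i < (2::nat) ^ n \<Longrightarrow> h i \<in> S"
    and "\<And>i. i < (2::nat) ^ n \<Longrightarrow> N (g i - h i) \<le> b"
  shows "N ((1 / 2 ^ n) *\<^sub>R (\<Sum>i<2 ^ n. g i) - (1 / 2 ^ n) *\<^sub>R (\<Sum>i<2 ^ n. h i)) \<le> b"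
proof -
  have "N ((\<Sum>i<2 ^ n. g i) - (\<Sum>i<2 ^ n. h i)) \<le> real (card {..<(2::nat) ^ n}) * b"
    using assms by (intro N_sum_diff_le) auto
  moreover have "(\<Sum>i<2 ^ n. g i) \<in> S" "(\<Sum>i<2 ^ n. h i) \<in> S" using assms by (auto intro!: S_sum)
  ultimately have "N ((1 / 2 ^ n) *\<^sub>R ((\<Sum>i<2 ^ n. g i) - (\<Sum>i<2 ^ n. h i))) \<le> 1 / 2 ^ n * (2 ^ n * b)"
    by (subst scale) (auto intro!: mult_left_mono S_diff simp del: times_divide_eq_left)
  then show ?thesis by (simp only: scaleR_diff_right[symmetric]) simp
qed

lemma dyadic_mean_in [simp]: "t \<ge> 0 \<Longrightarrow> f \<in> S \<Longrightarrow> dyadic_mean t f n \<in> S"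
  by (auto simp: dyadic_mean_def intro!: S_scale S_sum closed)

lemma N_T_step:
  assumes M: "\<forall>t\<in>{0..1}. \<forall>x\<in>S. N (T t x) \<le> M * N x" "M \<ge> 0"
    and f: "f \<in> S" and t: "0 \<le> t" "t \<le> 1" "s \<ge> 0" and b: "N (T s f - f) \<le> b"
  shows "N (T (t + s) f - T t f) \<le> M * b"
proof -
  have "N (T (t + s) f - T t f) = N (T t (T s f - f))" using t f by (intro N_T_shift) auto
  also have "\<dots> \<le> M * N (T s f - f)" using M f t closed by auto
  also have "\<dots> \<le> M * b" using b M by (intro mult_left_mono) auto
  finally show ?thesis .
qed

lemma sum_div_blocks:
  fixes g :: "nat \<Rightarrow> 'b::real_vector"
  assumes "K > 0" shows "(\<Sum>j<n * K. g (j div K)) = real K *\<^sub>R (\<Sum>i<n. g i)"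
proof -
  have "(\<Sum>j<n * K. g (j div K)) = (\<Sum>i<n. \<Sum>j = i * K..<i * K + K. g (j div K))"
    by (simp add: sum.nat_group)
  also have "\<dots> = (\<Sum>i<n. \<Sum>j = i * K..<i * K + K. g i)"
  proof (intro sum.cong refl)
    fix i j assume "j \<in> {i * K..<i * K + K}"
    then have "i * K \<le> j" "j < Suc i * K" by auto
    then have "j div K = i" using assms by (intro div_nat_eqI) (auto simp: mult.commute)
    then show "g (j div K) = g i" by simp
  qed
  also have "\<dots> = real K *\<^sub>R (\<Sum>i<n. g i)" by (simp add: sum_constant_scaleR scaleR_sum_right)
  finally show ?thesis .
qed

text \<open>The \<open>j\<close>-th point of the fine grid lies less than one coarse step to the
  right of the coarse point with index \<open>j div K\<close>; between them the orbit moves by at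
  most \<open>M * b\<close>.\<close>

lemma dyadic_mean_refine:
  assumes M: "\<forall>t\<in>{0..1}. \<forall>x\<in>S. N (T t x) \<le> M * N x" "M \<ge> 0"
    and f: "f \<in> S" and t: "0 < t" "t \<le> 1" and nm: "n \<le> m"
    and b: "\<And>s. 0 \<le> s \<Longrightarrow> s \<le> t / 2 ^ n \<Longrightarrow> N (T s f - f) \<le> b"
  shows "N (dyadic_mean t f m - dyadic_mean t f n) \<le> M * b"
proof -
  define K where "K = (2::nat) ^ (m - n)"
  have K: "K > 0" "2 ^ n * K = 2 ^ m" "(2::real) ^ m = 2 ^ n * real K"
    using nm by (auto simp: K_def simp flip: power_add)
  have "dyadic_mean t f n = (1 / 2 ^ m) *\<^sub>R (real K *\<^sub>R (\<Sum>i<2 ^ n. T (real i * (t / 2 ^ n)) f))"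
    using K by (simp add: dyadic_mean_def)
  also have "real K *\<^sub>R (\<Sum>i<2 ^ n. T (real i * (t / 2 ^ n)) f) = (\<Sum>j<2 ^ m. T (real (j div K) * (t / 2 ^ n)) f)"
    using sum_div_blocks[OF K(1), of "\<lambda>i. T (real i * (t / 2 ^ n)) f" "2 ^ n"] K by simp
  finally have e: "dyadic_mean t f n = (1 / 2 ^ m) *\<^sub>R (\<Sum>j<2 ^ m. T (real (j div K) * (t / 2 ^ n)) f)" .
  show ?thesis unfolding e unfolding dyadic_mean_def
  proof (rule N_dyadic_diff_le)
    fix j assume j: "j < (2::nat) ^ m"
    show "T (real j * (t / 2 ^ m)) f \<in> S" "T (real (j div K) * (t / 2 ^ n)) f \<in> S"
      using f t closed by auto
    have "real j = real (j div K) * K + real (j mod K)" 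
      by (metis div_mult_mod_eq of_nat_add of_nat_mult)
    then have "real j * (t / 2 ^ m) = real (j div K) * K * (t / 2 ^ m) + real (j mod K) * (t / 2 ^ m)"
      by (simp add: algebra_simps)
    also have "real (j div K) * K * (t / 2 ^ m) = real (j div K) * (t / 2 ^ n)" using K by simp
    finally have e: "real j * (t / 2 ^ m) = real (j div K) * (t / 2 ^ n) + real (j mod K) * (t / 2 ^ m)" .
    have "j div K < 2 ^ n" using j K by (simp add: less_mult_imp_div_less)
    then have "real (j div K) \<le> 2 ^ n" by (metis less_imp_le of_nat_le_iff of_nat_numeral of_nat_power)
    then have "real (j div K) * (t / 2 ^ n) \<le> 2 ^ n * (t / 2 ^ n)" using t by (intro mult_right_mono) auto
    also have "2 ^ n * (t / 2 ^ n) = t" by simp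
    finally have 1: "real (j div K) * (t / 2 ^ n) \<le> 1" using t by linarith
    have "real (j mod K) * (t / 2 ^ m) \<le> real K * (t / 2 ^ m)" using K t by (intro mult_right_mono) (auto simp: less_imp_le)
    also have "\<dots> = t / 2 ^ n" using K by simp
    finally have 2: "real (j mod K) * (t / 2 ^ m) \<le> t / 2 ^ n" .
    show "N (T (real j * (t / 2 ^ m)) f - T (real (j div K) * (t / 2 ^ n)) f) \<le> M * b"
      unfolding e using M f t 1 2 by (intro N_T_step b) auto
  qed
qed

text \<open>Shifting the average by \<open>h\<close> adds the orbit over {t..t+h} and removes it
  over {0..h}, a change of about \<open>h / t\<close> times \<open>T t f - f\<close>. The three
  errors come from rounding \<open>h\<close> down to the grid, from the variation of the orbit on
  the two end pieces, and from replacing \<open>m / 2 ^ n\<close> by \<open>h / t\<close>.\<close>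

lemma dyadic_mean_orbit:
  assumes M: "\<forall>t\<in>{0..1}. \<forall>x\<in>S. N (T t x) \<le> M * N x" "M \<ge> 1"
    and f: "f \<in> S" and t: "0 < t" "t \<le> 1 / 2" and h: "0 \<le> h" "h \<le> t"
    and b: "\<And>s. 0 \<le> s \<Longrightarrow> s \<le> t / 2 ^ n \<Longrightarrow> N (T s f - f) \<le> b"
    and c: "\<And>s. 0 \<le> s \<Longrightarrow> s \<le> h \<Longrightarrow> N (T s f - f) \<le> c"
  shows "N (T h (dyadic_mean t f n) - dyadic_mean t f n - (h / t) *\<^sub>R (T t f - f))
           \<le> M * b + h / t * ((M + 1) * c) + N (T t f - f) / 2 ^ n"
proof -
  define d where "d = t / 2 ^ n"
  have d: "d > 0" "2 ^ n * d = t" using t by (auto simp: d_def)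
  define m where "m = nat \<lfloor>h / d\<rfloor>"
  have m: "real m * d \<le> h" "h < real m * d + d"
  proof -
    have "real m = \<lfloor>h / d\<rfloor>" using h d by (simp add: m_def)
    then have "real m \<le> h / d" "h / d < real m + 1" by linarith+
    then show "real m * d \<le> h" "h < real m * d + d" using d by (auto simp: field_simps)
  qed
  have b0: "b \<ge> 0" using b[of 0] t N_nonneg closed f by (smt (verit) S_diff divide_nonneg_nonneg zero_le_power)
  have c0: "c \<ge> 0" using c[of 0] h N_nonneg closed f by (smt (verit) S_diff)
  define A where "A = dyadic_mean t f n"
  define R where "R = (\<Sum>i<2 ^ n. T (real i * d) f)"
  define R' where "R' = (\<Sum>i<2 ^ n. T (real (m + i) * d) f)"
  have AS: "A \<in> S" using t f by (simp add: A_def)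
  have RS: "R \<in> S" "R' \<in> S" using f d closed by (auto simp: R_def R'_def intro!: S_sum)
  have Aeq: "A = (1 / 2 ^ n) *\<^sub>R R" by (simp add: A_def R_def dyadic_mean_def d_def)
  have iS: "T (real i * d) f \<in> S" for i using f d closed by auto
  have hS: "T h A \<in> S" "T h (T (real i * d) f) \<in> S" for i using AS iS closed h by auto
  have n0: "N (T h A - (1 / 2 ^ n) *\<^sub>R (\<Sum>i<2 ^ n. T h (T (real i * d) f))) = 0"
    unfolding Aeq R_def using h iS by (intro N_T_scale_sum) auto
  have 1: "N ((1 / 2 ^ n) *\<^sub>R (\<Sum>i<2 ^ n. T h (T (real i * d) f)) - (1 / 2 ^ n) *\<^sub>R R') \<le> M * b"
    unfolding R'_def
  proof (rule N_dyadic_diff_le)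
    fix i assume i: "i < (2::nat) ^ n"
    then have "real i * d \<le> 2 ^ n * d" using d by (intro mult_right_mono) (auto simp: less_imp_le)
    then have id: "real i * d \<le> t" using d by simp
    show "T h (T (real i * d) f) \<in> S" "T (real (m + i) * d) f \<in> S" using hS f d closed by auto
    have eq: "real (m + i) * d + (h - real m * d) = h + real i * d" by (simp add: algebra_simps)
    have 0: "N (T (h + real i * d) f - T h (T (real i * d) f)) = 0"
      using T_add[of h "real i * d" f] h d f by simp
    have "N (T h (T (real i * d) f) - T (real (m + i) * d) f) = N (T (h + real i * d) f - T (real (m + i) * d) f)"
      using N_null_left[OF _ _ _ 0, of "T (real (m + i) * d) f"] hS f h d closed by simp
    also have "\<dots> = N (T (real (m + i) * d + (h - real m * d)) f - T (real (m + i) * d) f)" by (simp only: eq)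
    also have "\<dots> \<le> M * b"
    proof (rule N_T_step)
      \<comment> \<open>The hypothesis \<open>t <= 1 / 2\<close> enters here: the shifted times stay
        below \<open>h + t <= 1\<close>, where \<open>M\<close> bounds the semigroup.\<close>
      show "real (m + i) * d \<le> 1" using m h t id by (simp add: algebra_simps)
      show "N (T (h - real m * d) f - f) \<le> b" using m by (intro b) (auto simp: d_def)
    qed (use M f m d in auto)
    finally show "N (T h (T (real i * d) f) - T (real (m + i) * d) f) \<le> M * b" .
  qed
  \<comment> \<open>The overlap of the shifted and the unshifted sum cancels and leaves
    \<open>m\<close> terms at either end.\<close>
  have shift: "R' + (\<Sum>j<m. T (real j * d) f) = R + (\<Sum>j<m. T (real (2 ^ n + j) * d) f)"
    using sum_lessThan_add[of "\<lambda>i. T (real i * d) f" m "2 ^ n"] sum_lessThan_add[of "\<lambda>i. T (real i * d) f" "2 ^ n" m]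
    by (simp add: R_def R'_def add.commute)
  have small: "N ((1 / 2 ^ n) *\<^sub>R (R' - R) - (real m / 2 ^ n) *\<^sub>R (T t f - f)) \<le> h / t * ((M + 1) * c)"
  proof -
    define g where "g = T t f - f"
    have gS: "g \<in> S" using f t closed by (simp add: g_def)
    have "N ((\<Sum>j<m. T (real (2 ^ n + j) * d) f - T (real j * d) f) - (\<Sum>j<m. g)) \<le> real (card {..<m}) * ((M + 1) * c)"
    proof (rule N_sum_diff_le)
      fix j assume j: "j \<in> {..<m}"
      then have jd: "real j * d \<le> h" using m d by (smt (verit) lessThan_iff mult_right_mono of_nat_less_iff)
      have S: "T (real (2 ^ n + j) * d) f \<in> S" "T t f \<in> S" using f d closed t by auto
      then show "T (real (2 ^ n + j) * d) f - T (real j * d) f \<in> S" using iS by blast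
      have "N (T (t + real j * d) f - T t f) \<le> M * c"
        using M f t d jd by (intro N_T_step c) auto
      moreover have "t + real j * d = real (2 ^ n + j) * d" using d by (simp add: algebra_simps)
      ultimately have a: "N (T (real (2 ^ n + j) * d) f - T t f) \<le> M * c" by simp
      have b: "N (T (real j * d) f - f) \<le> c" using c[of "real j * d"] jd d by simp
      have "N (T (real (2 ^ n + j) * d) f - T (real j * d) f - g)
          = N ((T (real (2 ^ n + j) * d) f - T t f) - (T (real j * d) f - f))" by (simp add: g_def algebra_simps)
      also have "\<dots> \<le> N (T (real (2 ^ n + j) * d) f - T t f) + N (T (real j * d) f - f)"
        using S iS f by (intro N_diff) auto
      finally show "N (T (real (2 ^ n + j) * d) f - T (real j * d) f - g) \<le> (M + 1) * c" using a b by (simp add: algebra_simps)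
    qed (use gS in auto)
    also have "(\<Sum>j<m. T (real (2 ^ n + j) * d) f - T (real j * d) f) = R' - R"
      using shift by (simp add: sum_subtractf algebra_simps)
    also have "(\<Sum>j<m. g) = real m *\<^sub>R g" by (simp add: sum_constant_scaleR)
    finally have "N (R' - R - real m *\<^sub>R g) \<le> real m * ((M + 1) * c)" by simp
    then have "1 / 2 ^ n * N (R' - R - real m *\<^sub>R g) \<le> 1 / 2 ^ n * (real m * ((M + 1) * c))"
      by (intro mult_left_mono) auto
    also have "\<dots> = real m / 2 ^ n * ((M + 1) * c)" by simp
    also have "\<dots> \<le> h / t * ((M + 1) * c)"
    proof (rule mult_right_mono)
      show "real m / 2 ^ n \<le> h / t" using m d t by (simp add: d_def field_simps)
    qed (use M c0 in auto)
    also have "1 / 2 ^ n * N (R' - R - real m *\<^sub>R g) = N ((1 / 2 ^ n) *\<^sub>R (R' - R - real m *\<^sub>R g))"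
      using RS gS by (subst scale) auto
    finally show ?thesis by (simp add: g_def algebra_simps)
  qed
  have rest: "N ((real m / 2 ^ n) *\<^sub>R (T t f - f) - (h / t) *\<^sub>R (T t f - f)) \<le> N (T t f - f) / 2 ^ n"
  proof -
    have "real m / 2 ^ n - h / t = (real m * d - h) / t" using t by (simp add: d_def field_simps)
    moreover have "\<bar>(real m * d - h) / t\<bar> \<le> d / t" using m t by (simp add: abs_le_iff divide_right_mono)
    moreover have "d / t = 1 / 2 ^ n" using t by (simp add: d_def)
    ultimately have "\<bar>real m / 2 ^ n - h / t\<bar> \<le> 1 / 2 ^ n" by simp
    then have "\<bar>real m / 2 ^ n - h / t\<bar> * N (T t f - f) \<le> 1 / 2 ^ n * N (T t f - f)"
      using N_nonneg f t closed by (intro mult_right_mono) auto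
    then show ?thesis using f t closed by (simp add: scale flip: scaleR_diff_left)
  qed
  define g where "g = T t f - f"
  have gS: "g \<in> S" using f t closed by (simp add: g_def)
  have sS: "(\<Sum>i<2 ^ n. T h (T (real i * d) f)) \<in> S" using hS by (intro S_sum) auto
  have "N (T h A - A - (h / t) *\<^sub>R g) = N (T h A - (A + (h / t) *\<^sub>R g))" by (simp add: algebra_simps)
  also have "\<dots> = N ((1 / 2 ^ n) *\<^sub>R (\<Sum>i<2 ^ n. T h (T (real i * d) f)) - (A + (h / t) *\<^sub>R g))"
    using n0 hS AS gS sS by (intro N_null_left) auto
  also have "\<dots> \<le> N ((1 / 2 ^ n) *\<^sub>R (\<Sum>i<2 ^ n. T h (T (real i * d) f)) - (1 / 2 ^ n) *\<^sub>R R')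
      + N ((1 / 2 ^ n) *\<^sub>R R' - (A + (h / t) *\<^sub>R g))"
    using sS AS gS RS by (intro N_trans) auto
  also have "(1 / 2 ^ n) *\<^sub>R R' - (A + (h / t) *\<^sub>R g)
      = ((1 / 2 ^ n) *\<^sub>R (R' - R) - (real m / 2 ^ n) *\<^sub>R g) + ((real m / 2 ^ n) *\<^sub>R g - (h / t) *\<^sub>R g)"
    by (simp add: Aeq algebra_simps)
  also have "N \<dots> \<le> N ((1 / 2 ^ n) *\<^sub>R (R' - R) - (real m / 2 ^ n) *\<^sub>R g) + N ((real m / 2 ^ n) *\<^sub>R g - (h / t) *\<^sub>R g)"
    using RS gS by (intro triangle) auto
  finally show ?thesis using 1 small rest by (simp add: A_def g_def)
qed

lemma continuous_near_0:
  assumes f: "f \<in> S" and e: "e > 0"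
  shows "\<exists>d>0. \<forall>s. 0 \<le> s \<longrightarrow> s \<le> d \<longrightarrow> N (T s f - f) \<le> e"
proof -
  have "eventually (\<lambda>t. N (T t f - f) < e) (at_right 0)"
    using order_tendstoD(2)[OF continuous[OF f] e] .
  then obtain d where d: "d > 0" "\<And>s. 0 < s \<Longrightarrow> s < d \<Longrightarrow> N (T s f - f) < e"
    by (auto simp: eventually_at_right_field)
  have "N (T s f - f) \<le> e" if "0 \<le> s" "s \<le> d / 2" for s
  proof (cases "s = 0")
    case True then show ?thesis using T_0[OF f] e by simp
  next
    case False then show ?thesis using d(2)[of s] that d(1) by simp
  qed
  then show ?thesis using d(1) by (intro exI[of _ "d/2"]) auto
qed

text \<open>The limit \<open>x\<close> of the dyadic means is the average of the orbit over {0..t}.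
  It is close to \<open>f\<close> for small \<open>t\<close>, and the generator sends it to
  \<open>(T t f - f) / t\<close>.\<close>

theorem generator_dense:
  assumes f: "f \<in> S" and e: "e > 0"
  shows "\<exists>x\<in>S. \<exists>y\<in>S. generator_at x y \<and> N (f - x) \<le> e"
proof -
  obtain M where M: "M \<ge> 1" "\<forall>t\<in>{0..1}. \<forall>x\<in>S. N (T t x) \<le> M * N x" using bounded_on_unit by blast
  obtain t0 where t0: "t0 > 0" "\<And>s. 0 \<le> s \<Longrightarrow> s \<le> t0 \<Longrightarrow> N (T s f - f) \<le> e"
    using continuous_near_0[OF f e] by blast
  define t where "t = min t0 (1/2)"
  have t: "0 < t" "t \<le> 1/2" "t \<le> t0" using t0 by (auto simp: t_def)
  have lim: "(\<lambda>n. t * (1/2) ^ n) \<longlonglongrightarrow> t * 0" by (intro tendsto_intros LIMSEQ_power_zero) auto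
  have small: "\<exists>n0. \<forall>n\<ge>n0. \<forall>s. 0 \<le> s \<longrightarrow> s \<le> t / 2 ^ n \<longrightarrow> N (T s f - f) \<le> e'" if "e' > 0" for e'
  proof -
    obtain d where d: "d > 0" "\<And>s. 0 \<le> s \<Longrightarrow> s \<le> d \<Longrightarrow> N (T s f - f) \<le> e'"
      using continuous_near_0[OF f \<open>e' > 0\<close>] by blast
    have "eventually (\<lambda>n. t * (1/2) ^ n < d) sequentially" using order_tendstoD(2)[OF lim] d by simp
    then obtain n0 where "\<forall>n\<ge>n0. t * (1/2) ^ n < d" by (auto simp: eventually_sequentially)
    then have "\<forall>n\<ge>n0. t / 2 ^ n < d" by (simp add: power_one_over)
    then show ?thesis using d by (meson less_imp_le order_trans)
  qed
  have "\<exists>x\<in>S. (\<lambda>n. N (dyadic_mean t f n - x)) \<longlonglongrightarrow> 0"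
  proof (rule complete)
    fix r :: real assume r: "r > 0"
    \<comment> \<open>Refinement multiplies by \<open>M\<close>, so every later mean is within
      \<open>r / 3\<close> of the \<open>n0\<close>-th, and two such distances stay below
      \<open>r\<close>.\<close>
    obtain n0 where n0: "\<And>s. 0 \<le> s \<Longrightarrow> s \<le> t / 2 ^ n0 \<Longrightarrow> N (T s f - f) \<le> r / (3 * M)"
    proof -
      have "r / (3 * M) > 0" using r M by simp
      from small[OF this] that show thesis by blast
    qed
    have "N (dyadic_mean t f n - dyadic_mean t f n0) \<le> r / 3" if "n \<ge> n0" for n
      using dyadic_mean_refine[OF M(2) _ f t(1) _ that n0] M t by simp
    then have "N (dyadic_mean t f m - dyadic_mean t f n) < r" if "n \<ge> n0" "m \<ge> n0" for m n
    proof -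
      have S: "dyadic_mean t f k \<in> S" for k using t f by simp
      have "N (dyadic_mean t f m - dyadic_mean t f n) \<le> r / 3 + r / 3"
        using N_trans[OF S[of m] S[of n0] S[of n]] N_commute[OF S[of n0] S[of n]] 
          \<open>\<And>n. n0 \<le> n \<Longrightarrow> N (dyadic_mean t f n - dyadic_mean t f n0) \<le> r / 3\<close>[OF that(1)]
          \<open>\<And>n. n0 \<le> n \<Longrightarrow> N (dyadic_mean t f n - dyadic_mean t f n0) \<le> r / 3\<close>[OF that(2)] by linarith
      then show ?thesis using r by simp
    qed
    then show "\<exists>n0. \<forall>m\<ge>n0. \<forall>n\<ge>n0. N (dyadic_mean t f m - dyadic_mean t f n) < r" by blast
  qed (use t f in simp)
  then obtain x where x: "x \<in> S" "(\<lambda>n. N (dyadic_mean t f n - x)) \<longlonglongrightarrow> 0" by blast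
  have AS: "dyadic_mean t f n \<in> S" for n using t f by simp
  have "N (x - f) \<le> e"
  proof (rule limit_dist_le[OF AS x(1) f x(2)])
    have "N (dyadic_mean t f n - f) \<le> e" for n
    proof -
      have "f = (1 / 2 ^ n) *\<^sub>R (\<Sum>i<(2::nat) ^ n. f)" by (simp add: sum_constant_scaleR)
      then have "N (dyadic_mean t f n - f)
          = N ((1 / 2 ^ n) *\<^sub>R (\<Sum>i<2 ^ n. T (real i * (t / 2 ^ n)) f) - (1 / 2 ^ n) *\<^sub>R (\<Sum>i<(2::nat) ^ n. f))"
        by (simp add: dyadic_mean_def)
      also have "\<dots> \<le> e"
      proof (rule N_dyadic_diff_le)
        fix i assume "i < (2::nat) ^ n"
        then have "real i \<le> 2 ^ n" by (metis less_imp_le of_nat_le_iff of_nat_numeral of_nat_power)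
        then have "real i * (t / 2 ^ n) \<le> 2 ^ n * (t / 2 ^ n)" using t by (intro mult_right_mono) auto
        then show "N (T (real i * (t / 2 ^ n)) f - f) \<le> e" using t by (intro t0) auto
      qed (use f t closed in auto)
      finally show ?thesis .
    qed
    then show "\<forall>\<^sub>F n in sequentially. N (dyadic_mean t f n - f) \<le> e" by simp
  qed
  define g where "g = T t f - f"
  have gS: "g \<in> S" using f t closed by (simp add: g_def)
  \<comment> \<open>In the limit of \<open>n\<close> the rounding errors of
    \<open>dyadic_mean_orbit\<close> disappear; what remains carries the factor \<open>c\<close>,
    which is small for small \<open>h\<close>.\<close>
  have orbit: "N (T h x - x - (h / t) *\<^sub>R g) \<le> h / t * ((M + 1) * c)"
    if h: "0 \<le> h" "h \<le> t" and c: "\<And>s. 0 \<le> s \<Longrightarrow> s \<le> h \<Longrightarrow> N (T s f - f) \<le> c" for h c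
  proof (rule field_le_epsilon)
    fix r :: real assume r: "r > 0"
    obtain n0 where n0: "\<And>n s. n \<ge> n0 \<Longrightarrow> 0 \<le> s \<Longrightarrow> s \<le> t / 2 ^ n \<Longrightarrow> N (T s f - f) \<le> r / (4 * M)"
    proof -
      have "r / (4 * M) > 0" using r M by simp
      from small[OF this] that show thesis by blast
    qed
    have "(\<lambda>n. N g * (1/2) ^ n) \<longlonglongrightarrow> N g * 0" by (intro tendsto_intros LIMSEQ_power_zero) auto
    then have "eventually (\<lambda>n. N g * (1/2) ^ n < r / 4) sequentially"
      by (rule order_tendstoD(2)) (use r in simp)
    moreover have "(\<lambda>n. (M + 1) * N (dyadic_mean t f n - x)) \<longlonglongrightarrow> (M + 1) * 0"
      by (intro tendsto_intros x)
    then have "eventually (\<lambda>n. (M + 1) * N (dyadic_mean t f n - x) < r / 4) sequentially"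
      by (rule order_tendstoD(2)) (use r in simp)
    ultimately have "eventually (\<lambda>n. N g * (1/2) ^ n < r / 4 \<and> (M + 1) * N (dyadic_mean t f n - x) < r / 4 \<and> n \<ge> n0) sequentially"
      using eventually_ge_at_top[of n0] by eventually_elim auto
    then obtain n where n: "N g * (1/2) ^ n < r / 4" "(M + 1) * N (dyadic_mean t f n - x) < r / 4" "n \<ge> n0"
      by (auto simp: eventually_sequentially)
    define A where "A = dyadic_mean t f n"
    have A: "A \<in> S" using AS by (simp add: A_def)
    have hS: "T h x \<in> S" "T h A \<in> S" using closed h x A by auto
    have "N (T h A - A - (h / t) *\<^sub>R g) \<le> M * (r / (4 * M)) + h / t * ((M + 1) * c) + N g / 2 ^ n"
      unfolding A_def g_def
      by (rule dyadic_mean_orbit[OF M(2,1) f t(1,2) h]) (use n0[OF n(3)] c in blast)+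
    moreover have "M * (r / (4 * M)) = r / 4" using M by simp
    moreover have "N g / 2 ^ n \<le> r / 4" using n(1) by (simp add: power_one_over)
    ultimately have 1: "N (T h A - A - (h / t) *\<^sub>R g) \<le> r / 4 + h / t * ((M + 1) * c) + r / 4" by linarith
    have 2: "N (T h x - T h A) \<le> M * N (A - x)"
    proof -
      have "h \<in> {0..1}" "x - A \<in> S" using h t x A by auto
      then have "N (T h (x - A)) \<le> M * N (x - A)" using M(2) by blast
      then show ?thesis using N_T_diff[OF h(1) x(1) A] N_commute[OF x(1) A] by simp
    qed
    have 3: "M * N (A - x) + N (A - x) < r / 4" using n(2) by (simp add: A_def distrib_right)
    have "N (T h x - x - (h / t) *\<^sub>R g) = N ((T h x - T h A) + ((A - x) + (T h A - A - (h / t) *\<^sub>R g)))"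
      by (simp add: algebra_simps)
    also have "\<dots> \<le> N (T h x - T h A) + N ((A - x) + (T h A - A - (h / t) *\<^sub>R g))"
      using A x gS hS by (intro triangle) auto
    also have "N ((A - x) + (T h A - A - (h / t) *\<^sub>R g)) \<le> N (A - x) + N (T h A - A - (h / t) *\<^sub>R g)"
      using A x gS hS by (intro triangle) auto
    finally show "N (T h x - x - (h / t) *\<^sub>R g) \<le> h / t * ((M + 1) * c) + r"
      using 1 2 3 r by linarith
  qed
  have "generator_at x ((1 / t) *\<^sub>R g)" unfolding generator_at_def
  proof (rule tendstoI)
    fix r :: real assume r: "r > 0"
    \<comment> \<open>Chosen so that the remaining error \<open>h / t * ((M + 1) * c)\<close> equals
      \<open>h * r / 2\<close>, which is below \<open>r\<close> after division by
      \<open>h\<close>.\<close>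
    define c where "c = r * t / 2 / (M + 1)"
    have c0: "c > 0" using r t M by (simp add: c_def)
    obtain d where d: "d > 0" "\<And>s. 0 \<le> s \<Longrightarrow> s \<le> d \<Longrightarrow> N (T s f - f) \<le> c"
      using continuous_near_0[OF f c0] by blast
    have "dist (N ((1 / h) *\<^sub>R (T h x - x) - (1 / t) *\<^sub>R g)) 0 < r" if h: "0 < h" "h < min d t" for h
    proof -
      have "N (T h x - x - (h / t) *\<^sub>R g) \<le> h / t * ((M + 1) * c)" using h d by (intro orbit) auto
      also have "(M + 1) * c = r * t / 2"
      proof -
        have "M + 1 \<noteq> 0" using M by simp
        then show ?thesis unfolding c_def by (metis nonzero_mult_div_cancel_left times_divide_eq_right)
      qed
      also have "h / t * (r * t / 2) = h * (r / 2)" using t by simp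
      finally have "1 / h * N (T h x - x - (h / t) *\<^sub>R g) \<le> 1 / h * (h * (r / 2))"
        using h by (intro mult_left_mono) auto
      moreover have "N ((1 / h) *\<^sub>R (T h x - x - (h / t) *\<^sub>R g)) = 1 / h * N (T h x - x - (h / t) *\<^sub>R g)"
        using h x gS closed by (subst scale) auto
      moreover have "(1 / h) *\<^sub>R (T h x - x - (h / t) *\<^sub>R g) = (1 / h) *\<^sub>R (T h x - x) - (1 / t) *\<^sub>R g"
        using h by (simp add: scaleR_diff_right)
      moreover have "N ((1 / h) *\<^sub>R (T h x - x) - (1 / t) *\<^sub>R g) \<ge> 0" using h x gS closed by (intro N_nonneg) auto
      moreover have "1 / h * (h * (r / 2)) = r / 2" using h by simp
      ultimately have "0 \<le> N ((1 / h) *\<^sub>R (T h x - x) - (1 / t) *\<^sub>R g)"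
        "N ((1 / h) *\<^sub>R (T h x - x) - (1 / t) *\<^sub>R g) \<le> r / 2" by metis+
      then show ?thesis using r by simp
    qed
    then show "\<forall>\<^sub>F h in at_right 0. dist (N ((1 / h) *\<^sub>R (T h x - x) - (1 / t) *\<^sub>R g)) 0 < r"
      using d t by (auto simp: eventually_at_right_field intro!: exI[of _ "min d t"])
  qed
  then show ?thesis using x gS \<open>N (x - f) \<le> e\<close> N_commute[of x f] f by (intro bexI[of _ x] bexI[of _ "(1/t) *\<^sub>R g"]) auto
qed

end


text \<open>The induction passes to the kernel of one more functional at the cost of one correction
  vector. Density of the common kernel makes that vector as small as we like, and absorbing the
  new functional into the seminorm of the induction hypothesis bounds its coefficient.\<close>

lemma small_preimage:
  fixes E :: "'a::real_vector set" and l :: "nat \<Rightarrow> 'a \<Rightarrow> real"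
  assumes N: "seminormed E N" and R: "seminormed E R"
    and add: "\<And>i x y. i < n \<Longrightarrow> x \<in> E \<Longrightarrow> y \<in> E \<Longrightarrow> l i (x + y) = l i x + l i y"
    and sc: "\<And>i x c. i < n \<Longrightarrow> x \<in> E \<Longrightarrow> l i (c *\<^sub>R x) = c * l i x"
    and dense: "\<And>u e. u \<in> E \<Longrightarrow> e > 0 \<Longrightarrow> \<exists>k\<in>E. (\<forall>i<n. l i k = 0) \<and> N (u - k) \<le> e"
    and d: "d > 0"
  shows "\<exists>C\<ge>0. \<forall>u\<in>E. \<exists>w\<in>E. (\<forall>i<n. l i w = l i u) \<and> N w \<le> d * (\<Sum>i<n. \<bar>l i u\<bar>) \<and> R w \<le> C * (\<Sum>i<n. \<bar>l i u\<bar>)"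
  using R add sc dense d
proof (induction n arbitrary: R d)
  case 0
  interpret N: seminormed E N by fact
  interpret R: seminormed E R by fact
  show ?case by (intro exI[of _ 0]) (auto intro!: bexI[of _ 0])
next
  case (Suc n)
  interpret N: seminormed E N by fact
  interpret R: seminormed E R by fact
  note add = Suc.prems(2) and sc = Suc.prems(3)
  have dense: "\<exists>k\<in>E. (\<forall>i<n. l i k = 0) \<and> N (u - k) \<le> e" if "u \<in> E" "e > 0" for u e
    using Suc.prems(4)[OF that] by (meson less_SucI)
  have diff: "l i (x - y) = l i x - l i y" if "i < Suc n" "x \<in> E" "y \<in> E" for i x y
    using add[of i x "(-1) *\<^sub>R y"] sc[of i y "-1"] N.S_scale[of y "-1"] that by simp
  show ?case
  \<comment> \<open>If \<open>l n\<close> vanishes on the common kernel of the others, it is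
    determined by them: a vector matching \<open>u\<close> in the first \<open>n\<close> functionals
    then matches it in \<open>l n\<close> as well.\<close>
  proof (cases "\<forall>x\<in>E. (\<forall>i<n. l i x = 0) \<longrightarrow> l n x = 0")
    case True
    have "\<exists>C\<ge>0. \<forall>u\<in>E. \<exists>w\<in>E. (\<forall>i<n. l i w = l i u) \<and> N w \<le> d * (\<Sum>i<n. \<bar>l i u\<bar>) \<and> R w \<le> C * (\<Sum>i<n. \<bar>l i u\<bar>)"
      by (rule Suc.IH) (use Suc.prems dense in auto)
    then obtain C where C: "C \<ge> 0" and
      w: "\<And>u. u \<in> E \<Longrightarrow> \<exists>w\<in>E. (\<forall>i<n. l i w = l i u) \<and> N w \<le> d * (\<Sum>i<n. \<bar>l i u\<bar>) \<and> R w \<le> C * (\<Sum>i<n. \<bar>l i u\<bar>)"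
      by blast
    have "\<exists>w\<in>E. (\<forall>i<Suc n. l i w = l i u) \<and> N w \<le> d * (\<Sum>i<Suc n. \<bar>l i u\<bar>) \<and> R w \<le> C * (\<Sum>i<Suc n. \<bar>l i u\<bar>)"
      if u: "u \<in> E" for u
    proof -
      obtain w where w: "w \<in> E" "\<forall>i<n. l i w = l i u" "N w \<le> d * (\<Sum>i<n. \<bar>l i u\<bar>)" "R w \<le> C * (\<Sum>i<n. \<bar>l i u\<bar>)"
        using w[OF u] by blast
      have "w - u \<in> E" "\<forall>i<n. l i (w - u) = 0" using w(1,2) u diff by auto
      then have "l n (w - u) = 0" using True by blast
      then have "l n w = l n u" using diff w u by simp
      moreover have "d * (\<Sum>i<n. \<bar>l i u\<bar>) \<le> d * (\<Sum>i<Suc n. \<bar>l i u\<bar>)" "C * (\<Sum>i<n. \<bar>l i u\<bar>) \<le> C * (\<Sum>i<Suc n. \<bar>l i u\<bar>)"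
        using Suc.prems(5) C by (intro mult_left_mono; simp)+
      ultimately show ?thesis using w by (intro bexI[of _ w]) (auto simp: less_Suc_eq)
    qed
    then show ?thesis using C by blast
  next
    case False
    then obtain e0 where e0: "e0 \<in> E" "\<forall>i<n. l i e0 = 0" "l n e0 \<noteq> 0" by blast
    define e where "e = (1 / l n e0) *\<^sub>R e0"
    have e: "e \<in> E" "\<forall>i<n. l i e = 0" "l n e = 1" using e0 sc by (auto simp: e_def)
    define R' where "R' = (\<lambda>x. R x + \<bar>l n x\<bar>)"
    have R': "seminormed E R'"
    proof
      show "subspace E" by (rule N.subspace_S)
      show "R' (x + y) \<le> R' x + R' y" if "x \<in> E" "y \<in> E" for x y
        using R.triangle[OF that] add[of n x y] that by (simp add: R'_def)
      show "R' (c *\<^sub>R x) = \<bar>c\<bar> * R' x" if "x \<in> E" for c x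
        using R.scale[OF that] sc[of n x] that by (simp add: R'_def abs_mult distrib_left)
    qed
    have "\<exists>C\<ge>0. \<forall>u\<in>E. \<exists>w\<in>E. (\<forall>i<n. l i w = l i u) \<and> N w \<le> d / 2 * (\<Sum>i<n. \<bar>l i u\<bar>) \<and> R' w \<le> C * (\<Sum>i<n. \<bar>l i u\<bar>)"
      by (rule Suc.IH[OF R']) (use Suc.prems(2,3,5) dense in auto)
    then obtain C where C: "C \<ge> 0" and
      w: "\<And>u. u \<in> E \<Longrightarrow> \<exists>w\<in>E. (\<forall>i<n. l i w = l i u) \<and> N w \<le> d / 2 * (\<Sum>i<n. \<bar>l i u\<bar>) \<and> R' w \<le> C * (\<Sum>i<n. \<bar>l i u\<bar>)"
      by blast
    \<comment> \<open>Half of \<open>d\<close> is spent on \<open>w\<close>, half on the correction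
      \<open>a e'\<close>, whose coefficient will be at most \<open>1 + C\<close> times the sum of
      the \<open>l i u\<close>.\<close>
    define r where "r = d / (2 * (1 + C))"
    have r: "r > 0" "(1 + C) * r = d / 2" using C Suc.prems(5) by (auto simp: r_def field_simps)
    \<comment> \<open>Subtracting an element of the dense kernel keeps all values of the functionals
      and makes the correction vector small in \<open>N\<close>.\<close>
    obtain k where k: "k \<in> E" "\<forall>i<Suc n. l i k = 0" "N (e - k) \<le> r"
      using Suc.prems(4)[OF e(1) r(1)] by blast
    define e' where "e' = e - k"
    have e': "e' \<in> E" "\<forall>i<n. l i e' = 0" "l n e' = 1" "N e' \<le> r"
      using e k diff by (auto simp: e'_def)
    define C' where "C' = C + (1 + C) * R e'"
    have Re: "R e' \<ge> 0" using R.N_nonneg e' by blast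
    have "\<exists>w\<in>E. (\<forall>i<Suc n. l i w = l i u) \<and> N w \<le> d * (\<Sum>i<Suc n. \<bar>l i u\<bar>) \<and> R w \<le> C' * (\<Sum>i<Suc n. \<bar>l i u\<bar>)"
      if u: "u \<in> E" for u
    proof -
      define s where "s = (\<Sum>i<n. \<bar>l i u\<bar>)"
      define s' where "s' = (\<Sum>i<Suc n. \<bar>l i u\<bar>)"
      have s: "s \<ge> 0" "s' = s + \<bar>l n u\<bar>" by (auto simp: s_def s'_def sum_nonneg)
      obtain w where w: "w \<in> E" "\<forall>i<n. l i w = l i u" "N w \<le> d / 2 * s" "R' w \<le> C * s"
        using w[OF u] unfolding s_def by blast
      define a where "a = l n u - l n w"
      have Rw: "R w \<le> C * s" "\<bar>l n w\<bar> \<le> C * s" 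
        using w(1,4) R.N_nonneg[OF w(1)] by (auto simp: R'_def)
      have "C * s \<le> C * s'" using s C by (intro mult_left_mono) auto
      then have a: "\<bar>a\<bar> \<le> (1 + C) * s'" using Rw(2) s by (auto simp: a_def algebra_simps)
      define v where "v = w + a *\<^sub>R e'"
      have "v \<in> E" using w e' by (auto simp: v_def)
      moreover have "l i v = l i u" if "i < Suc n" for i
        using that w e' add sc N.S_scale[OF e'(1)] by (cases "i = n") (auto simp: v_def a_def)
      moreover have "N v \<le> d * s'"
      proof -
        have "N v \<le> N w + \<bar>a\<bar> * N e'" using N.triangle[of w "a *\<^sub>R e'"] w e' N.scale[of e' a] by (simp add: v_def)
        also have "\<bar>a\<bar> * N e' \<le> ((1 + C) * s') * r" using a e'(4) N.N_nonneg[OF e'(1)] s C by (intro mult_mono) auto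
        also have "((1 + C) * s') * r = d / 2 * s'" using r by (metis mult.assoc mult.commute)
        also have "N w \<le> d / 2 * s'" using w(3) s Suc.prems(5) mult_left_mono[of s s' "d/2"] by linarith
        finally show ?thesis by simp
      qed
      moreover have "R v \<le> C' * s'"
      proof -
        have "R v \<le> R w + \<bar>a\<bar> * R e'" using R.triangle[of w "a *\<^sub>R e'"] w e' R.scale[of e' a] by (simp add: v_def)
        also have "\<bar>a\<bar> * R e' \<le> ((1 + C) * s') * R e'" using a Re by (intro mult_right_mono) auto
        also have "R w \<le> C * s'" using Rw \<open>C * s \<le> C * s'\<close> by linarith
        finally show ?thesis by (simp add: C'_def algebra_simps)
      qed
      ultimately show ?thesis unfolding s'_def by blast
    qed
    moreover have "C' \<ge> 0" using C Re by (simp add: C'_def)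
    ultimately show ?thesis by blast
  qed
qed

section \<open>Completeness of X and Sobolev functions\<close>

lemma vnorm_0 [simp]: "vnorm 0 v = 0"
  by (simp add: vnorm_def)

lemma vnorm_Suc: "vnorm (Suc n) v = max (vnorm n v) (cmod (v n))"
  by (simp add: vnorm_def lessThan_Suc insert_commute[of 0] max.commute)

lemma vnorm_nonneg [simp]: "0 \<le> vnorm n v"
  by (induction n) (auto simp: vnorm_Suc)

lemma cmod_le_vnorm: "k < n \<Longrightarrow> cmod (v k) \<le> vnorm n v"
  by (induction n) (auto simp: vnorm_Suc less_Suc_eq le_max_iff_disj)

lemma vnorm_le: "0 \<le> b \<Longrightarrow> (\<And>k. k < n \<Longrightarrow> cmod (v k) \<le> b) \<Longrightarrow> vnorm n v \<le> b"
  by (induction n) (auto simp: vnorm_Suc)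

lemma vnorm_zero [simp]: "vnorm n (\<lambda>k. 0) = 0" "vnorm n 0 = 0"
  by (induction n) (auto simp: vnorm_Suc)

lemma vnorm_cong: "(\<And>k. k < n \<Longrightarrow> cmod (v k) = cmod (w k)) \<Longrightarrow> vnorm n v = vnorm n w"
  by (induction n) (auto simp: vnorm_Suc)

lemma vnorm_triangle: "vnorm n (v + w) \<le> vnorm n v + vnorm n w"
proof (rule vnorm_le)
  fix k assume "k < n"
  then show "cmod ((v + w) k) \<le> vnorm n v + vnorm n w"
    using norm_triangle_ineq[of "v k" "w k"] cmod_le_vnorm[of k n v] cmod_le_vnorm[of k n w] by simp
qed simp

lemma vnorm_scaleR: "vnorm n (c *\<^sub>R v) = \<bar>c\<bar> * vnorm n v"
  by (induction n) (auto simp: vnorm_Suc max_mult_distrib_left)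

lemma borel_measurable_vnorm:
  assumes "\<And>k. k < n \<Longrightarrow> (\<lambda>r. u r k) \<in> borel_measurable M"
  shows "(\<lambda>r. vnorm n (u r)) \<in> borel_measurable M"
  using assms by (induction n) (auto simp: vnorm_Suc intro!: borel_measurable_max)

text \<open>Convexity of the power function. If one argument is 0, the inequality reduces to
  \<open>t powr p <= t\<close> on the unit interval.\<close>

lemma powr_convex_comb:
  fixes x y t p :: real
  assumes p: "1 \<le> p" and "0 \<le> x" "0 \<le> y" "0 \<le> t" "t \<le> 1"
  shows "((1 - t) * x + t * y) powr p \<le> (1 - t) * x powr p + t * y powr p"
proof -
  have *: "(t * y) powr p \<le> t * y powr p" if "0 \<le> y" "0 \<le> t" "t \<le> 1" for t y :: real
  proof -
    have "t powr p \<le> t powr 1" using that p by (intro powr_mono') auto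
    then have "t powr p * y powr p \<le> t * y powr p" using that by (intro mult_right_mono) auto
    then show ?thesis using that by (simp add: powr_mult)
  qed
  show ?thesis
  proof (cases "x = 0 \<or> y = 0")
    case True
    then show ?thesis using *[of y t] *[of x "1 - t"] assms by auto
  next
    case False
    then show ?thesis using convex_onD[OF powr_convex[OF p], of t x y] assms by simp
  qed
qed

section \<open>The p-th power integral and the seminorm of X\<close>

definition Lint :: "real measure \<Rightarrow> nat \<Rightarrow> real \<Rightarrow> cfun \<Rightarrow> ennreal" where
  "Lint M n p u = (\<integral>\<^sup>+ r. ennreal (vnorm n (u r) powr p) \<partial>M)"

definition comp_measurable :: "real measure \<Rightarrow> nat \<Rightarrow> cfun \<Rightarrow> bool" where
  "comp_measurable M n u \<longleftrightarrow> (\<forall>k<n. (\<lambda>r. u r k) \<in> borel_measurable M)"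

lemma Xint_Lint: "Xint l m p f = Lint (lebesgue_on {0..}) l p (fst f) + Lint (lebesgue_on {0..1}) m p (snd f)"
  by (simp add: Xint_def Lint_def)

lemma inX_iff: "inX l m p f \<longleftrightarrow> comp_measurable (lebesgue_on {0..}) l (fst f) \<and>
    comp_measurable (lebesgue_on {0..1}) m (snd f) \<and> Xint l m p f < \<infinity>"
  by (simp add: inX_def comp_measurable_def)

lemma comp_measurable_add: "comp_measurable M n u \<Longrightarrow> comp_measurable M n v \<Longrightarrow> comp_measurable M n (u + v)"
  by (auto simp: comp_measurable_def intro!: borel_measurable_add borel_measurable_diff)

lemma comp_measurable_scaleR: "comp_measurable M n u \<Longrightarrow> comp_measurable M n (c *\<^sub>R u)"
  by (auto simp: comp_measurable_def intro!: borel_measurable_add borel_measurable_diff)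

lemma comp_measurable_diff: "comp_measurable M n u \<Longrightarrow> comp_measurable M n v \<Longrightarrow> comp_measurable M n (u - v)"
  by (auto simp: comp_measurable_def intro!: borel_measurable_add borel_measurable_diff)

lemma measurable_vnorm_powr [measurable]:
  "comp_measurable M n u \<Longrightarrow> (\<lambda>r. ennreal (vnorm n (u r) powr p)) \<in> borel_measurable M"
  using borel_measurable_vnorm[of n u M] by (simp add: comp_measurable_def)

lemma Lint_scaleR:
  assumes "comp_measurable M n u"
  shows "Lint M n p (c *\<^sub>R u) = ennreal (\<bar>c\<bar> powr p) * Lint M n p u"
proof -
  have "Lint M n p (c *\<^sub>R u) = (\<integral>\<^sup>+ r. ennreal (\<bar>c\<bar> powr p) * ennreal (vnorm n (u r) powr p) \<partial>M)"
    unfolding Lint_def by (intro nn_integral_cong) (simp add: vnorm_scaleR powr_mult ennreal_mult)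
  also have "\<dots> = ennreal (\<bar>c\<bar> powr p) * Lint M n p u"
    unfolding Lint_def using assms by (intro nn_integral_cmult) measurable
  finally show ?thesis .
qed

lemma Lint_convex:
  assumes p: "1 \<le> p" and u: "comp_measurable M n u" and v: "comp_measurable M n v" and t: "0 \<le> t" "t \<le> 1"
  shows "Lint M n p ((1 - t) *\<^sub>R u + t *\<^sub>R v) \<le> ennreal (1 - t) * Lint M n p u + ennreal t * Lint M n p v"
proof -
  have "Lint M n p ((1 - t) *\<^sub>R u + t *\<^sub>R v)
      \<le> (\<integral>\<^sup>+ r. ennreal (1 - t) * ennreal (vnorm n (u r) powr p) + ennreal t * ennreal (vnorm n (v r) powr p) \<partial>M)"
    unfolding Lint_def
  proof (rule nn_integral_mono)
    fix r
    have "vnorm n (((1 - t) *\<^sub>R u + t *\<^sub>R v) r) \<le> (1 - t) * vnorm n (u r) + t * vnorm n (v r)"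
      using vnorm_triangle[of n "(1 - t) *\<^sub>R u r" "t *\<^sub>R v r"] t by (simp add: vnorm_scaleR)
    then have "vnorm n (((1 - t) *\<^sub>R u + t *\<^sub>R v) r) powr p \<le> ((1 - t) * vnorm n (u r) + t * vnorm n (v r)) powr p"
      using p by (intro powr_mono2) auto
    also have "\<dots> \<le> (1 - t) * vnorm n (u r) powr p + t * vnorm n (v r) powr p"
      using p t by (intro powr_convex_comb) auto
    finally show "ennreal (vnorm n (((1 - t) *\<^sub>R u + t *\<^sub>R v) r) powr p)
        \<le> ennreal (1 - t) * ennreal (vnorm n (u r) powr p) + ennreal t * ennreal (vnorm n (v r) powr p)"
      using t by (simp flip: ennreal_mult ennreal_plus)
  qed
  also have "\<dots> = ennreal (1 - t) * Lint M n p u + ennreal t * Lint M n p v"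
    unfolding Lint_def using measurable_vnorm_powr[OF u, of p] measurable_vnorm_powr[OF v, of p]
    by (simp add: nn_integral_add nn_integral_cmult)
  finally show ?thesis .
qed

lemma Xint_scaleR: "inX l m p f \<Longrightarrow> Xint l m p (c *\<^sub>R f) = ennreal (\<bar>c\<bar> powr p) * Xint l m p f"
  by (simp add: Xint_Lint inX_iff Lint_scaleR distrib_left)

lemma inX_scaleR: "inX l m p f \<Longrightarrow> inX l m p (c *\<^sub>R f)"
  using Xint_scaleR[of l m p f c] by (auto simp: inX_iff comp_measurable_scaleR ennreal_mult_less_top)

lemma Xint_convex:
  assumes p: "1 \<le> p" and f: "inX l m p f" and g: "inX l m p g" and t: "0 \<le> t" "t \<le> 1"
  shows "Xint l m p ((1 - t) *\<^sub>R f + t *\<^sub>R g) \<le> ennreal (1 - t) * Xint l m p f + ennreal t * Xint l m p g"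
proof -
  have "Xint l m p ((1 - t) *\<^sub>R f + t *\<^sub>R g) \<le>
     (ennreal (1 - t) * Lint (lebesgue_on {0..}) l p (fst f) + ennreal t * Lint (lebesgue_on {0..}) l p (fst g)) +
     (ennreal (1 - t) * Lint (lebesgue_on {0..1}) m p (snd f) + ennreal t * Lint (lebesgue_on {0..1}) m p (snd g))"
    unfolding Xint_Lint using f g p t by (intro add_mono) (auto simp: inX_iff intro!: Lint_convex)
  also have "\<dots> = ennreal (1 - t) * Xint l m p f + ennreal t * Xint l m p g"
    by (simp add: Xint_Lint distrib_left add_ac)
  finally show ?thesis .
qed

lemma inX_add:
  assumes p: "1 \<le> p" and f: "inX l m p f" and g: "inX l m p g"
  shows "inX l m p (f + g)"
proof -
  have "Xint l m p ((1 - 1/2) *\<^sub>R f + (1/2) *\<^sub>R g) \<le> ennreal (1 - 1/2) * Xint l m p f + ennreal (1/2) * Xint l m p g"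
    by (rule Xint_convex) (use assms in auto)
  also have "ennreal c * Xint l m p h < \<infinity>" if "inX l m p h" for c h
    using that by (auto simp: inX_iff ennreal_mult_less_top)
  then have "ennreal (1 - 1/2) * Xint l m p f + ennreal (1/2) * Xint l m p g < \<infinity>"
    using f g unfolding infinity_ennreal_def by (intro ennreal_add_less_top[THEN iffD2] conjI)
  finally have "inX l m p ((1/2) *\<^sub>R f + (1/2) *\<^sub>R g)"
    using f g by (auto simp: inX_iff intro!: comp_measurable_add comp_measurable_scaleR)
  then have "inX l m p (2 *\<^sub>R ((1/2) *\<^sub>R f + (1/2) *\<^sub>R g))" by (rule inX_scaleR)
  then show ?thesis by (simp add: scaleR_add_right)
qed

lemma inX_0: "p \<noteq> 0 \<Longrightarrow> inX l m p 0"
  by (auto simp: inX_iff Xint_Lint Lint_def comp_measurable_def)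

lemma subspace_inX: "1 \<le> p \<Longrightarrow> subspace {f. inX l m p f}"
  by (auto simp: subspace_def inX_add inX_scaleR inX_0)

lemma inX_diff: "1 \<le> p \<Longrightarrow> inX l m p f \<Longrightarrow> inX l m p g \<Longrightarrow> inX l m p (f - g)"
  using subspace_diff[OF subspace_inX, of p f l m g] by simp

lemma normX_nonneg [simp]: "0 \<le> normX l m p f"
  by (simp add: normX_def)

lemma Xint_normX: "1 \<le> p \<Longrightarrow> inX l m p f \<Longrightarrow> Xint l m p f = ennreal (normX l m p f powr p)"
  by (simp add: normX_def inX_iff powr_powr)

lemma normX_le:
  assumes p: "1 \<le> p" and le: "Xint l m p f \<le> ennreal (b powr p)" and b: "0 \<le> b"
  shows "normX l m p f \<le> b"
proof -
  have "enn2real (Xint l m p f) \<le> b powr p" using le by (simp add: enn2real_leI)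
  then have "normX l m p f \<le> (b powr p) powr (1 / p)"
    unfolding normX_def using p by (intro powr_mono2) auto
  then show ?thesis using p b by (simp add: powr_powr)
qed

lemma normX_le_iff:
  assumes p: "1 \<le> p" and f: "inX l m p f" and b: "0 \<le> b"
  shows "normX l m p f \<le> b \<longleftrightarrow> Xint l m p f \<le> ennreal (b powr p)"
  using normX_le[OF p _ b, of l m f] Xint_normX[OF p f] p b by (auto intro!: ennreal_leI powr_mono2)

lemma normX_scaleR:
  assumes p: "1 \<le> p" and f: "inX l m p f"
  shows "normX l m p (c *\<^sub>R f) = \<bar>c\<bar> * normX l m p f"
  using p by (simp add: normX_def Xint_scaleR[OF f] enn2real_mult powr_mult powr_powr)

text \<open>Minkowski from convexity of \<open>Xint\<close>: \<open>f / a\<close> and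
  \<open>g / b\<close> lie in the unit ball, and \<open>(f + g) / (a + b)\<close> is their convex
  combination with weight \<open>b / (a + b)\<close>. Adding \<open>e / 2\<close> keeps both
  divisors positive. Arguing with \<open>Xint\<close> treats the two components of X at
  once.\<close>

lemma normX_triangle:
  assumes p: "1 \<le> p" and f: "inX l m p f" and g: "inX l m p g"
  shows "normX l m p (f + g) \<le> normX l m p f + normX l m p g"
proof (rule field_le_epsilon)
  fix e :: real assume e: "e > 0"
  define a where "a = normX l m p f + e / 2"
  define b where "b = normX l m p g + e / 2"
  have ab: "a > 0" "b > 0" using e by (auto simp: a_def b_def add_nonneg_pos)
  define t where "t = b / (a + b)"
  have t: "0 \<le> t" "t \<le> 1" "1 - t = a / (a + b)" using ab by (auto simp: t_def field_simps)
  have F: "Xint l m p ((1 / a) *\<^sub>R f) \<le> 1" "Xint l m p ((1 / b) *\<^sub>R g) \<le> 1"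
  proof -
    have *: "Xint l m p ((1 / c) *\<^sub>R h) \<le> 1" if h: "inX l m p h" and c: "c = normX l m p h + e / 2" for h c
    proof -
      have c0: "c > 0" using e c by (simp add: add_nonneg_pos)
      have "normX l m p ((1 / c) *\<^sub>R h) \<le> 1"
        using c c0 e by (simp add: normX_scaleR[OF p h])
      then show ?thesis using normX_le_iff[OF p inX_scaleR[OF h], of 1] by simp
    qed
    show "Xint l m p ((1 / a) *\<^sub>R f) \<le> 1" "Xint l m p ((1 / b) *\<^sub>R g) \<le> 1"
      using *[OF f a_def] *[OF g b_def] by auto
  qed
  have "Xint l m p ((1 - t) *\<^sub>R ((1 / a) *\<^sub>R f) + t *\<^sub>R ((1 / b) *\<^sub>R g))
     \<le> ennreal (1 - t) * Xint l m p ((1 / a) *\<^sub>R f) + ennreal t * Xint l m p ((1 / b) *\<^sub>R g)"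
    using p f g t by (intro Xint_convex inX_scaleR) auto
  also have "\<dots> \<le> ennreal (1 - t) * 1 + ennreal t * 1" using F by (intro add_mono mult_left_mono) auto
  also have "\<dots> = ennreal (1 powr p)" using t by (simp flip: ennreal_plus)
  finally have "normX l m p ((1 - t) *\<^sub>R ((1 / a) *\<^sub>R f) + t *\<^sub>R ((1 / b) *\<^sub>R g)) \<le> 1"
    by (intro normX_le p) auto
  also have "(1 - t) *\<^sub>R ((1 / a) *\<^sub>R f) + t *\<^sub>R ((1 / b) *\<^sub>R g) = (1 / (a + b)) *\<^sub>R (f + g)"
  proof -
    have "(1 - t) * (1 / a) = 1 / (a + b)" "t * (1 / b) = 1 / (a + b)"
      using ab unfolding t(3) by (auto simp: t_def)
    then show ?thesis by (simp only: scaleR_scaleR scaleR_add_right)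
  qed
  finally have "1 / (a + b) * normX l m p (f + g) \<le> 1"
    using normX_scaleR[OF p inX_add[OF p f g]] ab by simp
  then have "normX l m p (f + g) \<le> a + b" using ab by (simp add: field_simps)
  then show "normX l m p (f + g) \<le> normX l m p f + normX l m p g + e" by (simp add: a_def b_def)
qed

lemma seminormed_normX: "1 \<le> p \<Longrightarrow> seminormed {f. inX l m p f} (normX l m p)"
  by unfold_locales (auto simp: subspace_inX normX_triangle normX_scaleR)

section \<open>Completeness of X\<close>

text \<open>The argument of Riesz and Fischer. Increments of size \<open>4 ^ -i\<close> stay
  summable after multiplication by \<open>2 ^ i\<close>, so at almost every point the weighted
  increments tend to 0. Eventually the increments are then below \<open>2 ^ -i\<close>, and each
  component converges as a telescoping series.\<close>

lemma AE_convergent_of_fast_Cauchy: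
  assumes p: "1 \<le> p" and Y: "\<And>i. comp_measurable M n (Y i)"
    and fast: "\<And>i. Lint M n p (Y (Suc i) - Y i) \<le> ennreal ((1 / 4 ^ i) powr p)"
  shows "AE r in M. \<forall>k<n. convergent (\<lambda>i. Y i r k)"
proof -
  define d where "d = (\<lambda>i r. vnorm n (Y (Suc i) r - Y i r))"
  have meas: "(\<lambda>r. ennreal ((2 ^ i * d i r) powr p)) \<in> borel_measurable M" for i
  proof -
    have "(\<lambda>r. vnorm n ((Y (Suc i) - Y i) r)) \<in> borel_measurable M"
      using comp_measurable_diff[OF Y[of "Suc i"] Y[of i]]
      by (intro borel_measurable_vnorm) (auto simp: comp_measurable_def)
    then have [measurable]: "d i \<in> borel_measurable M" by (simp add: d_def)
    show ?thesis by measurable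
  qed
  have "(\<integral>\<^sup>+ r. (\<Sum>i. ennreal ((2 ^ i * d i r) powr p)) \<partial>M) = (\<Sum>i. \<integral>\<^sup>+ r. ennreal ((2 ^ i * d i r) powr p) \<partial>M)"
    using meas by (rule nn_integral_suminf)
  also have "\<dots> \<le> (\<Sum>i. ennreal ((1 / 2) ^ i))"
  proof (rule suminf_le)
    fix i
    have "(\<integral>\<^sup>+ r. ennreal ((2 ^ i * d i r) powr p) \<partial>M) = Lint M n p ((2 ^ i) *\<^sub>R (Y (Suc i) - Y i))"
      unfolding Lint_def d_def by (intro nn_integral_cong) (simp add: vnorm_scaleR flip: scaleR_diff_right)
    also have "\<dots> = ennreal (\<bar>2 ^ i\<bar> powr p) * Lint M n p (Y (Suc i) - Y i)"
      using Y by (intro Lint_scaleR comp_measurable_diff)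
    also have "\<dots> \<le> ennreal (\<bar>2 ^ i\<bar> powr p) * ennreal ((1 / 4 ^ i) powr p)"
      using fast by (intro mult_left_mono) auto
    also have "\<dots> = ennreal ((2 ^ i * (1 / 4 ^ i)) powr p)" by (simp add: powr_mult powr_divide ennreal_mult[symmetric])
    also have "2 ^ i * (1 / 4 ^ i) = (2 / 4 :: real) ^ i" by (simp only: power_divide times_divide_eq_right mult_1_right)
    also have "(2 / 4 :: real) = 1 / 2" by simp
    also have "ennreal (((1 / 2) ^ i) powr p) \<le> ennreal (((1 / 2) ^ i) powr 1)"
      using p by (intro ennreal_leI powr_mono') (auto simp: power_le_one)
    finally show "(\<integral>\<^sup>+ r. ennreal ((2 ^ i * d i r) powr p) \<partial>M) \<le> ennreal ((1 / 2) ^ i)" by simp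
  qed auto
  also have "\<dots> = ennreal (\<Sum>i. (1 / 2) ^ i)" by (intro suminf_ennreal2) (auto intro: summable_geometric)
  finally have "(\<integral>\<^sup>+ r. (\<Sum>i. ennreal ((2 ^ i * d i r) powr p)) \<partial>M) \<noteq> \<infinity>"
    by (metis ennreal_less_top infinity_ennreal_def leD)
  then have "AE r in M. (\<Sum>i. ennreal ((2 ^ i * d i r) powr p)) \<noteq> \<infinity>"
    using meas by (intro nn_integral_noteq_infinite borel_measurable_suminf_order) auto
  then show ?thesis
  proof eventually_elim
    case (elim r)
    have "summable (\<lambda>i. (2 ^ i * d i r) powr p)"
      using elim by (intro summable_suminf_not_top) auto
    then have "(\<lambda>i. (2 ^ i * d i r) powr p) \<longlonglongrightarrow> 0" by (rule summable_LIMSEQ_zero)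
    then have "eventually (\<lambda>i. (2 ^ i * d i r) powr p < 1) sequentially"
      using order_tendstoD(2) zero_less_one by blast
    then obtain n0 where n0: "\<And>i. i \<ge> n0 \<Longrightarrow> (2 ^ i * d i r) powr p < 1" by (auto simp: eventually_sequentially)
    have small: "d i r \<le> (1 / 2) ^ i" if "i \<ge> n0" for i
    proof (rule ccontr)
      assume "\<not> ?thesis"
      then have "2 ^ i * d i r \<ge> 1" by (simp add: power_one_over field_simps)
      then have "(2 ^ i * d i r) powr p \<ge> 1" using p ge_one_powr_ge_zero by simp
      then show False using n0[OF that] by simp
    qed
    show ?case
    proof (intro allI impI)
      fix k assume k: "k < n"
      have "summable (\<lambda>i. Y (Suc i) r k - Y i r k)"
      proof (rule summable_comparison_test)
        show "\<exists>N. \<forall>i\<ge>N. norm (Y (Suc i) r k - Y i r k) \<le> (1 / 2) ^ i"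
          using small cmod_le_vnorm[OF k, of "Y (Suc _) r - Y _ r"] unfolding d_def by (intro exI[of _ n0]) (force intro: order_trans)
        show "summable (\<lambda>i. (1 / 2 :: real) ^ i)" by (intro summable_geometric) auto
      qed
      then have "convergent (\<lambda>n. \<Sum>i<n. Y (Suc i) r k - Y i r k)" by (simp add: summable_iff_convergent)
      then have "convergent (\<lambda>n. Y n r k - Y 0 r k)" by (simp only: sum_lessThan_telescope[of "\<lambda>n. Y n r k"])
      from convergent_add[OF this convergent_const[of "Y 0 r k"]] show "convergent (\<lambda>i. Y i r k)" by simp
    qed
  qed
qed

text \<open>Subtracting a fixed \<open>g\<close> before applying Fatou turns a bound on distances
  along the sequence into the same bound for the limit.\<close>

lemma Lint_Fatou:
  assumes p: "1 \<le> p" and Y: "\<And>i. comp_measurable M n (Y i)" and g: "comp_measurable M n g"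
    and lim: "AE r in M. \<forall>k<n. (\<lambda>i. Y i r k) \<longlonglongrightarrow> f r k"
    and le: "\<And>i. i \<ge> i0 \<Longrightarrow> Lint M n p (Y i - g) \<le> b"
  shows "Lint M n p (f - g) \<le> b"
proof -
  have conv: "(\<lambda>i. vnorm n (u i)) \<longlonglongrightarrow> vnorm n v" if "\<forall>k<n. (\<lambda>i. u i k) \<longlonglongrightarrow> v k" for u v
    using that by (induction n) (auto simp: vnorm_Suc intro!: tendsto_max tendsto_norm)
  have "Lint M n p (f - g) \<le> (\<integral>\<^sup>+ r. liminf (\<lambda>i. ennreal (vnorm n ((Y i - g) r) powr p)) \<partial>M)"
    unfolding Lint_def
  proof (rule nn_integral_mono_AE, use lim in eventually_elim)
    case (elim r)
    have "(\<lambda>i. vnorm n ((Y i - g) r)) \<longlonglongrightarrow> vnorm n ((f - g) r)"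
      by (rule conv) (use elim in \<open>auto intro!: tendsto_diff\<close>)
    then have "(\<lambda>i. ennreal (vnorm n ((Y i - g) r) powr p)) \<longlonglongrightarrow> ennreal (vnorm n ((f - g) r) powr p)"
      using p by (intro tendsto_ennrealI tendsto_powr') auto
    then show ?case using lim_imp_Liminf[OF sequentially_bot] by (metis order_refl)
  qed
  also have "\<dots> \<le> liminf (\<lambda>i. \<integral>\<^sup>+ r. ennreal (vnorm n ((Y i - g) r) powr p) \<partial>M)"
    using Y g by (intro nn_integral_liminf measurable_vnorm_powr comp_measurable_diff)
  also have "\<dots> = liminf (\<lambda>i. Lint M n p (Y i - g))" by (simp add: Lint_def)
  also have "\<dots> \<le> b"
  proof (rule Liminf_le)
    show "eventually (\<lambda>i. Lint M n p (Y i - g) \<le> b) sequentially"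
      using le eventually_sequentially by blast
  qed simp
  finally show ?thesis .
qed

lemma complete_normX:
  assumes p: "1 \<le> p" and X: "\<And>n::nat. inX l m p (X n)"
    and Cauchy: "\<And>e. e > 0 \<Longrightarrow> \<exists>n0. \<forall>m'\<ge>n0. \<forall>n\<ge>n0. normX l m p (X m' - X n) < e"
  shows "\<exists>f. inX l m p f \<and> (\<lambda>n. normX l m p (X n - f)) \<longlonglongrightarrow> 0"
proof -
  interpret seminormed "{f. inX l m p f}" "normX l m p" using p by (rule seminormed_normX)
  obtain K where K: "\<And>i m' n. m' \<ge> K i \<Longrightarrow> n \<ge> K i \<Longrightarrow> normX l m p (X m' - X n) < 1 / 4 ^ i"
  proof -
    have "\<exists>n0. \<forall>m'\<ge>n0. \<forall>n\<ge>n0. normX l m p (X m' - X n) < 1 / 4 ^ i" for i :: nat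
      by (rule Cauchy) simp
    then show thesis using that by metis
  qed
  \<comment> \<open>Partial sums make the indices monotone while keeping them above
    \<open>K i\<close>.\<close>
  define J where "J = (\<lambda>i. \<Sum>j\<le>i. K j)"
  have J: "J i \<ge> K i" "J i \<le> J (Suc i)" for i by (auto simp: J_def intro: member_le_sum)
  have Jmono: "i \<le> j \<Longrightarrow> J i \<le> J j" for i j using J(2) by (rule lift_Suc_mono_le)
  define Y where "Y = (\<lambda>i. X (J i))"
  have YX: "inX l m p (Y i)" for i using X by (simp add: Y_def)
  have Ydist: "normX l m p (X n - Y i) \<le> 1 / 4 ^ i" if "n \<ge> J i" for n i
    using K[of i n "J i"] that J(1)[of i] by (simp add: Y_def)
  have F: "Xint l m p (X n - Y i) \<le> ennreal ((1 / 4 ^ i) powr p)" if "n \<ge> J i" for n i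
    using normX_le_iff[OF p inX_diff[OF p X YX], of "1 / 4 ^ i" n i] Ydist[OF that] by simp
  have meas: "comp_measurable (lebesgue_on {0..}) l (fst (Y i))" "comp_measurable (lebesgue_on {0..1}) m (snd (Y i))" for i
    using YX[of i] by (auto simp: inX_iff)
  have L: "Lint (lebesgue_on {0..}) l p (fst (Y j) - fst (Y i)) \<le> ennreal ((1 / 4 ^ i) powr p)"
      "Lint (lebesgue_on {0..1}) m p (snd (Y j) - snd (Y i)) \<le> ennreal ((1 / 4 ^ i) powr p)" if "j \<ge> i" for i j
  proof -
    have *: "Lint (lebesgue_on {0..}) l p (fst (Y j) - fst (Y i)) + Lint (lebesgue_on {0..1}) m p (snd (Y j) - snd (Y i))
         \<le> ennreal ((1 / 4 ^ i) powr p)"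
      using F[OF Jmono[OF that]] by (simp add: Y_def Xint_Lint)
    show "Lint (lebesgue_on {0..}) l p (fst (Y j) - fst (Y i)) \<le> ennreal ((1 / 4 ^ i) powr p)"
      by (rule order_trans[OF _ *]) simp
    show "Lint (lebesgue_on {0..1}) m p (snd (Y j) - snd (Y i)) \<le> ennreal ((1 / 4 ^ i) powr p)"
      by (rule order_trans[OF _ *]) simp
  qed
  define f :: "cfun \<times> cfun" where "f = ((\<lambda>r k. lim (\<lambda>i. fst (Y i) r k)), (\<lambda>r k. lim (\<lambda>i. snd (Y i) r k)))"
  have lim1: "AE r in lebesgue_on {0..}. \<forall>k<l. (\<lambda>i. fst (Y i) r k) \<longlonglongrightarrow> fst f r k"
    using AE_convergent_of_fast_Cauchy[OF p, of "lebesgue_on {0..}" l "\<lambda>i. fst (Y i)"] meas(1) L(1)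
    by (simp add: f_def convergent_LIMSEQ_iff)
  have lim2: "AE r in lebesgue_on {0..1}. \<forall>k<m. (\<lambda>i. snd (Y i) r k) \<longlonglongrightarrow> snd f r k"
    using AE_convergent_of_fast_Cauchy[OF p, of "lebesgue_on {0..1}" m "\<lambda>i. snd (Y i)"] meas(2) L(2)
    by (simp add: f_def convergent_LIMSEQ_iff)
  have mf: "comp_measurable (lebesgue_on {0..}) l (fst f)" "comp_measurable (lebesgue_on {0..1}) m (snd f)"
    using meas by (auto simp: f_def comp_measurable_def intro!: borel_measurable_lim_metric)
  have le: "Xint l m p (f - Y i) \<le> 2 * ennreal ((1 / 4 ^ i) powr p)" for i
  proof -
    have "Lint (lebesgue_on {0..}) l p (fst f - fst (Y i)) \<le> ennreal ((1 / 4 ^ i) powr p)"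
      by (rule Lint_Fatou[OF p meas(1) meas(1) lim1 L(1)])
    moreover have "Lint (lebesgue_on {0..1}) m p (snd f - snd (Y i)) \<le> ennreal ((1 / 4 ^ i) powr p)"
      by (rule Lint_Fatou[OF p meas(2) meas(2) lim2 L(2)])
    ultimately show ?thesis by (simp add: Xint_Lint mult_2 add_mono)
  qed
  have "inX l m p (f - Y 0)"
    using mf meas le[of 0] by (auto simp: inX_iff intro!: comp_measurable_diff intro: le_less_trans)
  from inX_add[OF p this YX[of 0]] have f: "inX l m p f" by simp
  have fY: "normX l m p (f - Y i) \<le> 2 / 4 ^ i" for i
  proof (rule normX_le[OF p])
    \<comment> \<open>The factor 2 comes from the two components of X; since \<open>p >= 1\<close>
      it is at most \<open>2 powr p\<close> and can move inside the power.\<close>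
    have "2 * ennreal ((1 / 4 ^ i) powr p) \<le> ennreal (2 powr p) * ennreal ((1 / 4 ^ i) powr p)"
    proof (rule mult_right_mono)
      have "(2::real) powr 1 \<le> 2 powr p" using p by (intro powr_mono) auto
      then show "2 \<le> ennreal (2 powr p)" by (metis ennreal_leI ennreal_numeral powr_one zero_le_numeral)
    qed simp
    also have "\<dots> = ennreal ((2 / 4 ^ i) powr p)" by (simp add: powr_divide ennreal_mult[symmetric])
    finally show "Xint l m p (f - Y i) \<le> ennreal ((2 / 4 ^ i) powr p)" using le[of i] by (rule order_trans[rotated])
  qed simp
  have "(\<lambda>n. normX l m p (X n - f)) \<longlonglongrightarrow> 0"
  proof (rule tendstoI)
    fix e :: real assume e: "e > 0"
    have "(\<lambda>i. 3 * (1 / 4) ^ i) \<longlonglongrightarrow> 3 * (0::real)" by (intro tendsto_intros LIMSEQ_power_zero) auto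
    then have "eventually (\<lambda>i. 3 * (1 / 4) ^ i < e) sequentially"
      by (rule order_tendstoD(2)) (use e in simp)
    then obtain i where i: "3 * (1 / 4) ^ i < e" by (auto simp: eventually_sequentially)
    have "normX l m p (X n - f) < e" if "n \<ge> J i" for n
    proof -
      have "normX l m p (X n - f) \<le> normX l m p (X n - Y i) + normX l m p (Y i - f)"
        using X YX f by (intro N_trans) auto
      also have "\<dots> \<le> 1 / 4 ^ i + 2 / 4 ^ i" using Ydist[OF that] fY[of i] N_commute[of "Y i" f] YX f by simp
      also have "\<dots> = 3 * (1 / 4) ^ i" by (simp add: power_one_over)
      finally show ?thesis using i by simp
    qed
    then show "eventually (\<lambda>n. dist (normX l m p (X n - f)) 0 < e) sequentially"
      by (auto simp: eventually_sequentially)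
  qed
  with f show ?thesis by blast
qed

lemma complete_seminormed_normX:
  assumes p: "1 \<le> p"
  shows "complete_seminormed {f. inX l m p f} (normX l m p)"
proof -
  interpret seminormed "{f. inX l m p f}" "normX l m p" using p by (rule seminormed_normX)
  show ?thesis
    by unfold_locales (use complete_normX[OF p] in \<open>simp add: Bex_def\<close>)
qed

section \<open>Sobolev functions are continuous and vanish at infinity\<close>

lemma tail_integral_small:
  fixes h :: "real \<Rightarrow> real"
  assumes h: "h integrable_on {0..}" and nn: "\<And>r. 0 \<le> r \<Longrightarrow> 0 \<le> h r" and e: "e > 0"
  shows "\<exists>s0\<ge>0. \<forall>s\<ge>s0. \<forall>t\<ge>s. integral {s..t} h < e"
proof -
  have sub: "h integrable_on {a..b}" if "0 \<le> a" for a b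
    using integrable_on_subinterval[OF h, of a b] that by auto
  define F where "F = (\<lambda>b. integral {0..b} h)"
  have F: "F t - F s = integral {s..t} h" if "0 \<le> s" "s \<le> t" for s t
    using Henstock_Kurzweil_Integration.integral_combine[of 0 s t h] that sub[of 0 t] by (simp add: F_def)
  have bdd: "F b \<le> integral {0..} h" for b
    unfolding F_def by (rule integral_subset_le) (use sub[of 0 b] h nn in auto)
  define L where "L = (SUP b\<in>{0..}. F b)"
  have bd: "bdd_above (F ` {0..})" using bdd by (auto intro!: bdd_aboveI)
  have "L - e < L" using e by simp
  then obtain s0 where s0: "s0 \<ge> 0" "L - e < F s0"
    unfolding L_def using less_cSUP_iff[OF _ bd, of "L - e"] by (auto simp: L_def)
  have "integral {s..t} h < e" if "s \<ge> s0" "t \<ge> s" for s t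
  proof -
    have "F t \<le> L" unfolding L_def using that s0 by (intro cSUP_upper bd) auto
    moreover have "F s0 \<le> F s"
    proof -
      have "integral {s0..s} h \<ge> 0" using nn s0 by (intro integral_nonneg sub) auto
      then show ?thesis using F[of s0 s] that s0 by simp
    qed
    moreover have "F t - F s = integral {s..t} h" using that s0 by (intro F) auto
    ultimately show ?thesis using s0 by linarith
  qed
  then show ?thesis using s0 by blast
qed

text \<open>For \<open>y > e\<close> the factor \<open>y powr (1 - p)\<close> is at most
  \<open>e powr (1 - p)\<close>. This takes the place of Hoelder's inequality: on an interval of
  length at most 1 it bounds the integral of \<open>|g|\<close> by \<open>e\<close> plus a multiple
  of the integral of \<open>|g| powr p\<close>.\<close>

lemma real_le_add_powr:
  fixes y e p :: real
  assumes "1 \<le> p" "0 \<le> y" "0 < e"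
  shows "y \<le> e + e powr (1 - p) * y powr p"
proof (cases "y \<le> e")
  case True
  have "0 \<le> e powr (1 - p) * y powr p" by simp
  with True show ?thesis by linarith
next
  case False
  have "y = y powr (1 - p) * y powr p" using False assms by (simp flip: powr_add)
  also have "\<dots> \<le> e powr (1 - p) * y powr p"
    using False assms by (intro mult_right_mono powr_mono2') auto
  finally show ?thesis using assms by simp
qed

lemma continuous_on_indefinite_integral:
  fixes f g :: "real \<Rightarrow> complex"
  assumes "\<And>t. t \<in> {0..b} \<Longrightarrow> (g has_integral (f t - f 0)) {0..t}"
  shows "continuous_on {0..b} f"
proof (cases "0 \<le> b")
  case True
  then have "g integrable_on {0..b}" using assms[of b] by (auto simp: has_integral_integrable)
  then have "continuous_on {0..b} (\<lambda>t. f 0 + integral {0..t} g)"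
    by (intro continuous_intros indefinite_integral_continuous_1)
  moreover have "f 0 + integral {0..t} g = f t" if "t \<in> {0..b}" for t
    using assms[OF that] by (simp add: integral_unique)
  ultimately show ?thesis by (rule continuous_on_eq)
qed simp

lemma continuous_on_atLeast_0:
  fixes f :: "real \<Rightarrow> 'a::topological_space"
  assumes "\<And>b. continuous_on {0..b} f"
  shows "continuous_on {0..} f"
  unfolding continuous_on_def
proof
  fix x :: real assume x: "x \<in> {0..}"
  have "at x within {0..} = at x within {0..x + 1}"
    by (rule at_within_nhd[of x "{..<x + 1}"]) auto
  then show "(f \<longlongrightarrow> f x) (at x within {0..})"
    using assms[of "x + 1"] x by (simp add: continuous_on_def)
qed

lemma integrable_on_of_nn_integral:
  fixes h :: "real \<Rightarrow> real"
  assumes "h \<in> borel_measurable (lebesgue_on {0..})" "\<And>r. 0 \<le> h r"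
    and "(\<integral>\<^sup>+ r. ennreal (h r) \<partial>(lebesgue_on {0..})) < \<infinity>"
  shows "h integrable_on {0..}"
proof -
  have "integrable (lebesgue_on {0..}) h"
    using assms by (intro integrableI_nonneg) auto
  then show ?thesis by (rule integrable_on_lebesgue_on) simp
qed

text \<open>Far out, the p-th power integrals of \<open>f\<close> and \<open>g\<close> over unit
  intervals are below \<open>e powr p\<close>. Then \<open>f\<close> varies by at most
  \<open>2 e\<close> on {s..s+1}, so a value of at least \<open>3 e\<close> at \<open>s\<close>
  would keep \<open>|f| >= e\<close> there and make the integral of its p-th power too
  large.\<close>

lemma tendsto_0_at_top_of_powr_integrable:
  fixes f g :: "real \<Rightarrow> complex"
  assumes p: "1 \<le> p"
    and fi: "(\<lambda>r. cmod (f r) powr p) integrable_on {0..}"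
    and gi: "(\<lambda>r. cmod (g r) powr p) integrable_on {0..}"
    and fg: "\<And>t. 0 \<le> t \<Longrightarrow> (g has_integral (f t - f 0)) {0..t}"
  shows "(f \<longlongrightarrow> 0) at_top"
proof (rule tendstoI)
  fix e0 :: real assume "e0 > 0"
  define e where "e = e0 / 3"
  have e: "e > 0" using \<open>e0 > 0\<close> by (simp add: e_def)
  obtain s1 where s1: "s1 \<ge> 0" "\<And>s t. s \<ge> s1 \<Longrightarrow> t \<ge> s \<Longrightarrow> integral {s..t} (\<lambda>r. cmod (f r) powr p) < e powr p"
    using tail_integral_small[OF fi, of "e powr p"] e by auto
  obtain s2 where s2: "s2 \<ge> 0" "\<And>s t. s \<ge> s2 \<Longrightarrow> t \<ge> s \<Longrightarrow> integral {s..t} (\<lambda>r. cmod (g r) powr p) < e powr p"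
    using tail_integral_small[OF gi, of "e powr p"] e by auto
  have "cmod (f s) < e0" if s: "s \<ge> max s1 s2" for s
  proof (rule ccontr)
    assume big: "\<not> cmod (f s) < e0"
    have s0: "0 \<le> s" "s \<ge> s1" "s \<ge> s2" using s s1 by auto
    have near: "cmod (f t - f s) \<le> 2 * e" if t: "t \<in> {s..s + 1}" for t
    proof -
      have gst: "(\<lambda>r. cmod (g r) powr p) integrable_on {s..t}"
        using integrable_on_subinterval[OF gi, of s t] s0 by auto
      have g0t: "g integrable_on {0..t}" using fg[of t] s0 t by auto
      then have gi': "g integrable_on {s..t}" using s0 t by (intro integrable_on_subinterval[OF g0t]) auto
      have "integral {0..s} g + integral {s..t} g = integral {0..t} g"
        using s0 t g0t by (intro Henstock_Kurzweil_Integration.integral_combine) auto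
      then have "f t - f s = integral {s..t} g"
        using fg[of t, THEN integral_unique] fg[of s, THEN integral_unique] s0 t by (simp add: algebra_simps)
      also have "cmod \<dots> \<le> integral {s..t} (\<lambda>r. e + e powr (1 - p) * cmod (g r) powr p)"
        using gi' gst real_le_add_powr[OF p _ e]
        by (intro integral_norm_bound_integral integrable_add integrable_on_mult_right) auto
      also have "\<dots> = e * (t - s) + e powr (1 - p) * integral {s..t} (\<lambda>r. cmod (g r) powr p)"
        using gst t by (subst integral_add) (auto intro!: integrable_on_mult_right)
      also have "\<dots> \<le> e * 1 + e powr (1 - p) * e powr p"
        using e t s2(2)[of s t] s0 by (intro add_mono mult_left_mono) auto
      also have "\<dots> = 2 * e" using e by (simp flip: powr_add)
      finally show ?thesis .
    qed
    have "cmod (f t) \<ge> e" if "t \<in> {s..s + 1}" for t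
      using near[OF that] big norm_triangle_ineq2[of "f s" "f t"] by (simp add: norm_minus_commute e_def)
    then have "e powr p \<le> cmod (f t) powr p" if "t \<in> {s..s + 1}" for t
      using that e p by (intro powr_mono2) auto
    then have "integral {s..s + 1} (\<lambda>r. e powr p) \<le> integral {s..s + 1} (\<lambda>r. cmod (f r) powr p)"
      using integrable_on_subinterval[OF fi, of s "s + 1"] s0 by (intro integral_le) auto
    then show False using s1(2)[of s "s + 1"] s0 by simp
  qed
  then show "eventually (\<lambda>s. dist (f s) 0 < e0) at_top"
    unfolding eventually_at_top_linorder by (intro exI[of _ "max s1 s2"]) simp
qed

lemma comp_powr_integrable:
  assumes "1 \<le> p" "inX l m p f" "k < l"
  shows "(\<lambda>r. cmod (fst f r k) powr p) integrable_on {0..}"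
proof (rule integrable_on_of_nn_integral)
  show "(\<lambda>r. cmod (fst f r k) powr p) \<in> borel_measurable (lebesgue_on {0..})"
    using assms by (auto simp: inX_def)
  have "(\<integral>\<^sup>+ r. ennreal (cmod (fst f r k) powr p) \<partial>(lebesgue_on {0..})) \<le> Lint (lebesgue_on {0..}) l p (fst f)"
    unfolding Lint_def using assms by (intro nn_integral_mono ennreal_leI powr_mono2 cmod_le_vnorm) auto
  also have "\<dots> \<le> Xint l m p f" by (simp add: Xint_Lint)
  also have "\<dots> < \<infinity>" using assms by (simp add: inX_def)
  finally show "(\<integral>\<^sup>+ r. ennreal (cmod (fst f r k) powr p) \<partial>(lebesgue_on {0..})) < \<infinity>" .
qed simp

lemma W1pair_C0C:
  assumes p: "1 \<le> p" and W: "W1pair l m p f g"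
  shows "C0C l m f"
  unfolding C0C_def
proof (intro conjI allI impI)
  fix k assume k: "k < l"
  have fg: "((\<lambda>r. fst g r k) has_integral (fst f t k - fst f 0 k)) {0..t}" if "0 \<le> t" for t
    using W k that by (auto simp: W1pair_def)
  show "continuous_on {0..} (\<lambda>r. fst f r k)"
    using fg by (intro continuous_on_atLeast_0 continuous_on_indefinite_integral) auto
  show "((\<lambda>r. fst f r k) \<longlongrightarrow> 0) at_top"
  proof (rule tendsto_0_at_top_of_powr_integrable[OF p _ _ fg])
    show "(\<lambda>r. cmod (fst f r k) powr p) integrable_on {0..}" "(\<lambda>r. cmod (fst g r k) powr p) integrable_on {0..}"
      using W k comp_powr_integrable[OF p] unfolding W1pair_def by blast+
  qed
next
  fix j assume j: "j < m"
  then show "continuous_on {0..1} (\<lambda>r. snd f r j)"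
    using W by (intro continuous_on_indefinite_integral[of 1 "\<lambda>s. snd g s j"]) (auto simp: W1pair_def)
qed

lemma supnorm_le:
  assumes "\<And>r. 0 \<le> r \<Longrightarrow> vnorm l (fst f r) \<le> b" "\<And>s. s \<in> {0..1} \<Longrightarrow> vnorm m (snd f s) \<le> b"
  shows "supnorm l m f \<le> b"
  unfolding supnorm_def using assms by (intro max.boundedI cSUP_least) auto

lemma W1pair_add:
  assumes p: "1 \<le> p" and W: "W1pair l m p f g" "W1pair l m p f' g'"
  shows "W1pair l m p (f + f') (g + g')"
  unfolding W1pair_def
proof (intro conjI allI impI ballI)
  show "inX l m p (f + f')" "inX l m p (g + g')" using W p by (auto simp: W1pair_def inX_add)
next
  fix k t assume "k < l" "0 \<le> (t::real)"
  then have "((\<lambda>s. fst g s k + fst g' s k) has_integral ((fst f t k - fst f 0 k) + (fst f' t k - fst f' 0 k))) {0..t}"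
    using W by (intro has_integral_add) (auto simp: W1pair_def)
  then show "((\<lambda>s. fst (g + g') s k) has_integral (fst (f + f') t k - fst (f + f') 0 k)) {0..t}"
    by (simp add: add_diff_add)
next
  fix j and t :: real assume "j < m" "t \<in> {0..1}"
  then have "((\<lambda>s. snd g s j + snd g' s j) has_integral ((snd f t j - snd f 0 j) + (snd f' t j - snd f' 0 j))) {0..t}"
    using W unfolding W1pair_def by (intro has_integral_add) blast+
  then show "((\<lambda>s. snd (g + g') s j) has_integral (snd (f + f') t j - snd (f + f') 0 j)) {0..t}"
    by (simp add: add_diff_add)
qed

lemma W1pair_scaleR:
  assumes W: "W1pair l m p f g"
  shows "W1pair l m p (c *\<^sub>R f) (c *\<^sub>R g)"
  unfolding W1pair_def
proof (intro conjI allI impI ballI)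
  show "inX l m p (c *\<^sub>R f)" "inX l m p (c *\<^sub>R g)" using W by (auto simp: W1pair_def inX_scaleR)
next
  fix k t assume "k < l" "0 \<le> (t::real)"
  then have "((\<lambda>s. c *\<^sub>R fst g s k) has_integral c *\<^sub>R (fst f t k - fst f 0 k)) {0..t}"
    using W by (intro has_integral_cmul) (auto simp: W1pair_def)
  then show "((\<lambda>s. fst (c *\<^sub>R g) s k) has_integral (fst (c *\<^sub>R f) t k - fst (c *\<^sub>R f) 0 k)) {0..t}"
    by (simp add: scaleR_diff_right)
next
  fix j and t :: real assume "j < m" "t \<in> {0..1}"
  then have "((\<lambda>s. c *\<^sub>R snd g s j) has_integral c *\<^sub>R (snd f t j - snd f 0 j)) {0..t}"
    using W unfolding W1pair_def by (intro has_integral_cmul) blast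
  then show "((\<lambda>s. snd (c *\<^sub>R g) s j) has_integral (snd (c *\<^sub>R f) t j - snd (c *\<^sub>R f) 0 j)) {0..t}"
    by (simp add: scaleR_diff_right)
qed

section \<open>Boundary layers\<close>

lemma exp_diff_le:
  fixes x y B :: real
  assumes "x \<le> B" "y \<le> B"
  shows "\<bar>exp x - exp y\<bar> \<le> exp B * \<bar>x - y\<bar>"
proof -
  have *: "exp x - exp y \<le> exp B * \<bar>x - y\<bar>" if "y \<le> x" "x \<le> B" for x y
  proof -
    have "1 + (y - x) \<le> exp (y - x)" by (rule exp_ge_add_one_self)
    then have "exp x * (1 + (y - x)) \<le> exp x * exp (y - x)" by (intro mult_left_mono) auto
    then have "exp x - exp y \<le> exp x * (x - y)" by (simp add: algebra_simps flip: exp_add)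
    also have "\<dots> \<le> exp B * (x - y)" using that by (intro mult_right_mono) auto
    finally show ?thesis using that by simp
  qed
  show ?thesis using *[of x y] *[of y x] assms by (cases "y \<le> x") (auto simp: abs_minus_commute)
qed

lemma exp_taylor_le:
  fixes x y B :: real
  assumes "x \<le> B" "y \<le> B"
  shows "\<bar>exp x - exp y - exp y * (x - y)\<bar> \<le> exp B * (x - y)\<^sup>2"
proof -
  have "1 + (x - y) \<le> exp (x - y)" "1 + (y - x) \<le> exp (y - x)" by (rule exp_ge_add_one_self)+
  then have "exp y * (1 + (x - y)) \<le> exp y * exp (x - y)" "exp x * (1 + (y - x)) \<le> exp x * exp (y - x)"
    by (auto intro!: mult_left_mono)
  then have 1: "0 \<le> exp x - exp y - exp y * (x - y)" "exp x - exp y - exp y * (x - y) \<le> (exp x - exp y) * (x - y)"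
    by (auto simp: algebra_simps simp flip: exp_add)
  have "(exp x - exp y) * (x - y) \<le> \<bar>exp x - exp y\<bar> * \<bar>x - y\<bar>" by (metis abs_ge_self abs_mult)
  also have "\<dots> \<le> exp B * \<bar>x - y\<bar> * \<bar>x - y\<bar>" using exp_diff_le[OF assms] by (intro mult_right_mono) auto
  finally show ?thesis using 1 by (simp add: power2_eq_square mult.assoc)
qed

text \<open>The primitive of a bounded measurable function need not be differentiable everywhere, so the
  fundamental theorem does not apply directly. But the defect between both sides grows at most
  quadratically on short intervals and hence vanishes.\<close>

lemma has_integral_exp_primitive:
  fixes g G :: "real \<Rightarrow> real"
  assumes b: "0 \<le> b" and meas: "g \<in> borel_measurable (lebesgue_on {0..b})"
    and bnd: "\<And>r. r \<in> {0..b} \<Longrightarrow> \<bar>g r\<bar> \<le> K"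
    and G: "\<And>t. t \<in> {0..b} \<Longrightarrow> G t = G 0 + integral {0..t} g"
  shows "((\<lambda>r. g r * exp (G r)) has_integral (exp (G b) - exp (G 0))) {0..b}"
proof -
  have K: "K \<ge> 0" using bnd[of 0] b by simp
  have gint: "g integrable_on {0..b}"
    by (rule measurable_bounded_by_integrable_imp_integrable[OF meas, of "\<lambda>_. K"]) (use bnd in auto)
  have gsub: "g integrable_on {s..t}" if "0 \<le> s" "t \<le> b" for s t
    using integrable_on_subinterval[OF gint] that by auto
  have Gdiff: "G t - G s = integral {s..t} g" if "0 \<le> s" "s \<le> t" "t \<le> b" for s t
    using Henstock_Kurzweil_Integration.integral_combine[of 0 s t g] that gsub[of 0 t] G[of s] G[of t] by simp
  have Glip: "\<bar>G t - G s\<bar> \<le> K * (t - s)" if "0 \<le> s" "s \<le> t" "t \<le> b" for s t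
  proof -
    have "norm (integral {s..t} g) \<le> integral {s..t} (\<lambda>_. K)"
      using that bnd gsub by (intro integral_norm_bound_integral) auto
    then show ?thesis using that Gdiff[of s t] by (simp add: mult.commute)
  qed
  define B where "B = G 0 + K * b"
  have GB: "G t \<le> B" if "t \<in> {0..b}" for t
  proof -
    have "K * t \<le> K * b" using K that by (intro mult_left_mono) auto
    then show ?thesis using Glip[of 0 t] that by (simp add: B_def)
  qed
  have Gcont: "continuous_on {0..b} G"
  proof (rule continuous_on_eq)
    show "continuous_on {0..b} (\<lambda>t. G 0 + integral {0..t} g)"
      by (intro continuous_intros indefinite_integral_continuous_1 gint)
  qed (rule G[symmetric])
  have hint: "(\<lambda>r. g r * exp (G r)) integrable_on {0..b}"
  proof (rule measurable_bounded_by_integrable_imp_integrable[of _ _ "\<lambda>_. K * exp B"])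
    have "(\<lambda>r. exp (G r)) \<in> borel_measurable (lebesgue_on {0..b})"
      by (rule continuous_imp_measurable_on_sets_lebesgue[OF continuous_on_exp[OF Gcont]]) simp
    then show "(\<lambda>r. g r * exp (G r)) \<in> borel_measurable (lebesgue_on {0..b})"
      using meas by (intro borel_measurable_times)
    show "norm (g r * exp (G r)) \<le> K * exp B" if "r \<in> {0..b}" for r
      using bnd[OF that] GB[OF that] K by (simp add: abs_mult mult_mono)
  qed auto
  have hsub: "(\<lambda>r. g r * exp (G r)) integrable_on {s..t}" if "0 \<le> s" "t \<le> b" for s t
    using integrable_on_subinterval[OF hint] that by auto
  define H where "H = (\<lambda>t. exp (G t) - integral {0..t} (\<lambda>r. g r * exp (G r)))"
  define C where "C = 2 * (exp B * K\<^sup>2)"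
  have quad: "\<bar>H t - H s\<bar> \<le> C * (t - s)\<^sup>2" if st: "0 \<le> s" "s \<le> t" "t \<le> b" for s t
  proof -
    have "integral {0..t} (\<lambda>r. g r * exp (G r)) - integral {0..s} (\<lambda>r. g r * exp (G r)) = integral {s..t} (\<lambda>r. g r * exp (G r))"
      using Henstock_Kurzweil_Integration.integral_combine[of 0 s t "\<lambda>r. g r * exp (G r)"] st hsub[of 0 t] by simp
    \<comment> \<open>Freezing \<open>exp (G r)\<close> at \<open>s\<close> produces exactly the
      linear Taylor term of \<open>exp (G t)\<close>; what remains is of second order in
      \<open>t - s\<close>.\<close>
    also have "\<dots> = integral {s..t} (\<lambda>r. g r * (exp (G r) - exp (G s))) + exp (G s) * (G t - G s)"
    proof -
      have "integral {s..t} (\<lambda>r. g r * exp (G r)) - integral {s..t} (\<lambda>r. g r * exp (G s))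
          = integral {s..t} (\<lambda>r. g r * exp (G r) - g r * exp (G s))"
        using st hsub gsub by (intro integral_diff[symmetric] integrable_on_mult_left) auto
      moreover have "integral {s..t} (\<lambda>r. g r * exp (G s)) = exp (G s) * (G t - G s)"
        using Gdiff[OF st] by (simp add: mult.commute)
      ultimately show ?thesis by (simp add: right_diff_distrib)
    qed
    finally have e: "H t - H s = (exp (G t) - exp (G s) - exp (G s) * (G t - G s)) - integral {s..t} (\<lambda>r. g r * (exp (G r) - exp (G s)))"
      by (simp add: H_def)
    have "norm (integral {s..t} (\<lambda>r. g r * (exp (G r) - exp (G s)))) \<le> integral {s..t} (\<lambda>_. K * (exp B * (K * (t - s))))"
    proof (rule integral_norm_bound_integral)
      show "(\<lambda>r. g r * (exp (G r) - exp (G s))) integrable_on {s..t}"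
        unfolding right_diff_distrib using st hsub gsub by (intro integrable_diff integrable_on_mult_left) auto
      fix r assume r: "r \<in> {s..t}"
      have "\<bar>exp (G r) - exp (G s)\<bar> \<le> exp B * \<bar>G r - G s\<bar>" using r st by (intro exp_diff_le GB) auto
      also have "\<dots> \<le> exp B * (K * (r - s))" using Glip[of s r] r st by (intro mult_left_mono) auto
      also have "\<dots> \<le> exp B * (K * (t - s))" using K r by (intro mult_left_mono) auto
      finally show "norm (g r * (exp (G r) - exp (G s))) \<le> K * (exp B * (K * (t - s)))"
        using bnd[of r] r st K by (simp add: abs_mult) (intro mult_mono, auto)
    qed auto
    also have "\<dots> = exp B * K\<^sup>2 * (t - s)\<^sup>2" using st by (simp add: power2_eq_square)
    finally have 1: "\<bar>integral {s..t} (\<lambda>r. g r * (exp (G r) - exp (G s)))\<bar> \<le> exp B * K\<^sup>2 * (t - s)\<^sup>2" by simp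
    have "\<bar>exp (G t) - exp (G s) - exp (G s) * (G t - G s)\<bar> \<le> exp B * (G t - G s)\<^sup>2"
      using st by (intro exp_taylor_le GB) auto
    also have "(G t - G s)\<^sup>2 \<le> (K * (t - s))\<^sup>2"
      using Glip[OF st] by (metis abs_ge_zero power2_abs power_mono)
    then have "exp B * (G t - G s)\<^sup>2 \<le> exp B * K\<^sup>2 * (t - s)\<^sup>2" by (simp add: power_mult_distrib)
    finally show ?thesis using 1 unfolding e C_def by linarith
  qed
  have quad': "\<bar>H t - H s\<bar> \<le> C * (t - s)\<^sup>2" if "s \<in> {0..b}" "t \<in> {0..b}" for s t
    using quad[of s t] quad[of t s] that by (cases "s \<le> t") (auto simp: abs_minus_commute power2_commute)
  have "\<exists>c. \<forall>x\<in>{0..b}. H x = c"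
  proof (rule has_field_derivative_zero_constant)
    fix x assume x: "x \<in> {0..b}"
    have "((\<lambda>y. (H y - H x) / (y - x)) \<longlongrightarrow> 0) (at x within {0..b})"
    proof (rule Lim_null_comparison)
      have "((\<lambda>y. C * \<bar>y - x\<bar>) \<longlongrightarrow> C * \<bar>x - x\<bar>) (at x within {0..b})" by (intro tendsto_intros)
      then show "((\<lambda>y. C * \<bar>y - x\<bar>) \<longlongrightarrow> 0) (at x within {0..b})" by simp
      have "norm ((H y - H x) / (y - x)) \<le> C * \<bar>y - x\<bar>" if "y \<in> {0..b}" "y \<noteq> x" for y
      proof -
        have "\<bar>H y - H x\<bar> \<le> (C * \<bar>y - x\<bar>) * \<bar>y - x\<bar>"
        proof -
          have "(y - x)\<^sup>2 = \<bar>y - x\<bar> * \<bar>y - x\<bar>" by (simp add: power2_eq_square)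
          then show ?thesis using quad'[OF x that(1)] by (simp only: mult.assoc)
        qed
        then show ?thesis using that by (simp add: pos_divide_le_eq)
      qed
      then show "\<forall>\<^sub>F y in at x within {0..b}. norm ((H y - H x) / (y - x)) \<le> C * \<bar>y - x\<bar>"
        by (simp add: eventually_at_filter)
    qed
    then show "(H has_field_derivative 0) (at x within {0..b})" by (simp add: has_field_derivative_iff)
  qed simp
  then have "H b = H 0" using b by auto
  then have "integral {0..b} (\<lambda>r. g r * exp (G r)) = exp (G b) - exp (G 0)" by (simp add: H_def)
  then show ?thesis using hint by (simp add: has_integral_integrable_integral)
qed

text \<open>The bound on \<open>qinv\<close> makes it Lipschitz off a null set, hence measurable.
  This supplies the measurability of the coefficient matrix c, about which the hypotheses on
  \<open>qinv\<close> say only that it inverts \<open>q\<close> and is essentially bounded.\<close>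

lemma measurable_matrix_inverse:
  fixes q qinv :: "real \<Rightarrow> cmat"
  assumes D: "D \<in> sets lebesgue"
    and lip: "\<And>r s i k. r \<in> D \<Longrightarrow> s \<in> D \<Longrightarrow> i < n \<Longrightarrow> k < n \<Longrightarrow> cmod (q r i k - q s i k) \<le> K * \<bar>r - s\<bar>"
    and inv: "\<And>r i k. r \<in> D \<Longrightarrow> i < n \<Longrightarrow> k < n \<Longrightarrow> (\<Sum>j<n. q r i j * qinv r j k) = (if i = k then 1 else 0) \<and>
      (\<Sum>j<n. qinv r i j * q r j k) = (if i = k then 1 else 0)"
    and bnd: "AE r in lebesgue_on D. \<forall>i<n. \<forall>k<n. cmod (qinv r i k) \<le> M"
    and ik: "i < n" "k < n"
  shows "(\<lambda>r. qinv r i k) \<in> borel_measurable (lebesgue_on D)"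
proof -
  obtain Z where Z: "Z \<in> null_sets (lebesgue_on D)" "{r \<in> space (lebesgue_on D). \<not> (\<forall>i<n. \<forall>k<n. cmod (qinv r i k) \<le> M)} \<subseteq> Z"
    using AE_E[OF bnd] by (metis (no_types, lifting) null_setsI)
  have bZ: "cmod (qinv r i k) \<le> M" if "r \<in> D - Z" "i < n" "k < n" for r i k
    using Z(2) that by auto
  have "dist (qinv r i k) (qinv s i k) \<le> (real n * real n * (M * K * M)) * dist r s" if r: "r \<in> D - Z" and s: "s \<in> D - Z" for r s
  proof -
    have M: "M \<ge> 0" using bZ[OF r ik] norm_ge_zero order_trans by blast
    \<comment> \<open>The entrywise form of the identity
      \<open>qinv r - qinv s = qinv r (q s - q r) qinv s\<close>.\<close>
    have "(\<Sum>a<n. \<Sum>c<n. qinv r i a * (q s a c - q r a c) * qinv s c k)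
      = (\<Sum>a<n. qinv r i a * (\<Sum>c<n. q s a c * qinv s c k)) - (\<Sum>a<n. \<Sum>c<n. (qinv r i a * q r a c) * qinv s c k)"
      by (simp add: algebra_simps sum_subtractf sum_distrib_left)
    also have "(\<Sum>a<n. \<Sum>c<n. (qinv r i a * q r a c) * qinv s c k) = (\<Sum>c<n. (\<Sum>a<n. qinv r i a * q r a c) * qinv s c k)"
      by (subst sum.swap) (simp add: sum_distrib_right)
    also have "\<dots> = (\<Sum>c<n. (if i = c then 1 else 0) * qinv s c k)"
      using inv r ik by (intro sum.cong) auto
    also have "\<dots> = qinv s i k" using ik by (simp add: if_distrib[of "\<lambda>x. x * _"] sum.delta' cong: if_cong)
    also have "(\<Sum>a<n. qinv r i a * (\<Sum>c<n. q s a c * qinv s c k)) = (\<Sum>a<n. qinv r i a * (if a = k then 1 else 0))"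
      using inv s ik by (intro sum.cong) auto
    also have "\<dots> = qinv r i k" using ik by (simp add: if_distrib[of "\<lambda>x. _ * x"] cong: if_cong)
    finally have "qinv r i k - qinv s i k = (\<Sum>a<n. \<Sum>c<n. qinv r i a * (q s a c - q r a c) * qinv s c k)" ..
    also have "cmod \<dots> \<le> (\<Sum>a<n. \<Sum>c<n. M * (K * \<bar>r - s\<bar>) * M)"
    proof (intro sum_norm_le)
      fix a c assume "a \<in> {..<n}" "c \<in> {..<n}"
      then have *: "cmod (qinv r i a) \<le> M" "cmod (q s a c - q r a c) \<le> K * \<bar>r - s\<bar>" "cmod (qinv s c k) \<le> M"
        using bZ[OF r] bZ[OF s] lip[of s r a c] r s ik by (auto simp: abs_minus_commute)
      then show "cmod (qinv r i a * (q s a c - q r a c) * qinv s c k) \<le> M * (K * \<bar>r - s\<bar>) * M"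
        unfolding norm_mult using M mult_nonneg_nonneg[OF M order_trans[OF norm_ge_zero *(2)]]
        by (intro mult_mono *) auto
    qed
    finally show ?thesis by (simp add: dist_norm algebra_simps)
  qed
  then have "continuous_on (D - Z) (\<lambda>r. qinv r i k)"
    by (intro lipschitz_on_continuous_on[of "\<bar>real n * real n * (M * K * M)\<bar>"] lipschitz_onI)
       (auto intro!: order_trans[OF _ mult_right_mono[OF abs_ge_self]])
  moreover have "D - Z \<in> sets lebesgue"
  proof -
    have "Z \<in> sets lebesgue" using null_setsD2[OF Z(1)] D by (simp add: sets_restrict_space_iff)
    then show ?thesis using D by blast
  qed
  ultimately have "(\<lambda>r. qinv r i k) \<in> borel_measurable (lebesgue_on (D - Z))"
    by (rule continuous_imp_measurable_on_sets_lebesgue)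
  then show ?thesis using borel_measurable_diff_null[OF Z(1) D] by blast
qed

text \<open>The source of the rate: the p-th power of a layer decays with \<open>mu\<close>
  proportional to \<open>la\<close>, so its integral is O(1 / la).\<close>

lemma nn_integral_exp_decay:
  assumes mu: "mu > 0" and D: "D = {0..} \<and> a = 0 \<or> D = {0..1::real} \<and> (a = 0 \<or> a = 1)"
  shows "(\<integral>\<^sup>+ r. ennreal (exp (- mu * \<bar>r - a\<bar>)) \<partial>(lebesgue_on D)) \<le> ennreal (1 / mu)"
proof -
  have le: "(\<integral>\<^sup>+ r. ennreal (f r) \<partial>(lebesgue_on D)) = ennreal I"
    if "(f has_integral I) D" "\<And>r. r \<in> D \<Longrightarrow> 0 \<le> f r" "D \<in> sets lebesgue" for f I D
  proof -
    have "integrable (lebesgue_on D) f"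
      using that by (intro absolutely_integrable_imp_integrable nonnegative_absolutely_integrable_1) auto
    then have "(\<integral>\<^sup>+ r. ennreal (f r) \<partial>(lebesgue_on D)) = ennreal (integral\<^sup>L (lebesgue_on D) f)"
      using that by (intro nn_integral_eq_integral) (auto intro!: AE_I2)
    also have "integral\<^sup>L (lebesgue_on D) f = I"
      using that \<open>integrable (lebesgue_on D) f\<close> by (metis integral_unique lebesgue_integral_eq_integral)
    finally show ?thesis .
  qed
  have zero: "(\<integral>\<^sup>+ r. ennreal (exp (- mu * \<bar>r\<bar>)) \<partial>(lebesgue_on {0..})) = ennreal (1 / mu)"
  proof (rule le)
    have "((\<lambda>r. exp (- mu * r)) has_integral 1 / mu) {0..}"
      using has_integral_exp_minus_to_infinity[OF mu, of 0] by simp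
    then show "((\<lambda>r. exp (- mu * \<bar>r\<bar>)) has_integral 1 / mu) {0..}"
      by (rule has_integral_eq[rotated]) auto
  qed auto
  consider "D = {0..}" "a = 0" | "D = {0..1}" "a = 0" | "D = {0..1}" "a = 1" using D by blast
  then show ?thesis
  proof cases
    case 1 then show ?thesis using zero by simp
  next
    case 2
    have "(\<integral>\<^sup>+ r. ennreal (exp (- mu * \<bar>r\<bar>)) \<partial>(lebesgue_on {0..1})) \<le> (\<integral>\<^sup>+ r. ennreal (exp (- mu * \<bar>r\<bar>)) \<partial>(lebesgue_on {0..}))"
      by (auto simp: nn_integral_restrict_space intro!: nn_integral_mono simp: indicator_def)
    then show ?thesis using 2 zero by simp
  next
    case 3
    have "((\<lambda>r. exp (- mu * (1 - r))) has_integral (exp (- mu * (1 - 1)) / mu - exp (- mu * (1 - 0)) / mu)) {0..1}"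
      using mu by (intro fundamental_theorem_of_calculus)
        (auto intro!: derivative_eq_intros simp flip: has_real_derivative_iff_has_vector_derivative)
    then have "((\<lambda>r. exp (- mu * \<bar>r - 1\<bar>)) has_integral (1 / mu - exp (- mu) / mu)) {0..1}"
      by (subst has_integral_cong[of _ _ "\<lambda>r. exp (- mu * (1 - r))"]) auto
    from le[OF this] have "(\<integral>\<^sup>+ r. ennreal (exp (- mu * \<bar>r - 1\<bar>)) \<partial>(lebesgue_on {0..1})) = ennreal (1 / mu - exp (- mu) / mu)"
      by simp
    also have "\<dots> \<le> ennreal (1 / mu)" using mu by (intro ennreal_leI) simp
    finally show ?thesis using 3 by simp
  qed
qed

lemma sum_powr_le:
  fixes y :: "nat \<Rightarrow> real"
  assumes p: "1 \<le> p" and y: "\<And>b. b < n \<Longrightarrow> 0 \<le> y b"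
  shows "(\<Sum>b<n. y b) powr p \<le> real n powr p * (\<Sum>b<n. y b powr p)"
proof (cases "n = 0")
  case False
  define m where "m = Max (y ` {..<n})"
  have "m \<in> y ` {..<n}" unfolding m_def using False by (intro Max_in) auto
  then obtain b0 where b0: "b0 < n" "m = y b0" by auto
  have "(\<Sum>b<n. y b) \<le> (\<Sum>b<n. m)" by (intro sum_mono) (auto simp: m_def)
  then have "(\<Sum>b<n. y b) \<le> real n * m" by simp
  then have "(\<Sum>b<n. y b) powr p \<le> (real n * m) powr p"
    using p y by (intro powr_mono2 sum_nonneg) auto
  also have "\<dots> = real n powr p * m powr p" using b0 y by (simp add: powr_mult)
  also have "m powr p \<le> (\<Sum>b<n. y b powr p)"
    unfolding b0(2) using b0(1) by (intro member_le_sum) auto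
  finally show ?thesis by (simp add: mult_left_mono)
qed simp

text \<open>In each component with x b \<open>\<noteq>\<close> 0 the profile solves \<open>lam b * e' = la * e\<close> exactly and decays away
  from the end point a b from which characteristics enter. Freezing q at that end point avoids differentiating q;
  the error is of size \<open>\<bar>s - a b\<bar> * e\<close>, which gains a factor 1 / la.\<close>

locale boundary_layer =
  fixes D :: "real set" and n :: nat and lam :: "nat \<Rightarrow> real \<Rightarrow> real" and q qinv :: "real \<Rightarrow> cmat"
    and c0 c1 K M :: real and a :: "nat \<Rightarrow> real" and x :: cvec
  assumes D: "D = {0..} \<or> D = {0..1}"
    and c0: "0 < c0" and c1: "0 < c1" and K: "0 \<le> K" and M: "0 \<le> M"
    and meas: "k < n \<Longrightarrow> lam k \<in> borel_measurable (lebesgue_on D)"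
    and lam_bound: "k < n \<Longrightarrow> r \<in> D \<Longrightarrow> c0 \<le> \<bar>lam k r\<bar> \<and> \<bar>lam k r\<bar> \<le> c1"
    and lip: "r \<in> D \<Longrightarrow> s \<in> D \<Longrightarrow> i < n \<Longrightarrow> k < n \<Longrightarrow> cmod (q r i k - q s i k) \<le> K * \<bar>r - s\<bar>"
    and linv: "r \<in> D \<Longrightarrow> i < n \<Longrightarrow> k < n \<Longrightarrow> (\<Sum>j<n. qinv r i j * q r j k) = (if i = k then 1 else 0)"
    and q_bound: "AE r in lebesgue_on D. \<forall>i<n. \<forall>k<n. cmod (q r i k) \<le> M \<and> cmod (qinv r i k) \<le> M"
    and anchor: "b < n \<Longrightarrow> a b = 0 \<or> a b = 1 \<and> D = {0..1}"
    and sgn: "b < n \<Longrightarrow> x b \<noteq> 0 \<Longrightarrow> a b = 0 \<and> (\<forall>r\<in>D. lam b r < 0) \<or> a b = 1 \<and> (\<forall>r\<in>D. lam b r > 0)"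
begin

text \<open>Signed travel time from the anchor \<open>a b\<close> to \<open>s\<close>. Where
  \<open>x b\<close> is nonzero it is nonpositive on \<open>D\<close>, so
  \<open>exp (la * eta b s)\<close> decays away from the anchor.\<close>

definition eta :: "nat \<Rightarrow> real \<Rightarrow> real" where
  "eta b s = integral {0..s} (\<lambda>r. 1 / lam b r) - integral {0..a b} (\<lambda>r. 1 / lam b r)"

definition prof :: "real \<Rightarrow> cfun" where
  "prof la s = (\<lambda>i. \<Sum>b<n. q (a b) i b * (complex_of_real (exp (la * eta b s)) * x b))"

definition dprof :: "real \<Rightarrow> cfun" where
  "dprof la s = (\<lambda>i. \<Sum>b<n. q (a b) i b * (complex_of_real (la / lam b s * exp (la * eta b s)) * x b))"

definition flat :: "real \<Rightarrow> cfun" where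
  "flat la s = (\<lambda>b. complex_of_real (exp (la * eta b s)) * x b)"

text \<open>The layer decays at rate \<open>la / c1\<close>. Only half of it is kept here; the other
  half pays for a factor \<open>la * |s - a b|\<close>.\<close>

definition bump :: "real \<Rightarrow> nat \<Rightarrow> real \<Rightarrow> real" where
  "bump la b s = exp (- (la / (2 * c1)) * \<bar>s - a b\<bar>)"

definition weight :: "real \<Rightarrow> real \<Rightarrow> real" where
  "weight la s = (\<Sum>b<n. bump la b s)"

definition amplitude :: real where
  "amplitude = (\<Sum>b<n. cmod (x b))"

definition frozen :: real where
  "frozen = (\<Sum>i<n. \<Sum>b<n. cmod (q (a b) i b))"

lemma D_interval: "s \<in> D \<Longrightarrow> 0 \<le> r \<Longrightarrow> r \<le> s \<Longrightarrow> r \<in> D" and D_nonneg: "s \<in> D \<Longrightarrow> 0 \<le> s"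
  and D_lebesgue [simp]: "D \<in> sets lebesgue" and zero_in_D: "0 \<in> D"
  using D by auto

lemma anchor_in_D: "b < n \<Longrightarrow> a b \<in> D"
  using anchor[of b] zero_in_D by auto

lemma inv_meas: "b < n \<Longrightarrow> (\<lambda>r. 1 / lam b r) \<in> borel_measurable (lebesgue_on D)"
  using meas[of b] by (intro borel_measurable_divide) auto

lemma inv_meas_subset: "b < n \<Longrightarrow> S \<subseteq> D \<Longrightarrow> (\<lambda>r. 1 / lam b r) \<in> borel_measurable (lebesgue_on S)"
  using measurable_restrict_mono[OF inv_meas] by blast

lemma inv_bound: "b < n \<Longrightarrow> r \<in> D \<Longrightarrow> \<bar>1 / lam b r\<bar> \<le> 1 / c0"
  using lam_bound[of b r] c0 by (auto simp: divide_simps)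

lemma inv_integrable: assumes "b < n" "s \<in> D" "0 \<le> r" shows "(\<lambda>r. 1 / lam b r) integrable_on {r..s}"
proof -
  have sub: "{r..s} \<subseteq> D" using D_interval[OF assms(2)] assms(3) by auto
  show ?thesis
    by (rule measurable_bounded_by_integrable_imp_integrable[OF inv_meas_subset[OF assms(1) sub], of "\<lambda>_. 1 / c0"])
      (use inv_bound[OF assms(1)] sub in auto)
qed

lemma eta_combine: assumes "b < n" "s \<in> D" "t \<in> D" "s \<le> t"
  shows "eta b t - eta b s = integral {s..t} (\<lambda>r. 1 / lam b r)"
  using Henstock_Kurzweil_Integration.integral_combine[of 0 s t "\<lambda>r. 1 / lam b r"]
    inv_integrable[OF assms(1,3), of 0] assms D_nonneg[of s] by (simp add: eta_def)

lemma eta_anchor: "eta b (a b) = 0"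
  by (simp add: eta_def)

lemma eta_bounds:
  assumes b: "b < n" "x b \<noteq> 0" and s: "s \<in> D"
  shows "eta b s \<le> - \<bar>s - a b\<bar> / c1" "- \<bar>s - a b\<bar> / c0 \<le> eta b s"
proof -
  have int: "integral {r..t} (\<lambda>r. 1 / lam b r) \<le> (t - r) * u \<and> (t - r) * l \<le> integral {r..t} (\<lambda>r. 1 / lam b r)"
    if "0 \<le> r" "r \<le> t" "t \<in> D" "\<And>y. y \<in> D \<Longrightarrow> 1 / lam b y \<le> u" "\<And>y. y \<in> D \<Longrightarrow> l \<le> 1 / lam b y" for r t u l
  proof -
    have sub: "y \<in> D" if "y \<in> {r..t}" for y using D_interval[OF \<open>t \<in> D\<close>, of y] that \<open>0 \<le> r\<close> by auto
    have "integral {r..t} (\<lambda>r. 1 / lam b r) \<le> integral {r..t} (\<lambda>_. u)"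
      using that sub b inv_integrable by (intro integral_le) auto
    moreover have "integral {r..t} (\<lambda>_. l) \<le> integral {r..t} (\<lambda>r. 1 / lam b r)"
      using that sub b inv_integrable by (intro integral_le) auto
    ultimately show ?thesis using that by simp
  qed
  have "eta b s \<le> - \<bar>s - a b\<bar> / c1 \<and> - \<bar>s - a b\<bar> / c0 \<le> eta b s"
    using sgn[OF b]
  proof
    assume *: "a b = 0 \<and> (\<forall>r\<in>D. lam b r < 0)"
    have "1 / lam b y \<le> - 1 / c1" "- 1 / c0 \<le> 1 / lam b y" if "y \<in> D" for y
      using lam_bound[OF b(1) that] *[THEN conjunct2, rule_format, OF that] c0 c1 by (auto simp: field_simps)
    from int[of 0 s, OF _ _ s this] D_nonneg[OF s] eta_combine[OF b(1) zero_in_D s] eta_anchor[of b] *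
    show ?thesis by auto
  next
    assume *: "a b = 1 \<and> (\<forall>r\<in>D. lam b r > 0)"
    then have D1: "D = {0..1}" using anchor[OF b(1)] by auto
    have "1 / lam b y \<le> 1 / c0" "1 / c1 \<le> 1 / lam b y" if "y \<in> D" for y
      using lam_bound[OF b(1) that] *[THEN conjunct2, rule_format, OF that] c0 c1 by (auto simp: field_simps)
    from int[of s 1, OF _ _ _ this] D_nonneg[OF s] eta_combine[OF b(1) s, of 1] eta_anchor[of b] * D1 s
    have "- eta b s \<le> (1 - s) * (1 / c0)" "(1 - s) * (1 / c1) \<le> - eta b s" by auto
    moreover have "(s - 1) / c = - ((1 - s) / c)" for c by (simp add: diff_divide_distrib)
    ultimately show ?thesis using * D1 s by (auto simp del: minus_divide_left)
  qed
  then show "eta b s \<le> - \<bar>s - a b\<bar> / c1" "- \<bar>s - a b\<bar> / c0 \<le> eta b s" by auto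
qed

lemma cmod_le_amplitude: "b < n \<Longrightarrow> cmod (x b) \<le> amplitude"
  unfolding amplitude_def by (intro member_le_sum) auto

lemma amplitude_nonneg: "0 \<le> amplitude"
  by (simp add: amplitude_def sum_nonneg)

lemma frozen_nonneg: "0 \<le> frozen"
  by (simp add: frozen_def sum_nonneg)

lemma cmod_frozen_le: assumes "i < n" "b < n" shows "cmod (q (a b) i b) \<le> frozen"
proof -
  have "cmod (q (a b) i b) \<le> (\<Sum>b<n. cmod (q (a b) i b))" using assms by (intro member_le_sum) auto
  also have "\<dots> \<le> frozen" unfolding frozen_def using assms
    by (intro member_le_sum[of i "{..<n}" "\<lambda>i. \<Sum>b<n. cmod (q (a b) i b)"]) (auto intro: sum_nonneg)
  finally show ?thesis .
qed

lemma bump_pos: "0 < bump la b s"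
  by (simp add: bump_def)

lemma weight_nonneg: "0 \<le> weight la s"
  by (simp add: weight_def bump_def sum_nonneg)

text \<open>The layer is bounded by the square of \<open>bump\<close>. In the second claim one
  factor is used up by \<open>y * exp (- y) <= 1\<close>, where
  \<open>la * |s - a b| = 2 * c1 * y\<close>.\<close>

lemma cmod_exp_le_bump:
  assumes b: "b < n" and s: "s \<in> D" and la: "la > 0"
  shows "cmod (complex_of_real (exp (la * eta b s)) * x b) \<le> amplitude * bump la b s"
    and "la * \<bar>s - a b\<bar> * cmod (complex_of_real (exp (la * eta b s)) * x b) \<le> 2 * c1 * amplitude * bump la b s"
proof -
  define y where "y = la * \<bar>s - a b\<bar> / (2 * c1)"
  have y: "y \<ge> 0" "la * \<bar>s - a b\<bar> = 2 * c1 * y" using la c1 by (auto simp: y_def)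
  have bump: "bump la b s = exp (- y)" by (simp add: bump_def y_def)
  have main: "cmod (complex_of_real (exp (la * eta b s)) * x b) \<le> amplitude * (exp (- y) * exp (- y))"
  proof (cases "x b = 0")
    case True then show ?thesis using amplitude_nonneg by simp
  next
    case False
    have "la * eta b s \<le> la * (- \<bar>s - a b\<bar> / c1)" using eta_bounds(1)[OF b False s] la by (intro mult_left_mono) auto
    also have "\<dots> = - y + - y" using c1 by (simp add: y_def field_simps)
    finally have "exp (la * eta b s) \<le> exp (- y) * exp (- y)" by (simp flip: exp_add)
    then show ?thesis using cmod_le_amplitude[OF b] amplitude_nonneg
      by (simp add: norm_mult mult.commute[of amplitude]) (intro mult_mono, auto)
  qed
  have "exp (- y) \<le> 1" using y by simp
  then have "amplitude * (exp (- y) * exp (- y)) \<le> amplitude * (exp (- y) * 1)"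
    using amplitude_nonneg by (intro mult_left_mono) auto
  with main show "cmod (complex_of_real (exp (la * eta b s)) * x b) \<le> amplitude * bump la b s"
    unfolding bump by simp
  have "y * exp (- y) \<le> 1"
  proof -
    have "y \<le> exp y" using exp_ge_add_one_self[of y] by linarith
    then have "y * exp (- y) \<le> exp y * exp (- y)" by (intro mult_right_mono) auto
    then show ?thesis by (simp flip: exp_add)
  qed
  have "la * \<bar>s - a b\<bar> * cmod (complex_of_real (exp (la * eta b s)) * x b) \<le> la * \<bar>s - a b\<bar> * (amplitude * (exp (- y) * exp (- y)))"
    using main la by (intro mult_left_mono) auto
  also have "\<dots> = (2 * c1 * amplitude * exp (- y)) * (y * exp (- y))" by (simp only: y) (simp add: algebra_simps)
  also have "\<dots> \<le> (2 * c1 * amplitude * exp (- y)) * 1" 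
    using \<open>y * exp (- y) \<le> 1\<close> c1 amplitude_nonneg by (intro mult_left_mono) auto
  finally show "la * \<bar>s - a b\<bar> * cmod (complex_of_real (exp (la * eta b s)) * x b) \<le> 2 * c1 * amplitude * bump la b s"
    unfolding bump by simp
qed

lemma eta_continuous: assumes b: "b < n" shows "continuous_on D (eta b)"
proof -
  have c: "continuous_on {0..t} (eta b)" if "t \<in> D" for t
    unfolding eta_def using inv_integrable[OF b that] by (intro continuous_intros indefinite_integral_continuous_1) auto
  from D show ?thesis
  proof
    assume D0: "D = {0..}"
    have "continuous_on {0..t} (eta b)" for t using c[of t] D0 by (cases "0 \<le> t") auto
    then show ?thesis unfolding D0 by (rule continuous_on_atLeast_0)
  next
    assume "D = {0..1}" then show ?thesis using c[of 1] by simp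
  qed
qed

lemma prof_continuous: "continuous_on D (\<lambda>s. prof la s i)"
  unfolding prof_def by (intro continuous_intros eta_continuous) auto

lemma prof_measurable: "comp_measurable (lebesgue_on D) n (prof la)"
  unfolding comp_measurable_def
  by (intro allI impI continuous_imp_measurable_on_sets_lebesgue[OF prof_continuous]) simp

lemma dprof_measurable: "comp_measurable (lebesgue_on D) n (dprof la)"
  unfolding comp_measurable_def dprof_def
proof (intro allI impI borel_measurable_sum borel_measurable_times borel_measurable_const)
  fix b assume b: "b \<in> {..<n}"
  then have 1: "(\<lambda>r. la / lam b r) \<in> borel_measurable (lebesgue_on D)"
    using meas[of b] by (intro borel_measurable_divide) auto
  have 2: "(\<lambda>r. exp (la * eta b r)) \<in> borel_measurable (lebesgue_on D)"
    using b by (intro continuous_imp_measurable_on_sets_lebesgue continuous_on_exp continuous_on_mult continuous_on_const eta_continuous) auto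
  show "(\<lambda>r. complex_of_real (la / lam b r * exp (la * eta b r))) \<in> borel_measurable (lebesgue_on D)"
    by (rule measurable_compose[OF borel_measurable_times[OF 1 2]])
      (intro borel_measurable_continuous_onI continuous_intros)
qed

lemma prof_has_integral:
  assumes t: "t \<in> D" and la: "la > 0"
  shows "((\<lambda>s. dprof la s i) has_integral (prof la t i - prof la 0 i)) {0..t}"
proof -
  have "((\<lambda>s. \<Sum>b<n. q (a b) i b * (complex_of_real (la / lam b s * exp (la * eta b s)) * x b)) has_integral
     (\<Sum>b<n. q (a b) i b * (complex_of_real (exp (la * eta b t) - exp (la * eta b 0)) * x b))) {0..t}"
  proof (intro has_integral_sum has_integral_mult_right has_integral_mult_left)
    fix b assume "b \<in> {..<n}"
    then have b: "b < n" by simp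
    have sub: "{0..t} \<subseteq> D" using D_interval[OF t] by auto
    have "((\<lambda>s. la / lam b s * exp (la * eta b s)) has_integral (exp (la * eta b t) - exp (la * eta b 0))) {0..t}"
    proof (rule has_integral_exp_primitive[where K = "la / c0"])
      show "0 \<le> t" by (rule D_nonneg[OF t])
      show "(\<lambda>s. la / lam b s) \<in> borel_measurable (lebesgue_on {0..t})"
        using borel_measurable_times[OF borel_measurable_const inv_meas_subset[OF b sub], of la] by simp
      show "\<bar>la / lam b r\<bar> \<le> la / c0" if "r \<in> {0..t}" for r
        using mult_left_mono[OF inv_bound[OF b, of r], of la] that sub la by (auto simp: abs_mult)
      show "la * eta b s = la * eta b 0 + integral {0..s} (\<lambda>s. la / lam b s)" if "s \<in> {0..t}" for s
      proof -
        have "eta b s = eta b 0 + integral {0..s} (\<lambda>r. 1 / lam b r)"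
          using eta_combine[OF b zero_in_D, of s] that sub by auto
        moreover have "integral {0..s} (\<lambda>s. la / lam b s) = la * integral {0..s} (\<lambda>r. 1 / lam b r)"
          by (simp flip: integral_mult_right)
        ultimately show ?thesis by (simp add: distrib_left)
      qed
    qed
    from has_integral_linear[OF this bounded_linear_of_real]
    show "((\<lambda>s. complex_of_real (la / lam b s * exp (la * eta b s))) has_integral
        complex_of_real (exp (la * eta b t) - exp (la * eta b 0))) {0..t}" by (simp only: o_def)
  qed simp
  moreover have "(\<Sum>b<n. q (a b) i b * (complex_of_real (exp (la * eta b t) - exp (la * eta b 0)) * x b)) = prof la t i - prof la 0 i"
    unfolding prof_def sum_subtractf[symmetric] by (intro sum.cong) (auto simp: algebra_simps)
  ultimately show ?thesis by (simp add: dprof_def)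
qed

lemma vnorm_prof_le:
  assumes s: "s \<in> D" and la: "la > 0"
  shows "vnorm n (prof la s) \<le> frozen * amplitude * weight la s"
proof (rule vnorm_le)
  fix i assume i: "i < n"
  have "cmod (prof la s i) \<le> (\<Sum>b<n. frozen * (amplitude * bump la b s))"
    unfolding prof_def
  proof (rule sum_norm_le)
    fix b assume "b \<in> {..<n}"
    then show "cmod (q (a b) i b * (complex_of_real (exp (la * eta b s)) * x b)) \<le> frozen * (amplitude * bump la b s)"
      using cmod_frozen_le[OF i] cmod_exp_le_bump(1)[OF _ s la] frozen_nonneg
      by (subst norm_mult) (intro mult_mono, auto)
  qed
  also have "\<dots> = frozen * amplitude * weight la s" by (simp add: weight_def sum_distrib_left mult.assoc)
  finally show "cmod (prof la s i) \<le> frozen * amplitude * weight la s" .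
qed (intro mult_nonneg_nonneg frozen_nonneg amplitude_nonneg weight_nonneg)

lemma vnorm_dprof_le:
  assumes s: "s \<in> D" and la: "la > 0"
  shows "vnorm n (dprof la s) \<le> la / c0 * (frozen * amplitude) * weight la s"
proof (rule vnorm_le)
  fix i assume i: "i < n"
  have "cmod (dprof la s i) \<le> (\<Sum>b<n. frozen * (la / c0 * (amplitude * bump la b s)))"
    unfolding dprof_def
  proof (rule sum_norm_le)
    fix b assume "b \<in> {..<n}"
    then have b: "b < n" by simp
    have "\<bar>la / lam b s\<bar> \<le> la / c0"
      using mult_left_mono[OF inv_bound[OF b s], of la] la by (simp add: abs_mult)
    then have *: "\<bar>la / lam b s\<bar> * cmod (complex_of_real (exp (la * eta b s)) * x b) \<le> la / c0 * (amplitude * bump la b s)"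
      using cmod_exp_le_bump(1)[OF b s la] la c0 by (intro mult_mono) auto
    have "cmod (complex_of_real (la / lam b s * exp (la * eta b s)) * x b)
        = \<bar>la / lam b s\<bar> * cmod (complex_of_real (exp (la * eta b s)) * x b)"
      by (simp only: of_real_mult mult.assoc norm_mult norm_of_real)
    with * have "cmod (complex_of_real (la / lam b s * exp (la * eta b s)) * x b) \<le> la / c0 * (amplitude * bump la b s)"
      by simp
    then show "cmod (q (a b) i b * (complex_of_real (la / lam b s * exp (la * eta b s)) * x b)) \<le> frozen * (la / c0 * (amplitude * bump la b s))"
      unfolding norm_mult[of "q (a b) i b"] using cmod_frozen_le[OF i b] frozen_nonneg by (intro mult_mono) auto
  qed
  also have "\<dots> = la / c0 * (frozen * amplitude) * weight la s" by (simp add: weight_def sum_distrib_left sum_divide_distrib mult_ac)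
  finally show "cmod (dprof la s i) \<le> la / c0 * (frozen * amplitude) * weight la s" .
qed (use la c0 in \<open>intro mult_nonneg_nonneg frozen_nonneg amplitude_nonneg weight_nonneg, auto\<close>)

text \<open>The Lipschitz condition turns the error of freezing into \<open>K * |s - a b|\<close>,
  and against the exponential a factor \<open>|s - a b|\<close> is worth
  \<open>2 * c1 / la\<close>.\<close>

lemma vnorm_prof_diff_le:
  assumes s: "s \<in> D" and la: "la > 0"
  shows "vnorm n (\<lambda>i. prof la s i - mv n (q s) (flat la s) i) \<le> 2 * c1 * K * amplitude / la * weight la s"
proof (rule vnorm_le)
  fix i assume i: "i < n"
  have "prof la s i - mv n (q s) (flat la s) i = (\<Sum>b<n. (q (a b) i b - q s i b) * (complex_of_real (exp (la * eta b s)) * x b))"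
    using i by (simp add: prof_def mv_def flat_def sum_subtractf left_diff_distrib)
  also have "cmod \<dots> \<le> (\<Sum>b<n. K / la * (2 * c1 * amplitude * bump la b s))"
  proof (rule sum_norm_le)
    fix b assume "b \<in> {..<n}"
    then have b: "b < n" by simp
    have "cmod (q (a b) i b - q s i b) \<le> K * \<bar>s - a b\<bar>" using lip[OF anchor_in_D[OF b] s i b] by (simp add: abs_minus_commute)
    then have "cmod ((q (a b) i b - q s i b) * (complex_of_real (exp (la * eta b s)) * x b))
       \<le> K * \<bar>s - a b\<bar> * cmod (complex_of_real (exp (la * eta b s)) * x b)"
      unfolding norm_mult[of "q (a b) i b - q s i b"] by (intro mult_right_mono) auto
    also have "\<dots> = K / la * (la * \<bar>s - a b\<bar> * cmod (complex_of_real (exp (la * eta b s)) * x b))" using la by simp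
    also have "\<dots> \<le> K / la * (2 * c1 * amplitude * bump la b s)"
      using cmod_exp_le_bump(2)[OF b s la] K la by (intro mult_left_mono) auto
    finally show "cmod ((q (a b) i b - q s i b) * (complex_of_real (exp (la * eta b s)) * x b)) \<le> K / la * (2 * c1 * amplitude * bump la b s)" .
  qed
  also have "\<dots> = 2 * c1 * K * amplitude / la * weight la s"
    by (simp add: weight_def sum_distrib_left sum_divide_distrib mult_ac)
  finally show "cmod (prof la s i - mv n (q s) (flat la s) i) \<le> 2 * c1 * K * amplitude / la * weight la s" .
qed (use la c1 K in \<open>intro mult_nonneg_nonneg divide_nonneg_nonneg amplitude_nonneg weight_nonneg, auto\<close>)

lemma weight_le: "la > 0 \<Longrightarrow> weight la s \<le> n"
proof -
  assume la: "la > 0"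
  have "bump la b s \<le> 1" for b using la c1 by (simp add: bump_def)
  then have "weight la s \<le> (\<Sum>b<n. 1)" unfolding weight_def by (intro sum_mono)
  then show ?thesis by simp
qed

text \<open>The p-th power of \<open>bump\<close> is an exponential of rate
  \<open>mu = la * p / (2 * c1)\<close>, with integral at most \<open>1 / mu\<close>; the powers of
  \<open>n\<close> come from splitting the sum in \<open>weight\<close>.\<close>

lemma Lint_le_of_weight:
  assumes p: "1 \<le> p" and la: "la > 0" and A: "A \<ge> 0"
    and le: "AE r in lebesgue_on D. vnorm n (v r) \<le> A * weight la r"
  shows "Lint (lebesgue_on D) n p v \<le> ennreal (A powr p * (real n powr p * real n * (2 * c1 / p)) / la)"
proof -
  define mu where "mu = la * p / (2 * c1)"
  have mu: "mu > 0" using la p c1 by (simp add: mu_def)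
  have bp: "bump la b r powr p = exp (- mu * \<bar>r - a b\<bar>)" for b r
    by (simp add: bump_def mu_def exp_powr_real)
  have "Lint (lebesgue_on D) n p v \<le> (\<integral>\<^sup>+ r. (\<Sum>b<n. ennreal (A powr p * real n powr p) * ennreal (exp (- mu * \<bar>r - a b\<bar>))) \<partial>(lebesgue_on D))"
    unfolding Lint_def
  proof (rule nn_integral_mono_AE, use le in eventually_elim)
    case (elim r)
    have "vnorm n (v r) powr p \<le> (A * weight la r) powr p" using elim p by (intro powr_mono2) auto
    also have "\<dots> = A powr p * weight la r powr p" using A weight_nonneg by (simp add: powr_mult)
    also have "\<dots> \<le> A powr p * (real n powr p * (\<Sum>b<n. bump la b r powr p))"
      unfolding weight_def using p by (intro mult_left_mono sum_powr_le less_imp_le[OF bump_pos]) auto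
    finally have "vnorm n (v r) powr p \<le> (\<Sum>b<n. A powr p * real n powr p * exp (- mu * \<bar>r - a b\<bar>))"
      by (simp add: bp sum_distrib_left mult_ac)
    then show ?case by (simp add: ennreal_mult[symmetric] sum_nonneg ennreal_leI)
  qed
  also have "\<dots> = (\<Sum>b<n. ennreal (A powr p * real n powr p) * (\<integral>\<^sup>+ r. ennreal (exp (- mu * \<bar>r - a b\<bar>)) \<partial>(lebesgue_on D)))"
  proof -
    have m: "(\<lambda>r. ennreal (exp (- mu * \<bar>r - a b\<bar>))) \<in> borel_measurable (lebesgue_on D)" for b
      by (intro measurable_compose[OF _ measurable_ennreal] continuous_imp_measurable_on_sets_lebesgue continuous_intros) auto
    show ?thesis using m by (simp add: nn_integral_sum nn_integral_cmult)
  qed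
  also have "\<dots> \<le> (\<Sum>b<n. ennreal (A powr p * real n powr p) * ennreal (1 / mu))"
  proof (intro sum_mono mult_left_mono nn_integral_exp_decay mu)
    fix b assume "b \<in> {..<n}"
    then show "D = {0..} \<and> a b = 0 \<or> D = {0..1} \<and> (a b = 0 \<or> a b = 1)" using anchor[of b] D by auto
  qed simp
  also have "\<dots> = (\<Sum>b<n. ennreal (A powr p * real n powr p * (1 / mu)))"
    using mu by (simp add: ennreal_mult[symmetric])
  also have "\<dots> = ennreal (\<Sum>b<n. A powr p * real n powr p * (1 / mu))"
    using mu by (intro sum_ennreal) auto
  also have "(\<Sum>b<n. A powr p * real n powr p * (1 / mu)) = A powr p * (real n powr p * real n * (2 * c1 / p)) / la"
    by (simp add: mu_def mult_ac)
  finally show ?thesis .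
qed

end

context boundary_layer
begin

lemma vnorm_defect_le:
  assumes la: "la > 0"
  shows "AE s in lebesgue_on D. vnorm n (\<lambda>i. mv n (cmatr n lam q qinv s) (dprof la s) i - complex_of_real la * prof la s i)
    \<le> K * (1 + real n * real n * M * M * c1 / c0) * (2 * c1 * amplitude) * weight la s"
  (is "AE s in _. _ \<le> ?A * _ * _")
proof -
  have A: "?A \<ge> 0" using K M c0 c1 by auto
  have "AE s in lebesgue_on D. s \<in> D" by (auto intro!: AE_I2)
  with q_bound show ?thesis
  proof eventually_elim
    case (elim s)
    then have s: "s \<in> D" by simp
    have qb: "cmod (q s i k) \<le> M" "cmod (qinv s i k) \<le> M" if "i < n" "k < n" for i k using elim that by auto
    define e where "e = (\<lambda>b. complex_of_real (exp (la * eta b s)) * x b)"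
    define R where "R = (\<lambda>k b. \<Sum>j<n. qinv s k j * q (a b) j b)"
    have Rdiff: "cmod (R k b - (if k = b then 1 else 0)) \<le> real n * M * K * \<bar>s - a b\<bar>" if "k < n" "b < n" for k b
    proof -
      have "R k b - (if k = b then 1 else 0) = (\<Sum>j<n. qinv s k j * (q (a b) j b - q s j b))"
        using linv[OF s that] by (simp add: R_def right_diff_distrib sum_subtractf)
      also have "cmod \<dots> \<le> (\<Sum>j<n. M * (K * \<bar>s - a b\<bar>))"
      proof (rule sum_norm_le)
        fix j assume "j \<in> {..<n}"
        then show "cmod (qinv s k j * (q (a b) j b - q s j b)) \<le> M * (K * \<bar>s - a b\<bar>)"
          unfolding norm_mult using qb(2)[of k j] that lip[OF anchor_in_D s, of b j b] M
          by (intro mult_mono) (auto simp: abs_minus_commute)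
      qed
      finally show ?thesis by (simp add: mult.assoc)
    qed
    show ?case
    proof (rule vnorm_le)
      fix i assume i: "i < n"
      define Z where "Z = (\<lambda>b. (\<Sum>k<n. q s i k * complex_of_real (lam k s) * (R k b - (if k = b then 1 else 0))) / complex_of_real (lam b s)
        + (q s i b - q (a b) i b))"
      have "mv n (cmatr n lam q qinv s) (dprof la s) i
          = (\<Sum>j<n. \<Sum>b<n. (\<Sum>k<n. q s i k * complex_of_real (lam k s) * qinv s k j) * (q (a b) j b * (complex_of_real (la / lam b s) * e b)))"
        using i by (simp add: mv_def cmatr_def dprof_def e_def sum_distrib_left mult.assoc)
      also have "\<dots> = (\<Sum>b<n. \<Sum>j<n. (\<Sum>k<n. q s i k * complex_of_real (lam k s) * qinv s k j) * (q (a b) j b * (complex_of_real (la / lam b s) * e b)))"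
        by (rule sum.swap)
      also have "\<dots> = (\<Sum>b<n. (\<Sum>k<n. q s i k * complex_of_real (lam k s) * R k b) * (complex_of_real (la / lam b s) * e b))"
      proof (intro sum.cong refl)
        fix b
        have "(\<Sum>j<n. (\<Sum>k<n. q s i k * complex_of_real (lam k s) * qinv s k j) * (q (a b) j b * (complex_of_real (la / lam b s) * e b)))
           = (\<Sum>j<n. \<Sum>k<n. q s i k * complex_of_real (lam k s) * qinv s k j * q (a b) j b) * (complex_of_real (la / lam b s) * e b)"
          by (simp only: sum_distrib_right mult.assoc)
        also have "(\<Sum>j<n. \<Sum>k<n. q s i k * complex_of_real (lam k s) * qinv s k j * q (a b) j b)
           = (\<Sum>k<n. q s i k * complex_of_real (lam k s) * R k b)"
          by (subst sum.swap) (simp add: R_def sum_distrib_left mult.assoc)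
        finally show "(\<Sum>j<n. (\<Sum>k<n. q s i k * complex_of_real (lam k s) * qinv s k j) * (q (a b) j b * (complex_of_real (la / lam b s) * e b)))
           = (\<Sum>k<n. q s i k * complex_of_real (lam k s) * R k b) * (complex_of_real (la / lam b s) * e b)" .
      qed
      also have "\<dots> = (\<Sum>b<n. complex_of_real la * (Z b * e b) + complex_of_real la * (q (a b) i b * e b))"
      proof (intro sum.cong refl)
        fix b assume "b \<in> {..<n}"
        then have b: "b < n" by simp
        have l0: "complex_of_real (lam b s) \<noteq> 0" using lam_bound[OF b s] c0 by auto
        have "(\<Sum>k<n. q s i k * complex_of_real (lam k s) * (if k = b then 1 else 0)) = (\<Sum>k<n. if k = b then q s i k * complex_of_real (lam k s) else 0)"
          by (intro sum.cong) auto
        also have "\<dots> = q s i b * complex_of_real (lam b s)" using b by simp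
        finally have "(\<Sum>k<n. q s i k * complex_of_real (lam k s) * (R k b - (if k = b then 1 else 0)))
          = (\<Sum>k<n. q s i k * complex_of_real (lam k s) * R k b) - q s i b * complex_of_real (lam b s)"
          by (simp only: right_diff_distrib sum_subtractf)
        then have "(\<Sum>k<n. q s i k * complex_of_real (lam k s) * R k b) / complex_of_real (lam b s) = Z b + q (a b) i b"
          using l0 by (simp add: Z_def diff_divide_distrib)
        moreover have "(\<Sum>k<n. q s i k * complex_of_real (lam k s) * R k b) * (complex_of_real (la / lam b s) * e b)
          = complex_of_real la * (((\<Sum>k<n. q s i k * complex_of_real (lam k s) * R k b) / complex_of_real (lam b s)) * e b)"
          by simp
        ultimately show "(\<Sum>k<n. q s i k * complex_of_real (lam k s) * R k b) * (complex_of_real (la / lam b s) * e b)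
          = complex_of_real la * (Z b * e b) + complex_of_real la * (q (a b) i b * e b)"
          by (simp only: distrib_right distrib_left)
      qed
      also have "\<dots> = (\<Sum>b<n. complex_of_real la * (Z b * e b)) + complex_of_real la * prof la s i"
        by (simp add: sum.distrib prof_def e_def sum_distrib_left)
      finally have "mv n (cmatr n lam q qinv s) (dprof la s) i - complex_of_real la * prof la s i = (\<Sum>b<n. complex_of_real la * (Z b * e b))"
        by simp
      also have "cmod \<dots> \<le> (\<Sum>b<n. ?A * (2 * c1 * amplitude * bump la b s))"
      proof (rule sum_norm_le)
        fix b assume "b \<in> {..<n}"
        then have b: "b < n" by simp
        have "cmod (\<Sum>k<n. q s i k * complex_of_real (lam k s) * (R k b - (if k = b then 1 else 0)))
            \<le> (\<Sum>k<n. M * c1 * (real n * M * K * \<bar>s - a b\<bar>))"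
        proof (rule sum_norm_le)
          fix k assume "k \<in> {..<n}"
          then have k: "k < n" by simp
          have "cmod (q s i k * complex_of_real (lam k s)) \<le> M * c1"
            unfolding norm_mult using qb(1)[OF i k] lam_bound[OF k s] M by (intro mult_mono) auto
          then show "cmod (q s i k * complex_of_real (lam k s) * (R k b - (if k = b then 1 else 0))) \<le> M * c1 * (real n * M * K * \<bar>s - a b\<bar>)"
            unfolding norm_mult[of "q s i k * complex_of_real (lam k s)"] using Rdiff[OF k b] M c1 by (intro mult_mono) auto
        qed
        then have "cmod ((\<Sum>k<n. q s i k * complex_of_real (lam k s) * (R k b - (if k = b then 1 else 0))) / complex_of_real (lam b s))
            \<le> (\<Sum>k<n. M * c1 * (real n * M * K * \<bar>s - a b\<bar>)) / c0"
          unfolding norm_divide using lam_bound[OF b s] c0 K M c1 by (intro frac_le) (auto intro!: sum_nonneg)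
        also have "\<dots> = real n * real n * M * M * c1 / c0 * (K * \<bar>s - a b\<bar>)" by (simp add: mult_ac)
        finally have "cmod (Z b) \<le> real n * real n * M * M * c1 / c0 * (K * \<bar>s - a b\<bar>) + K * \<bar>s - a b\<bar>"
          unfolding Z_def using lip[OF s anchor_in_D[OF b] i b] by (intro norm_triangle_le add_mono) auto
        also have "\<dots> = ?A * \<bar>s - a b\<bar>" by (simp add: algebra_simps)
        finally have "cmod (complex_of_real la * (Z b * e b)) \<le> la * (?A * \<bar>s - a b\<bar> * cmod (e b))"
          using la by (simp add: norm_mult mult_left_mono mult_right_mono)
        also have "\<dots> = ?A * (la * \<bar>s - a b\<bar> * cmod (e b))" by (simp only: mult_ac)
        also have "\<dots> \<le> ?A * (2 * c1 * amplitude * bump la b s)"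
          using cmod_exp_le_bump(2)[OF b s la] A unfolding e_def by (intro mult_left_mono)
        finally show "cmod (complex_of_real la * (Z b * e b)) \<le> ?A * (2 * c1 * amplitude * bump la b s)" .
      qed
      also have "\<dots> = ?A * (2 * c1 * amplitude) * weight la s"
        by (simp only: weight_def sum_distrib_left mult.assoc)
      finally show "cmod (mv n (cmatr n lam q qinv s) (dprof la s) i - complex_of_real la * prof la s i) \<le> ?A * (2 * c1 * amplitude) * weight la s" .
    qed (use A c1 amplitude_nonneg weight_nonneg in simp)
  qed
qed

lemma mv_flat_continuous:
  assumes i: "i < n"
  shows "continuous_on D (\<lambda>s. mv n (q s) (flat la s) i)"
proof -
  have "continuous_on D (\<lambda>s. q s i k)" if "k < n" for k
    by (rule lipschitz_on_continuous_on[of K]) (use lip i that K in \<open>auto simp: lipschitz_on_def dist_norm\<close>)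
  then have "continuous_on D (\<lambda>s. \<Sum>b<n. q s i b * (complex_of_real (exp (la * eta b s)) * x b))"
    by (intro continuous_intros eta_continuous) auto
  then show ?thesis using i by (simp add: mv_def flat_def)
qed

lemma weight_tendsto:
  assumes D0: "D = {0..}" and la: "la > 0"
  shows "(weight la \<longlongrightarrow> 0) at_top"
proof -
  have "((\<lambda>s. bump la b s) \<longlongrightarrow> 0) at_top" if "b < n" for b
  proof -
    have a0: "a b = 0" using anchor[OF that] D0 by auto
    have "filterlim (\<lambda>s::real. (la / (2 * c1)) * s) at_top at_top"
      using la c1 by (intro filterlim_tendsto_pos_mult_at_top[OF tendsto_const] filterlim_ident) auto
    then have "filterlim (\<lambda>s::real. - ((la / (2 * c1)) * s)) at_bot at_top"
      by (simp add: filterlim_uminus_at_top)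
    then have "((\<lambda>s. exp (- ((la / (2 * c1)) * s))) \<longlongrightarrow> 0) at_top"
      using filterlim_compose[OF exp_at_bot] by blast
    then show ?thesis
      by (rule Lim_transform_eventually)
        (use eventually_ge_at_top[of 0] in \<open>eventually_elim, simp add: bump_def a0\<close>)
  qed
  then have "((\<lambda>s. \<Sum>b<n. bump la b s) \<longlongrightarrow> (\<Sum>b<n. 0)) at_top" by (intro tendsto_sum) auto
  then show ?thesis by (simp add: weight_def[abs_def])
qed

lemma mv_flat_tendsto:
  assumes i: "i < n" and D0: "D = {0..}" and la: "la > 0"
  shows "((\<lambda>s. mv n (q s) (flat la s) i) \<longlongrightarrow> 0) at_top"
proof (rule Lim_null_comparison)
  let ?C = "frozen * amplitude + 2 * c1 * K * amplitude / la"
  have "((\<lambda>s. ?C * weight la s) \<longlongrightarrow> ?C * 0) at_top" by (intro tendsto_intros weight_tendsto D0 la)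
  then show "((\<lambda>s. ?C * weight la s) \<longlongrightarrow> 0) at_top" by simp
  show "eventually (\<lambda>s. norm (mv n (q s) (flat la s) i) \<le> ?C * weight la s) at_top"
    using eventually_ge_at_top[of 0]
  proof eventually_elim
    case (elim s)
    then have s: "s \<in> D" using D0 by simp
    have "cmod (mv n (q s) (flat la s) i) \<le> cmod (prof la s i) + cmod (prof la s i - mv n (q s) (flat la s) i)"
      by (metis norm_minus_commute norm_triangle_sub)
    also have "\<dots> \<le> frozen * amplitude * weight la s + 2 * c1 * K * amplitude / la * weight la s"
      using order_trans[OF cmod_le_vnorm[OF i] vnorm_prof_le[OF s la]]
        order_trans[OF cmod_le_vnorm[OF i] vnorm_prof_diff_le[OF s la]] by (intro add_mono) auto
    finally show ?case by (simp add: distrib_right)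
  qed
qed

lemma cmod_flat_le:
  assumes s: "s \<in> D" and qb: "\<And>i k. i < n \<Longrightarrow> k < n \<Longrightarrow> cmod (qinv s i k) \<le> M" and b: "b < n"
  shows "cmod (flat la s b) \<le> real n * M * vnorm n (mv n (q s) (flat la s))"
proof -
  have "(\<Sum>k<n. qinv s b k * mv n (q s) (flat la s) k) = (\<Sum>k<n. \<Sum>j<n. qinv s b k * q s k j * flat la s j)"
    by (simp add: mv_def sum_distrib_left mult.assoc)
  also have "\<dots> = (\<Sum>j<n. (\<Sum>k<n. qinv s b k * q s k j) * flat la s j)"
    by (subst sum.swap) (simp add: sum_distrib_right)
  also have "\<dots> = (\<Sum>j<n. if j = b then flat la s j else 0)"
    using linv[OF s b] by (intro sum.cong) auto
  also have "\<dots> = flat la s b" using b by simp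
  finally have "cmod (flat la s b) = cmod (\<Sum>k<n. qinv s b k * mv n (q s) (flat la s) k)" by simp
  also have "\<dots> \<le> (\<Sum>k<n. M * vnorm n (mv n (q s) (flat la s)))"
  proof (rule sum_norm_le)
    fix k assume "k \<in> {..<n}"
    then show "cmod (qinv s b k * mv n (q s) (flat la s) k) \<le> M * vnorm n (mv n (q s) (flat la s))"
      unfolding norm_mult using qb b M by (intro mult_mono cmod_le_vnorm) auto
  qed
  finally show ?thesis by (simp add: mult.assoc)
qed

text \<open>On an interval of length \<open>1 / la\<close> at the anchor the exponent
  \<open>la * eta b s\<close> is at least \<open>- 1 / c0\<close>, so the \<open>b\<close>-th
  coordinate of \<open>flat\<close> stays away from 0. The bound on \<open>qinv\<close> carries this
  over to \<open>q s\<close> times \<open>flat\<close>, and freezing costs only O(1 / la).\<close>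

lemma Lint_prof_ge:
  assumes p: "1 \<le> p" and b: "b < n" "x b \<noteq> 0"
  shows "\<exists>c>0. \<exists>la0\<ge>1. \<forall>la\<ge>la0. ennreal (c / la) \<le> Lint (lebesgue_on D) n p (prof la)"
proof -
  \<comment> \<open>The lower bound for \<open>q s\<close> times \<open>flat\<close>, from
    \<open>cmod_flat_le\<close>; \<open>M + 1\<close> replaces \<open>M\<close> to avoid division by
    0.\<close>
  define d where "d = exp (- 1 / c0) * cmod (x b) / (real n * (M + 1))"
  have d: "d > 0" using b M by (auto simp: d_def)
  define C where "C = 2 * c1 * K * amplitude * real n"
  have C: "C \<ge> 0" using c1 K amplitude_nonneg by (simp add: C_def)
  \<comment> \<open>From here on the error \<open>C / la\<close> of freezing is at most half of
    \<open>d\<close>.\<close>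
  define la0 where "la0 = max 1 (2 * C / d)"
  have "ennreal ((d / 2) powr p / la) \<le> Lint (lebesgue_on D) n p (prof la)" if la: "la \<ge> la0" for la
  proof -
    have la1: "la \<ge> 1" "la > 0" and laC: "2 * C / d \<le> la" using la by (auto simp: la0_def)
    have Cla: "C / la \<le> d / 2" using laC d la1 by (simp add: field_simps)
    define I where "I = (if a b = 0 then {0..1 / la} else {1 - 1 / la..1})"
    have I: "I \<subseteq> D" "emeasure (lebesgue_on D) I = ennreal (1 / la)" "I \<in> sets (lebesgue_on D)"
      "\<And>s. s \<in> I \<Longrightarrow> \<bar>s - a b\<bar> \<le> 1 / la"
    proof -
      have l: "1 / la \<le> 1" "1 / la > 0" using la1 by auto
      have "r \<in> D" if "r \<in> I" for r
      proof (cases "a b = 0")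
        case True
        then have "0 \<le> r \<and> r \<le> 1 / la" using that by (simp add: I_def)
        then have "0 \<le> r \<and> r \<le> 1" using l(1) by linarith
        then show ?thesis using D by auto
      next
        case False
        then have "D = {0..1}" using anchor[OF b(1)] by simp
        moreover have "1 - 1 / la \<le> r \<and> r \<le> 1" using that False by (simp add: I_def)
        moreover from this have "0 \<le> r" using l(1) by linarith
        ultimately show ?thesis by simp
      qed
      then show sub: "I \<subseteq> D" by blast
      have IS: "I \<in> sets lebesgue" by (simp add: I_def)
      show "emeasure (lebesgue_on D) I = ennreal (1 / la)"
        using sub l by (simp add: emeasure_restrict_space) (simp add: I_def)
      show "I \<in> sets (lebesgue_on D)" using sub IS by (simp add: sets_restrict_space_iff)
      show "\<bar>s - a b\<bar> \<le> 1 / la" if "s \<in> I" for s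
        using that anchor[OF b(1)] by (auto simp: I_def split: if_splits)
    qed
    have "ennreal ((d / 2) powr p / la) = ennreal ((d / 2) powr p) * emeasure (lebesgue_on D) I"
      using I(2) la1 by (simp flip: ennreal_mult)
    also have "\<dots> = (\<integral>\<^sup>+ s. ennreal ((d / 2) powr p) * indicator I s \<partial>(lebesgue_on D))"
      using I(3) by (simp add: nn_integral_cmult_indicator)
    also have "\<dots> \<le> Lint (lebesgue_on D) n p (prof la)"
      unfolding Lint_def
    proof (rule nn_integral_mono_AE, use q_bound in eventually_elim)
      case (elim s)
      show ?case
      proof (cases "s \<in> I")
        case False then show ?thesis by simp
      next
        case True
        have s: "s \<in> D" using True I by auto
        have "la * \<bar>s - a b\<bar> \<le> 1" using I(4)[OF True] la1 by (simp add: field_simps)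
        then have "la * \<bar>s - a b\<bar> / c0 \<le> 1 / c0" using c0 by (intro divide_right_mono) auto
        moreover have "la * (- \<bar>s - a b\<bar> / c0) \<le> la * eta b s"
          using eta_bounds(2)[OF b s] la1 by (intro mult_left_mono) auto
        ultimately have "- 1 / c0 \<le> la * eta b s" by simp
        then have "exp (- 1 / c0) * cmod (x b) \<le> cmod (flat la s b)"
          by (simp add: flat_def norm_mult mult_right_mono)
        also have "\<dots> \<le> real n * M * vnorm n (mv n (q s) (flat la s))"
          using elim b s by (intro cmod_flat_le) auto
        also have "\<dots> \<le> real n * (M + 1) * vnorm n (mv n (q s) (flat la s))"
          using M by (intro mult_right_mono mult_left_mono) auto
        finally have 0: "exp (- 1 / c0) * cmod (x b) \<le> real n * (M + 1) * vnorm n (mv n (q s) (flat la s))" .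
        have 1: "d \<le> vnorm n (mv n (q s) (flat la s))"
        proof -
          have pos: "real n * (M + 1) > 0" using b M by auto
          show ?thesis using 0
            unfolding d_def pos_divide_le_eq[OF pos] by (simp only: mult_ac)
        qed
        have "vnorm n (mv n (q s) (flat la s)) \<le> vnorm n (prof la s) + vnorm n (\<lambda>i. prof la s i - mv n (q s) (flat la s) i)"
        proof -
          have "mv n (q s) (flat la s) = prof la s + (-1) *\<^sub>R (\<lambda>i. prof la s i - mv n (q s) (flat la s) i)"
            by (simp add: fun_eq_iff)
          then show ?thesis
            using vnorm_triangle[of n "prof la s" "(-1) *\<^sub>R (\<lambda>i. prof la s i - mv n (q s) (flat la s) i)"]
            by (simp only: vnorm_scaleR)
        qed
        also have "vnorm n (\<lambda>i. prof la s i - mv n (q s) (flat la s) i) \<le> 2 * c1 * K * amplitude / la * weight la s"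
          by (rule vnorm_prof_diff_le[OF s la1(2)])
        also have "\<dots> \<le> 2 * c1 * K * amplitude / la * real n"
          using weight_le[OF la1(2)] c1 K amplitude_nonneg la1 by (intro mult_left_mono) auto
        also have "\<dots> = C / la" by (simp add: C_def)
        finally have "d / 2 \<le> vnorm n (prof la s)" using 1 Cla by linarith
        then have "(d / 2) powr p \<le> vnorm n (prof la s) powr p" using d p by (intro powr_mono2) auto
        then show ?thesis using True by (simp add: ennreal_leI)
      qed
    qed
    finally show ?thesis .
  qed
  moreover have "(d / 2) powr p > 0" using d by simp
  moreover have "la0 \<ge> 1" by (simp add: la0_def)
  ultimately show ?thesis by blast
qed

end

section \<open>The boundary space and operators into it\<close>

text \<open>These identities pass from the explicit operations on functions and vectors to the real
  vector space structure of their types, in which the abstract results are stated.\<close>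

lemma xadd_eq: "xadd f g = f + g"
  by (simp add: xadd_def prod_eq_iff fun_eq_iff)

lemma xscale_eq: "xscale (complex_of_real c) f = c *\<^sub>R f"
  by (simp add: xscale_def prod_eq_iff fun_eq_iff scaleR_conv_of_real)

lemma xdiff_eq: "xdiff f g = f - g"
  by (simp add: xdiff_def xadd_def xscale_def prod_eq_iff fun_eq_iff)

lemma badd_eq: "badd x y = x + y"
  by (simp add: badd_def prod_eq_iff fun_eq_iff)

lemma bscale_eq: "bscale (complex_of_real c) x = c *\<^sub>R x"
  by (simp add: bscale_def prod_eq_iff fun_eq_iff scaleR_conv_of_real)

lemma bzero_eq: "bzero = 0"
  by (simp add: bzero_def prod_eq_iff fun_eq_iff)

lemma subspace_dX: "subspace (dX l m lame)"
  unfolding subspace_def dX_def by auto (metis add.right_neutral add.left_neutral)+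

lemma sum_fun_apply: "(\<Sum>k\<in>A. f k) x = (\<Sum>k\<in>A. f k x)" for f :: "'a \<Rightarrow> 'b \<Rightarrow> 'c::comm_monoid_add"
  by (induction A rule: infinite_finite_induct) auto

text \<open>The span is over the reals, so each complex coordinate contributes the two vectors with
  entries 1 and i.\<close>

lemma dX_finite_spanning: "\<exists>S. finite S \<and> dX l m lame \<subseteq> span S"
proof (intro exI conjI)
  define e :: "nat \<Rightarrow> complex \<Rightarrow> cvec" where "e = (\<lambda>k c i. if i = k then c else 0)"
  let ?E = "(\<lambda>(k, c). (e k c, 0)) ` ({..<l} \<times> {1, \<i>}) :: (cvec \<times> cvec) set"
  let ?I = "(\<lambda>(k, c). (0, e k c)) ` ({..<m} \<times> {1, \<i>}) :: (cvec \<times> cvec) set"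
  show "finite (?E \<union> ?I)" by (intro finite_UnI finite_imageI finite_cartesian_product) auto
  have dec: "(\<Sum>k<n. Re (v k) *\<^sub>R e k 1 + Im (v k) *\<^sub>R e k \<i>) = v" if "\<forall>k. v k \<noteq> 0 \<longrightarrow> k < n" for v n
  proof
    fix i
    have "(\<Sum>k<n. Re (v k) *\<^sub>R e k 1 + Im (v k) *\<^sub>R e k \<i>) i = (\<Sum>k<n. if i = k then v k else 0)"
      unfolding sum_fun_apply by (intro sum.cong) (auto simp: e_def complex_eq_iff)
    then show "(\<Sum>k<n. Re (v k) *\<^sub>R e k 1 + Im (v k) *\<^sub>R e k \<i>) i = v i" using that by auto
  qed
  show "dX l m lame \<subseteq> span (?E \<union> ?I)"
  proof
    fix x assume x: "x \<in> dX l m lame"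
    have "(\<Sum>k<l. Re (fst x k) *\<^sub>R (e k 1, 0) + Im (fst x k) *\<^sub>R (e k \<i>, 0))
        + (\<Sum>k<m. Re (snd x k) *\<^sub>R (0, e k 1) + Im (snd x k) *\<^sub>R (0, e k \<i>)) \<in> span (?E \<union> ?I)"
      by (intro span_add span_sum span_scale span_base) (force simp: image_iff)+
    also have "(\<Sum>k<l. Re (fst x k) *\<^sub>R (e k 1, 0) + Im (fst x k) *\<^sub>R (e k \<i>, 0))
        + (\<Sum>k<m. Re (snd x k) *\<^sub>R (0, e k 1) + Im (snd x k) *\<^sub>R (0, e k \<i>)) = x"
      using x dec[of "fst x" l] dec[of "snd x" m] by (auto simp: prod_eq_iff fst_sum snd_sum dX_def)
    finally show "x \<in> span (?E \<union> ?I)" .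
  qed
qed

text \<open>In finite dimension an injective linear map of \<open>X\<close> into itself is onto: the
  image of a basis is independent and has as many elements as the basis.\<close>

lemma kernel_of_not_bij:
  fixes X :: "'a::real_vector set"
  assumes X: "subspace X" and fin: "finite S" "X \<subseteq> span S"
    and V: "\<And>x. x \<in> X \<Longrightarrow> V x \<in> X" "\<And>x y. x \<in> X \<Longrightarrow> y \<in> X \<Longrightarrow> V (x + y) = V x + V y"
      "\<And>c x. x \<in> X \<Longrightarrow> V (c *\<^sub>R x) = c *\<^sub>R V x"
    and nb: "\<not> bij_betw V X X"
  shows "\<exists>x\<in>X. x \<noteq> 0 \<and> V x = 0"
proof (rule ccontr)
  assume contr: "\<not> ?thesis"
  have inj: "inj_on V X"
  proof (rule inj_onI)
    fix x y assume xy: "x \<in> X" "y \<in> X" "V x = V y"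
    have "x - y \<in> X" using xy X by (simp add: subspace_diff)
    moreover have "V (x - y) = 0"
      using V(2)[of x "(-1) *\<^sub>R y"] V(3)[of y "-1"] xy X by (simp add: subspace_scale subspace_neg)
    ultimately show "x = y" using contr by auto
  qed
  obtain B where B: "B \<subseteq> X" "independent B" "X \<subseteq> span B" by (rule maximal_independent_subset)
  have spanB: "span B = X" using B X by (simp add: span_subspace)
  have finB: "finite B" using independent_span_bound[OF fin(1) B(2)] B(1) fin(2) by blast
  \<comment> \<open>\<open>V\<close> is linear on \<open>X\<close> only; its extension from a basis
    is linear on the whole type and agrees with \<open>V\<close> on \<open>X\<close>.\<close>
  define W where "W = construct B V"
  have W: "linear W" unfolding W_def by (rule linear_construct[OF B(2)])
  have WV: "W x = V x" if "x \<in> X" for x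
  proof -
    have "x \<in> span B" using that spanB by simp
    then have "x \<in> X \<and> W x = V x"
    proof (induction rule: span_induct_alt)
      case base
      have "V 0 = 0" using V(3)[of 0 0] X by (simp add: subspace_0)
      then show ?case using X W by (simp add: subspace_0 linear_0)
    next
      case (step c b y)
      have "b \<in> X" using step B by blast
      moreover have "W b = V b" unfolding W_def using construct_basis[OF B(2)] step by blast
      ultimately show ?case using step X V W
        by (simp add: subspace_add subspace_scale linear_add linear_scale)
    qed
    then show ?thesis by blast
  qed
  have "inj_on W (span B)" unfolding spanB using inj inj_on_cong[of X W V] WV by blast
  then have ind: "independent (W ` B)" by (rule linear_independent_injective_image[OF W B(2)])
  have card: "card (W ` B) = card B"
    using \<open>inj_on W (span B)\<close> by (intro card_image) (meson inj_on_subset span_superset)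
  have "V ` X = X"
  proof
    show "V ` X \<subseteq> X" using V(1) by blast
    show "X \<subseteq> V ` X"
    proof
      fix y assume y: "y \<in> X"
      have "y \<in> span (W ` B)"
      proof (rule ccontr)
        assume ny: "y \<notin> span (W ` B)"
        then have "independent (insert y (W ` B))" using ind by (simp add: independent_insertI)
        moreover have "insert y (W ` B) \<subseteq> span B" using y V(1) WV B(1) spanB by auto
        ultimately have "card (insert y (W ` B)) \<le> card B" using independent_span_bound[OF finB] by blast
        moreover have "card (insert y (W ` B)) = Suc (card (W ` B))"
          using ny span_base[of y "W ` B"] finB by (intro card_insert_disjoint) auto
        ultimately show False using card by linarith
      qed
      then have "y \<in> W ` X" using linear_span_image[OF W, of B] spanB by simp
      then show "y \<in> V ` X" using WV by auto
    qed
  qed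
  then show False using nb inj by (simp add: bij_betw_def)
qed

lemma lin_dX_kernel:
  assumes V: "lin_dX l m lame V" and nb: "\<not> bij_betw V (dX l m lame) (dX l m lame)"
  shows "\<exists>x\<in>dX l m lame. x \<noteq> 0 \<and> V x = 0"
proof -
  obtain S where S: "finite S" "dX l m lame \<subseteq> span S" using dX_finite_spanning by blast
  show ?thesis
  proof (rule kernel_of_not_bij[OF subspace_dX S _ _ _ nb])
    show "V (c *\<^sub>R x) = c *\<^sub>R V x" if "x \<in> dX l m lame" for c x
      using V that unfolding lin_dX_def bscale_eq[symmetric] by blast
  qed (use V in \<open>auto simp: lin_dX_def badd_eq\<close>)
qed

lemma normdX_nonneg [simp]: "0 \<le> normdX l m x"
  by (simp add: normdX_def le_max_iff_disj)

lemma normdX_triangle: "normdX l m (x + y) \<le> normdX l m x + normdX l m y"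
  using vnorm_triangle[of l "fst x" "fst y"] vnorm_triangle[of m "snd x" "snd y"]
  by (auto simp: normdX_def)

lemma normdX_scaleR: "normdX l m (c *\<^sub>R x) = \<bar>c\<bar> * normdX l m x"
  by (simp add: normdX_def vnorm_scaleR max_mult_distrib_left)

lemma normdX_0 [simp]: "normdX l m 0 = 0"
  by (simp add: normdX_def)

lemma normdX_pos: assumes x: "x \<in> dX l m lame" "x \<noteq> 0" shows "normdX l m x > 0"
proof (rule ccontr)
  assume "\<not> ?thesis"
  then have "vnorm l (fst x) \<le> 0" "vnorm m (snd x) \<le> 0" by (auto simp: normdX_def)
  then have "fst x k = 0" if "k < l" for k
    using cmod_le_vnorm[OF that, of "fst x"] by (metis norm_le_zero_iff order_trans)
  moreover have "snd x k = 0" if "k < m" for k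
    using cmod_le_vnorm[OF that, of "snd x"] \<open>vnorm m (snd x) \<le> 0\<close> by (metis norm_le_zero_iff order_trans)
  ultimately have "fst x k = 0" "snd x k = 0" for k using x(1) unfolding dX_def by blast+
  then show False using x(2) by (simp add: prod_eq_iff fun_eq_iff)
qed

lemma blin_C_add: "blin_C l m lame A \<Longrightarrow> C0C l m f \<Longrightarrow> C0C l m g \<Longrightarrow> A (f + g) = A f + A g"
  unfolding blin_C_def xadd_eq badd_eq by blast

lemma blin_C_scaleR: "blin_C l m lame A \<Longrightarrow> C0C l m f \<Longrightarrow> A (c *\<^sub>R f) = c *\<^sub>R A f"
  unfolding blin_C_def xscale_eq[symmetric] bscale_eq[symmetric] by blast

lemma C0C_add: "C0C l m f \<Longrightarrow> C0C l m g \<Longrightarrow> C0C l m (f + g)"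
  unfolding C0C_def by (auto intro!: continuous_on_add tendsto_add_zero)

lemma C0C_scaleR: assumes "C0C l m f" shows "C0C l m (c *\<^sub>R f)"
proof -
  have "((\<lambda>r. c *\<^sub>R fst f r k) \<longlongrightarrow> 0) at_top" if "k < l" for k
    using assms that tendsto_scaleR[OF tendsto_const, of "\<lambda>r. fst f r k" 0 at_top c] by (simp add: C0C_def)
  then show ?thesis using assms unfolding C0C_def by (auto intro!: continuous_on_scaleR continuous_on_const)
qed

lemma C0C_diff: "C0C l m f \<Longrightarrow> C0C l m g \<Longrightarrow> C0C l m (f - g)"
  using C0C_add[of l m f "(-1) *\<^sub>R g"] C0C_scaleR[of l m g "-1"] by simp

lemma blin_C_diff: "blin_C l m lame A \<Longrightarrow> C0C l m f \<Longrightarrow> C0C l m g \<Longrightarrow> A (f - g) = A f - A g"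
  using blin_C_add[of l m lame A f "(-1) *\<^sub>R g"] blin_C_scaleR[of l m lame A g "-1"] C0C_scaleR[of l m g "-1"] by simp

text \<open>The value of \<open>SUP\<close> is informative only for bounded sets. Compactness of
  {0..1} bounds the internal part, and its nonnegative supremum lies below the maximum.\<close>

lemma supnorm_nonneg: assumes "C0C l m f" shows "0 \<le> supnorm l m f"
proof -
  have "compact ((\<lambda>s. vnorm m (snd f s)) ` {0..1})"
  proof (rule compact_continuous_image)
    have "continuous_on {0..1} (\<lambda>s. vnorm n (snd f s))" if "n \<le> m" for n
      using that
    proof (induction n)
      case (Suc n)
      then show ?case using assms unfolding vnorm_Suc C0C_def
        by (intro continuous_on_max continuous_on_norm) auto
    qed simp
    then show "continuous_on {0..1} (\<lambda>s. vnorm m (snd f s))" by simp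
  qed simp
  then have "bdd_above ((\<lambda>s. vnorm m (snd f s)) ` {0..1})" by (intro bounded_imp_bdd_above compact_imp_bounded)
  then have "vnorm m (snd f 0) \<le> (SUP s\<in>{0..1}. vnorm m (snd f s))" by (intro cSUP_upper) auto
  then show ?thesis unfolding supnorm_def using vnorm_nonneg[of m "snd f 0"] by linarith
qed

lemma blin_C_bound:
  assumes "blin_C l m lame A"
  shows "\<exists>M\<ge>0. \<forall>f. C0C l m f \<longrightarrow> normdX l m (A f) \<le> M * supnorm l m f"
proof -
  obtain M where M: "\<And>f. C0C l m f \<Longrightarrow> normdX l m (A f) \<le> M * supnorm l m f"
    using assms unfolding blin_C_def by blast
  have "normdX l m (A f) \<le> \<bar>M\<bar> * supnorm l m f" if "C0C l m f" for f
    using M[OF that] mult_right_mono[OF abs_ge_self supnorm_nonneg[OF that], of M] by linarith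
  then show ?thesis by (intro exI[of _ "\<bar>M\<bar>"]) auto
qed

lemma blin_X_bound:
  assumes "blin_X l m p lame A"
  shows "\<exists>M\<ge>0. \<forall>f. inX l m p f \<longrightarrow> normdX l m (A f) \<le> M * normX l m p f"
proof -
  obtain M where M: "\<And>f. inX l m p f \<Longrightarrow> normdX l m (A f) \<le> M * normX l m p f"
    using assms unfolding blin_X_def by blast
  have "normdX l m (A f) \<le> \<bar>M\<bar> * normX l m p f" if "inX l m p f" for f
    using M[OF that] mult_right_mono[OF abs_ge_self normX_nonneg, of M] by (meson order_trans)
  then show ?thesis by (intro exI[of _ "\<bar>M\<bar>"]) auto
qed

lemma Lint_cong: "(\<And>r k. r \<in> space M \<Longrightarrow> k < n \<Longrightarrow> u r k = v r k) \<Longrightarrow> Lint M n p u = Lint M n p v"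
  unfolding Lint_def by (intro nn_integral_cong) (metis vnorm_cong)

lemma inX_cong:
  assumes "\<And>r k. 0 \<le> r \<Longrightarrow> k < l \<Longrightarrow> fst f r k = fst g r k"
    and "\<And>s j. s \<in> {0..1} \<Longrightarrow> j < m \<Longrightarrow> snd f s j = snd g s j"
  shows "inX l m p f \<longleftrightarrow> inX l m p g"
proof -
  have "Xint l m p f = Xint l m p g"
    unfolding Xint_Lint using assms by (intro arg_cong2[where f = "(+)"] Lint_cong) auto
  moreover have "comp_measurable (lebesgue_on {0..}) l (fst f) \<longleftrightarrow> comp_measurable (lebesgue_on {0..}) l (fst g)"
    "comp_measurable (lebesgue_on {0..1}) m (snd f) \<longleftrightarrow> comp_measurable (lebesgue_on {0..1}) m (snd g)"
    using assms unfolding comp_measurable_def by (auto intro!: all_cong measurable_cong simp del: atLeastAtMost_iff)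
  ultimately show ?thesis by (simp add: inX_iff)
qed

lemma W1pair_cong:
  assumes W: "W1pair l m p f g"
    and eq: "\<And>r k. 0 \<le> r \<Longrightarrow> k < l \<Longrightarrow> fst f' r k = fst f r k"
    "\<And>s j. s \<in> {0..1} \<Longrightarrow> j < m \<Longrightarrow> snd f' s j = snd f s j"
  shows "W1pair l m p f' g"
proof -
  have "inX l m p f'" using inX_cong[of l f' f m p] W eq by (simp add: W1pair_def)
  then show ?thesis using W eq by (simp add: W1pair_def)
qed

lemma C0C_Llam:
  assumes la: "la > 0"
  shows "C0C l m (Llam lami la x)"
  unfolding C0C_def
proof (intro conjI allI impI)
  fix k
  show "continuous_on {0..} (\<lambda>r. fst (Llam lami la x) r k)" by (simp add: Llam_def) (intro continuous_intros)
  have "filterlim (\<lambda>r::real. la * r) at_top at_top"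
    using la by (intro filterlim_tendsto_pos_mult_at_top[OF tendsto_const] filterlim_ident) auto
  then have "filterlim (\<lambda>r::real. - (la * r)) at_bot at_top" by (simp add: filterlim_uminus_at_top)
  then have "((\<lambda>r. exp (- la * r)) \<longlongrightarrow> 0) at_top" using filterlim_compose[OF exp_at_bot] by fastforce
  then have "((\<lambda>r. complex_of_real (exp (- la * r)) * fst x k) \<longlongrightarrow> complex_of_real 0 * fst x k) at_top"
    by (intro tendsto_intros)
  then show "((\<lambda>r. fst (Llam lami la x) r k) \<longlongrightarrow> 0) at_top" by (simp add: Llam_def)
next
  fix j
  show "continuous_on {0..1} (\<lambda>s. snd (Llam lami la x) s j)"
    by (cases "lami j 0 > 0"; cases "lami j 0 < 0") (simp_all add: Llam_def, (intro continuous_intros)+)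
qed

lemma C0C_cong:
  assumes "C0C l m f" and "\<And>r k. 0 \<le> r \<Longrightarrow> k < l \<Longrightarrow> fst g r k = fst f r k"
    and "\<And>s j. s \<in> {0..1} \<Longrightarrow> j < m \<Longrightarrow> snd g s j = snd f s j"
  shows "C0C l m g"
  unfolding C0C_def
proof (intro conjI allI impI)
  fix k assume k: "k < l"
  then show "continuous_on {0..} (\<lambda>r. fst g r k)"
    using assms continuous_on_cong[of "{0..}" "{0..}" "\<lambda>r. fst g r k" "\<lambda>r. fst f r k"] by (simp add: C0C_def)
  have "eventually (\<lambda>r. fst f r k = fst g r k) at_top"
    using eventually_ge_at_top[of 0] by eventually_elim (use assms k in auto)
  moreover have "((\<lambda>r. fst f r k) \<longlongrightarrow> 0) at_top" using assms(1) k by (simp add: C0C_def)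
  ultimately show "((\<lambda>r. fst g r k) \<longlongrightarrow> 0) at_top" by (rule Lim_transform_eventually[rotated])
next
  fix j assume "j < m"
  then show "continuous_on {0..1} (\<lambda>s. snd g s j)"
    using assms continuous_on_cong[of "{0..1}" "{0..1}" "\<lambda>s. snd g s j" "\<lambda>s. snd f s j"] by (simp add: C0C_def)
qed

lemma mv_cong: "(\<And>j. j < n \<Longrightarrow> v j = w j) \<Longrightarrow> mv n A v = mv n A w"
  by (auto simp: mv_def fun_eq_iff intro!: sum.cong)

lemma comp_measurable_mv:
  assumes "\<And>i k. i < n \<Longrightarrow> k < n \<Longrightarrow> (\<lambda>r. A r i k) \<in> borel_measurable M" and "comp_measurable M n u"
  shows "comp_measurable M n (\<lambda>r. mv n (A r) (u r))"
  using assms by (auto simp: comp_measurable_def mv_def intro!: borel_measurable_sum borel_measurable_times)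

lemma vnorm_mv_le:
  assumes "\<And>i k. i < n \<Longrightarrow> k < n \<Longrightarrow> cmod (A i k) \<le> C" "0 \<le> C"
  shows "vnorm n (mv n A v) \<le> real n * C * vnorm n v"
proof (rule vnorm_le)
  fix i assume i: "i < n"
  have "cmod (mv n A v i) \<le> (\<Sum>j<n. C * vnorm n v)"
  proof -
    have "cmod (\<Sum>j<n. A i j * v j) \<le> (\<Sum>j<n. C * vnorm n v)"
    proof (rule sum_norm_le)
      fix j assume "j \<in> {..<n}"
      then show "cmod (A i j * v j) \<le> C * vnorm n v"
        unfolding norm_mult using i assms by (intro mult_mono cmod_le_vnorm) auto
    qed
    then show ?thesis using i by (simp add: mv_def)
  qed
  then show "cmod (mv n A v i) \<le> real n * C * vnorm n v" by (simp add: mult.assoc)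
qed (use assms in simp)

lemma Lint_mv_finite:
  assumes p: "1 \<le> p" and C: "0 \<le> C" and bnd: "AE r in M. \<forall>i<n. \<forall>k<n. cmod (A r i k) \<le> C"
    and u: "comp_measurable M n u" "Lint M n p u < \<infinity>"
  shows "Lint M n p (\<lambda>r. mv n (A r) (u r)) < \<infinity>"
proof -
  have "Lint M n p (\<lambda>r. mv n (A r) (u r)) \<le> Lint M n p ((real n * C) *\<^sub>R u)"
    unfolding Lint_def
  proof (rule nn_integral_mono_AE, use bnd in eventually_elim)
    case (elim r)
    then have "vnorm n (mv n (A r) (u r)) \<le> real n * C * vnorm n (u r)"
      using C by (intro vnorm_mv_le) auto
    also have "\<dots> = vnorm n (((real n * C) *\<^sub>R u) r)" using C by (simp add: vnorm_scaleR)
    finally show ?case using p by (intro ennreal_leI powr_mono2) auto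
  qed
  also have "\<dots> < \<infinity>" using u by (simp add: Lint_scaleR ennreal_mult_less_top)
  finally show ?thesis .
qed

lemma cmatr_measurable:
  assumes "\<And>k. k < n \<Longrightarrow> lam k \<in> borel_measurable N"
    and "\<And>i k. i < n \<Longrightarrow> k < n \<Longrightarrow> (\<lambda>r. q r i k) \<in> borel_measurable N"
    and "\<And>i k. i < n \<Longrightarrow> k < n \<Longrightarrow> (\<lambda>r. qinv r i k) \<in> borel_measurable N"
    and "i < n" "j < n"
  shows "(\<lambda>r. cmatr n lam q qinv r i j) \<in> borel_measurable N"
proof -
  have "(\<lambda>r. complex_of_real (lam k r)) \<in> borel_measurable N" if "k < n" for k
    by (rule measurable_compose[OF assms(1)[OF that]]) (intro borel_measurable_continuous_onI continuous_intros)
  then show ?thesis unfolding cmatr_def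
    using assms by (intro borel_measurable_sum borel_measurable_times) auto
qed

lemma cmatr_bound:
  assumes "AE r in lebesgue_on D. \<forall>i<n. \<forall>k<n. cmod (q r i k) \<le> M \<and> cmod (qinv r i k) \<le> M"
    and "\<And>k r. k < n \<Longrightarrow> r \<in> D \<Longrightarrow> \<bar>lam k r\<bar> \<le> c1" "0 \<le> M" "0 \<le> c1"
  shows "AE r in lebesgue_on D. \<forall>i<n. \<forall>k<n. cmod (cmatr n lam q qinv r i k) \<le> real n * (M * c1 * M)"
proof -
  have "AE r in lebesgue_on D. r \<in> D" by (auto intro!: AE_I2)
  with assms(1) show ?thesis
  proof eventually_elim
    case (elim r)
    show ?case
    proof (intro allI impI)
      fix i k assume ik: "i < n" "k < n"
      have "cmod (cmatr n lam q qinv r i k) \<le> (\<Sum>j<n. M * c1 * M)"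
        unfolding cmatr_def
      proof (rule sum_norm_le)
        fix j assume "j \<in> {..<n}"
        then have "cmod (q r i j) \<le> M" "\<bar>lam j r\<bar> \<le> c1" "cmod (qinv r j k) \<le> M"
          using elim ik assms(2) by auto
        then show "cmod (q r i j * complex_of_real (lam j r) * qinv r j k) \<le> M * c1 * M"
          unfolding norm_mult norm_of_real using assms(3,4) by (intro mult_mono) auto
      qed
      then show "cmod (cmatr n lam q qinv r i k) \<le> real n * (M * c1 * M)" by simp
    qed
  qed
qed

text \<open>One constant for all rates; \<open>W\<close> is the factor produced by
  \<open>Lint_le_of_weight\<close>. For \<open>dprof\<close>, whose bound grows with
  \<open>la\<close>, finiteness is what membership in W^{1,p} asks for.\<close>

lemma (in boundary_layer) layer_estimates:
  assumes p: "1 \<le> p"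
  shows "\<exists>C\<ge>0. \<forall>la\<ge>1. Lint (lebesgue_on D) n p (prof la) \<le> ennreal (C / la)
    \<and> Lint (lebesgue_on D) n p (dprof la) < \<infinity>
    \<and> Lint (lebesgue_on D) n p (\<lambda>s i. mv n (cmatr n lam q qinv s) (dprof la s) i - complex_of_real la * prof la s i) \<le> ennreal (C / la)
    \<and> (\<forall>s\<in>D. vnorm n (\<lambda>i. prof la s i - mv n (q s) (flat la s) i) \<le> C / la)"
proof -
  define W where "W = real n powr p * real n * (2 * c1 / p)"
  define A1 where "A1 = frozen * amplitude"
  define A2 where "A2 = K * (1 + real n * real n * M * M * c1 / c0) * (2 * c1 * amplitude)"
  define A3 where "A3 = 2 * c1 * K * amplitude * real n"
  have A: "0 \<le> A1" "0 \<le> A2" "0 \<le> A3" "0 \<le> W"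
    using frozen_nonneg amplitude_nonneg c0 c1 K M p by (auto simp: A1_def A2_def A3_def W_def)
  define C where "C = A1 powr p * W + A2 powr p * W + A3"
  have C: "A1 powr p * W \<le> C" "A2 powr p * W \<le> C" "A3 \<le> C" "0 \<le> C"
    using A by (auto simp: C_def)
  have inD: "AE s in lebesgue_on D. s \<in> D" by (auto intro!: AE_I2)
  show ?thesis
  proof (intro exI[of _ C] conjI allI impI ballI C(4))
    fix la :: real assume "1 \<le> la"
    then have la: "la > 0" by simp
    have "Lint (lebesgue_on D) n p (prof la) \<le> ennreal (A1 powr p * W / la)"
      unfolding W_def
    proof (rule Lint_le_of_weight[OF p la A(1)], use inD in eventually_elim)
      case (elim s) then show ?case using vnorm_prof_le[OF elim la] by (simp add: A1_def)
    qed
    also have "\<dots> \<le> ennreal (C / la)" using C la by (intro ennreal_leI divide_right_mono) auto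
    finally show "Lint (lebesgue_on D) n p (prof la) \<le> ennreal (C / la)" .
    have "Lint (lebesgue_on D) n p (dprof la) \<le> ennreal ((la / c0 * A1) powr p * W / la)"
      unfolding W_def
    proof (rule Lint_le_of_weight[OF p la], use la c0 A in simp, use inD in eventually_elim)
      case (elim s) then show ?case using vnorm_dprof_le[OF elim la] by (simp only: A1_def)
    qed
    then show "Lint (lebesgue_on D) n p (dprof la) < \<infinity>" by (rule le_less_trans) simp
    have "Lint (lebesgue_on D) n p (\<lambda>s i. mv n (cmatr n lam q qinv s) (dprof la s) i - complex_of_real la * prof la s i)
        \<le> ennreal (A2 powr p * W / la)"
      unfolding W_def by (rule Lint_le_of_weight[OF p la A(2)]) (use vnorm_defect_le[OF la] in \<open>simp only: A2_def\<close>)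
    also have "\<dots> \<le> ennreal (C / la)" using C la by (intro ennreal_leI divide_right_mono) auto
    finally show "Lint (lebesgue_on D) n p (\<lambda>s i. mv n (cmatr n lam q qinv s) (dprof la s) i - complex_of_real la * prof la s i) \<le> ennreal (C / la)" .
    fix s assume s: "s \<in> D"
    have "vnorm n (\<lambda>i. prof la s i - mv n (q s) (flat la s) i) \<le> 2 * c1 * K * amplitude / la * weight la s"
      by (rule vnorm_prof_diff_le[OF s la])
    also have "\<dots> \<le> 2 * c1 * K * amplitude / la * real n"
      using weight_le[OF la] c1 K amplitude_nonneg la by (intro mult_left_mono) auto
    also have "\<dots> = A3 / la" by (simp add: A3_def)
    also have "\<dots> \<le> C / la" using C la by (intro divide_right_mono) auto
    finally show "vnorm n (\<lambda>i. prof la s i - mv n (q s) (flat la s) i) \<le> C / la" .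
  qed
qed

section \<open>The transport operator and its boundary layers\<close>

text \<open>The hypotheses of the theorem with common constants for the external and the internal
  component, so that both are instances of \<open>boundary_layer\<close>.\<close>

locale transport_data =
  fixes p :: real and l m :: nat and lame lami :: "nat \<Rightarrow> real \<Rightarrow> real"
    and qe qeinv qi qiinv :: "real \<Rightarrow> cmat" and c0 c1 K M :: real
  assumes p: "1 \<le> p" and c0: "0 < c0" and c1: "0 < c1" and K: "0 \<le> K" and M: "0 \<le> M"
    and lame_meas: "k < l \<Longrightarrow> lame k \<in> borel_measurable (lebesgue_on {0..})"
    and lami_meas: "j < m \<Longrightarrow> lami j \<in> borel_measurable (lebesgue_on {0..1})"
    and lame_bounds: "k < l \<Longrightarrow> 0 \<le> r \<Longrightarrow> c0 \<le> \<bar>lame k r\<bar> \<and> \<bar>lame k r\<bar> \<le> c1"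
    and lami_bounds: "j < m \<Longrightarrow> s \<in> {0..1} \<Longrightarrow> c0 \<le> \<bar>lami j s\<bar> \<and> \<bar>lami j s\<bar> \<le> c1"
    and lame_neg: "k < l \<Longrightarrow> 0 \<le> r \<Longrightarrow> lame k 0 < 0 \<Longrightarrow> lame k r < 0"
    and lami_neg: "j < m \<Longrightarrow> s \<in> {0..1} \<Longrightarrow> lami j 0 < 0 \<Longrightarrow> lami j s < 0"
    and lami_pos: "j < m \<Longrightarrow> s \<in> {0..1} \<Longrightarrow> lami j 0 > 0 \<Longrightarrow> lami j s > 0"
    and qe_lip: "0 \<le> r \<Longrightarrow> 0 \<le> r' \<Longrightarrow> i < l \<Longrightarrow> k < l \<Longrightarrow> cmod (qe r i k - qe r' i k) \<le> K * \<bar>r - r'\<bar>"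
    and qi_lip: "s \<in> {0..1} \<Longrightarrow> s' \<in> {0..1} \<Longrightarrow> i < m \<Longrightarrow> k < m \<Longrightarrow> cmod (qi s i k - qi s' i k) \<le> K * \<bar>s - s'\<bar>"
    and qe_inv: "0 \<le> r \<Longrightarrow> i < l \<Longrightarrow> k < l \<Longrightarrow> (\<Sum>j<l. qe r i j * qeinv r j k) = (if i = k then 1 else 0) \<and>
      (\<Sum>j<l. qeinv r i j * qe r j k) = (if i = k then 1 else 0)"
    and qi_inv: "s \<in> {0..1} \<Longrightarrow> i < m \<Longrightarrow> k < m \<Longrightarrow> (\<Sum>j<m. qi s i j * qiinv s j k) = (if i = k then 1 else 0) \<and>
      (\<Sum>j<m. qiinv s i j * qi s j k) = (if i = k then 1 else 0)"
    and qe_bound: "AE r in lebesgue_on {0..}. \<forall>i<l. \<forall>k<l. cmod (qe r i k) \<le> M \<and> cmod (qeinv r i k) \<le> M"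
    and qi_bound: "AE s in lebesgue_on {0..1}. \<forall>i<m. \<forall>k<m. cmod (qi s i k) \<le> M \<and> cmod (qiinv s i k) \<le> M"
begin

text \<open>The end point at which \<open>Lop\<close> evaluates the component.\<close>

definition anchor_i :: "nat \<Rightarrow> real" where
  "anchor_i j = (if lami j 0 > 0 then 1 else 0)"

definition speed :: "cfun \<times> cfun \<Rightarrow> cfun \<times> cfun" where
  "speed g = ((\<lambda>r. mv l (cmatr l lame qe qeinv r) (fst g r)), (\<lambda>s. mv m (cmatr m lami qi qiinv s) (snd g s)))"

text \<open>The substitution inside \<open>Phibar\<close>, with both components kept together; on
  functions whose pullback is admissible for \<open>Phi\<close>, \<open>Phibar\<close> is
  \<open>Phi\<close> after \<open>pullback\<close>.\<close>

definition pullback :: "cfun \<times> cfun \<Rightarrow> cfun \<times> cfun" where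
  "pullback f = ((\<lambda>r. mv l (qe r) (Je l lame (fst f) r)), (\<lambda>s. mv m (qi s) (Ji m lami (snd f) s)))"

lemma lami_nonzero: "j < m \<Longrightarrow> lami j 0 \<noteq> 0"
  using lami_bounds[of j 0] c0 by auto

lemma external_layer:
  assumes "x \<in> dX l m lame"
  shows "boundary_layer {0..} l lame qe qeinv c0 c1 K M (\<lambda>_. 0) (fst x)"
proof
  show "(0::real) = 0 \<and> (\<forall>r\<in>{0..}. lame b r < 0) \<or> (0::real) = 1 \<and> (\<forall>r\<in>{0..}. lame b r > 0)"
    if "b < l" "fst x b \<noteq> 0" for b
    using that assms lame_neg[of b] by (auto simp: dX_def)
qed (use c0 c1 K M lame_meas lame_bounds qe_lip qe_inv qe_bound in auto)

lemma internal_layer: "boundary_layer {0..1} m lami qi qiinv c0 c1 K M anchor_i y"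
proof
  show "anchor_i b = 0 \<and> (\<forall>r\<in>{0..1}. lami b r < 0) \<or> anchor_i b = 1 \<and> (\<forall>r\<in>{0..1}. lami b r > 0)"
    if "b < m" for b
    using lami_nonzero[OF that] lami_neg[OF that] lami_pos[OF that] by (auto simp: anchor_i_def)
qed (use c0 c1 K M lami_meas lami_bounds qi_lip qi_inv qi_bound in \<open>auto simp: anchor_i_def\<close>)

lemma phii_bounds:
  assumes j: "j < m"
  shows "lami j 0 > 0 \<Longrightarrow> 1 / c1 \<le> phii lami j 1 \<and> phii lami j 1 \<le> 1 / c0"
    and "lami j 0 < 0 \<Longrightarrow> - 1 / c0 \<le> phii lami j 1 \<and> phii lami j 1 \<le> - 1 / c1"
proof -
  \<comment> \<open>The amplitude is 1 in every coordinate, which makes \<open>eta_bounds\<close>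
    available for all \<open>j\<close>. Evaluated at the end opposite the anchor, \<open>eta\<close>
    is plus or minus \<open>phii lami j 1\<close>.\<close>
  interpret boundary_layer "{0..1}" m lami qi qiinv c0 c1 K M anchor_i "\<lambda>_. 1" by (rule internal_layer)
  show "1 / c1 \<le> phii lami j 1 \<and> phii lami j 1 \<le> 1 / c0" if "lami j 0 > 0"
    using eta_bounds[OF j, of 0] that by (simp add: eta_def phii_def anchor_i_def)
  show "- 1 / c0 \<le> phii lami j 1 \<and> phii lami j 1 \<le> - 1 / c1" if "lami j 0 < 0"
    using eta_bounds[OF j, of 1] that by (simp add: eta_def phii_def anchor_i_def)
qed

definition unit_matrix :: "real \<Rightarrow> cmat" where
  "unit_matrix r i k = (if i = k then 1 else 0)"

text \<open>\<open>Llam\<close> is itself a boundary layer, with identity matrices and constant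
  speeds: -1 outside and, in the next lemma, the constants \<open>1 / phii lami j 1\<close> inside.
  Its estimates are thus instances of the general ones.\<close>

lemma flat_external_layer:
  "boundary_layer {0..} l (\<lambda>_ _. -1) unit_matrix unit_matrix 1 1 0 1 (\<lambda>_. 0) y"
  by unfold_locales (auto simp: unit_matrix_def if_distrib[of "\<lambda>x. _ * x"] cong: if_cong)

lemma flat_internal_layer:
  "boundary_layer {0..1} m (\<lambda>j _. 1 / phii lami j 1) unit_matrix unit_matrix c0 c1 0 1 anchor_i y"
proof
  have sgn: "anchor_i b = 0 \<and> phii lami b 1 < 0 \<or> anchor_i b = 1 \<and> phii lami b 1 > 0" if "b < m" for b
  proof (cases "lami b 0 > 0")
    case True
    have "0 < 1 / c1" using c1 by simp
    then have "0 < phii lami b 1" using phii_bounds(1)[OF that True] by linarith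
    then show ?thesis using True by (simp add: anchor_i_def)
  next
    case False
    then have neg: "lami b 0 < 0" using lami_nonzero[OF that] by linarith
    have "- 1 / c1 < 0" using c1 by simp
    then have "phii lami b 1 < 0" using phii_bounds(2)[OF that neg] by linarith
    then show ?thesis using False by (simp add: anchor_i_def)
  qed
  then show "anchor_i b = 0 \<and> (\<forall>r\<in>{0..1}. 1 / phii lami b 1 < 0) \<or> anchor_i b = 1 \<and> (\<forall>r\<in>{0..1}. 1 / phii lami b 1 > 0)"
    if "b < m" for b using that by auto
  show "c0 \<le> \<bar>1 / phii lami k 1\<bar> \<and> \<bar>1 / phii lami k 1\<bar> \<le> c1" if k: "k < m" for k
  proof -
    define y where "y = \<bar>phii lami k 1\<bar>"
    have pos: "0 < 1 / c0" "0 < 1 / c1" using c0 c1 by auto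
    have y: "1 / c1 \<le> y" "y \<le> 1 / c0"
      unfolding y_def using phii_bounds[OF k] lami_nonzero[OF k] pos by linarith+
    then have "0 < y" using pos by linarith
    then have "c0 \<le> 1 / y" "1 / y \<le> c1" using y c0 c1 by (auto simp: field_simps)
    then show ?thesis by (simp add: y_def)
  qed
qed (use c0 c1 in \<open>auto simp: anchor_i_def unit_matrix_def if_distrib[of "\<lambda>x. _ * x"] cong: if_cong\<close>)

text \<open>It makes \<open>Llam lami la x\<close> admissible in the decomposition of Phi-bar and
  controls the term with \<open>B\<close>, which is continuous for the norm of X.\<close>

lemma Llam_W1pair:
  assumes x: "x \<in> dX l m lame"
  shows "\<exists>C\<ge>0. \<forall>la\<ge>1. Xint l m p (Llam lami la x) \<le> ennreal (C / la) \<and> (\<exists>g. W1pair l m p (Llam lami la x) g)"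
proof -
  interpret E: boundary_layer "{0..}" l "\<lambda>_ _. -1" unit_matrix unit_matrix 1 1 0 1 "\<lambda>_. 0" "fst x"
    by (rule flat_external_layer)
  interpret I: boundary_layer "{0..1}" m "\<lambda>j _. 1 / phii lami j 1" unit_matrix unit_matrix c0 c1 0 1 anchor_i "snd x"
    by (rule flat_internal_layer)
  obtain C where C: "C \<ge> 0" "\<And>la. la \<ge> 1 \<Longrightarrow> Lint (lebesgue_on {0..}) l p (E.prof la) \<le> ennreal (C / la)"
      "\<And>la. la \<ge> 1 \<Longrightarrow> Lint (lebesgue_on {0..}) l p (E.dprof la) < \<infinity>"
    using E.layer_estimates[OF p] by blast
  obtain C' where C': "C' \<ge> 0" "\<And>la. la \<ge> 1 \<Longrightarrow> Lint (lebesgue_on {0..1}) m p (I.prof la) \<le> ennreal (C' / la)"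
      "\<And>la. la \<ge> 1 \<Longrightarrow> Lint (lebesgue_on {0..1}) m p (I.dprof la) < \<infinity>"
    using I.layer_estimates[OF p] by blast
  have eqE: "fst (Llam lami la x) r k = E.prof la r k" if "0 \<le> r" "k < l" for la r k
  proof -
    have "E.prof la r k = (\<Sum>b<l. if k = b then complex_of_real (exp (la * E.eta b r)) * fst x b else 0)"
      unfolding E.prof_def unit_matrix_def by (intro sum.cong) auto
    also have "\<dots> = complex_of_real (exp (la * E.eta k r)) * fst x k" using that by simp
    also have "E.eta k r = - r" using that by (simp add: E.eta_def)
    finally show ?thesis by (simp add: Llam_def)
  qed
  have eqI: "snd (Llam lami la x) s j = I.prof la s j" if "s \<in> {0..1}" "j < m" for la s j
  proof -
    have "I.prof la s j = (\<Sum>b<m. if j = b then complex_of_real (exp (la * I.eta b s)) * snd x b else 0)"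
      unfolding I.prof_def unit_matrix_def by (intro sum.cong) auto
    also have "\<dots> = complex_of_real (exp (la * I.eta j s)) * snd x j" using that by simp
    also have "I.eta j s = (s - anchor_i j) * phii lami j 1"
      using that by (simp add: I.eta_def anchor_i_def left_diff_distrib)
    also have "complex_of_real (exp (la * ((s - anchor_i j) * phii lami j 1))) * snd x j = snd (Llam lami la x) s j"
      using lami_nonzero[OF that(2)] by (auto simp: Llam_def anchor_i_def mult.assoc)
    finally show ?thesis ..
  qed
  show ?thesis
  proof (intro exI[of _ "C + C'"] conjI allI impI)
    show "0 \<le> C + C'" using C C' by simp
    fix la :: real assume la: "1 \<le> la"
    have X: "Xint l m p (Llam lami la x) = Lint (lebesgue_on {0..}) l p (E.prof la) + Lint (lebesgue_on {0..1}) m p (I.prof la)"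
      unfolding Xint_Lint using eqE eqI by (intro arg_cong2[where f = "(+)"] Lint_cong) auto
    also have "\<dots> \<le> ennreal (C / la) + ennreal (C' / la)" using C(2)[OF la] C'(2)[OF la] by (rule add_mono)
    also have "\<dots> = ennreal ((C + C') / la)" using C(1) C'(1) la by (simp add: add_divide_distrib flip: ennreal_plus)
    finally show le: "Xint l m p (Llam lami la x) \<le> ennreal ((C + C') / la)" .
    have "W1pair l m p (E.prof la, I.prof la) (E.dprof la, I.dprof la)"
      unfolding W1pair_def
    proof (intro conjI allI impI ballI)
      show "inX l m p (E.prof la, I.prof la)"
        using E.prof_measurable I.prof_measurable le_less_trans[OF C(2)[OF la]] le_less_trans[OF C'(2)[OF la]]
        by (simp add: inX_iff Xint_Lint)
      show "inX l m p (E.dprof la, I.dprof la)"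
        using E.dprof_measurable I.dprof_measurable C(3)[OF la] C'(3)[OF la] by (auto simp: inX_iff Xint_Lint)
    qed (use E.prof_has_integral I.prof_has_integral la in auto)
    then have "W1pair l m p (Llam lami la x) (E.dprof la, I.dprof la)"
      by (rule W1pair_cong) (use eqE eqI in auto)
    then show "\<exists>g. W1pair l m p (Llam lami la x) g" by blast
  qed
qed

text \<open>\<open>u la\<close> is the pair of frozen profiles. The substitutions in
  \<open>pullback\<close> turn the exponentials of \<open>Llam\<close> into those of
  \<open>flat\<close>, so the distance in the supremum norm is the error of freezing
  \<open>q\<close>. For the lower bound a single nonzero coordinate of \<open>x\<close>
  suffices.\<close>

lemma boundary_layer_pair:
  assumes x: "x \<in> dX l m lame" "x \<noteq> 0"
  shows "\<exists>C\<ge>0. \<exists>u u'. (\<forall>la\<ge>1. W1pair l m p (u la) (u' la)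
      \<and> Xint l m p (speed (u' la) - la *\<^sub>R u la) \<le> ennreal (C / la)
      \<and> C0C l m (pullback (Llam lami la x))
      \<and> supnorm l m (u la - pullback (Llam lami la x)) \<le> C / la)
    \<and> (\<exists>c>0. \<exists>la0\<ge>1. \<forall>la\<ge>la0. ennreal (c / la) \<le> Xint l m p (u la))"
proof -
  interpret E: boundary_layer "{0..}" l lame qe qeinv c0 c1 K M "\<lambda>_. 0" "fst x"
    by (rule external_layer[OF x(1)])
  interpret I: boundary_layer "{0..1}" m lami qi qiinv c0 c1 K M anchor_i "snd x"
    by (rule internal_layer)
  obtain C where C: "C \<ge> 0" "\<And>la. la \<ge> 1 \<Longrightarrow> Lint (lebesgue_on {0..}) l p (E.prof la) \<le> ennreal (C / la)
    \<and> Lint (lebesgue_on {0..}) l p (E.dprof la) < \<infinity>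
    \<and> Lint (lebesgue_on {0..}) l p (\<lambda>s i. mv l (cmatr l lame qe qeinv s) (E.dprof la s) i - complex_of_real la * E.prof la s i) \<le> ennreal (C / la)
    \<and> (\<forall>s\<in>{0..}. vnorm l (\<lambda>i. E.prof la s i - mv l (qe s) (E.flat la s) i) \<le> C / la)"
    using E.layer_estimates[OF p] by blast
  obtain C' where C': "C' \<ge> 0" "\<And>la. la \<ge> 1 \<Longrightarrow> Lint (lebesgue_on {0..1}) m p (I.prof la) \<le> ennreal (C' / la)
    \<and> Lint (lebesgue_on {0..1}) m p (I.dprof la) < \<infinity>
    \<and> Lint (lebesgue_on {0..1}) m p (\<lambda>s i. mv m (cmatr m lami qi qiinv s) (I.dprof la s) i - complex_of_real la * I.prof la s i) \<le> ennreal (C' / la)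
    \<and> (\<forall>s\<in>{0..1}. vnorm m (\<lambda>i. I.prof la s i - mv m (qi s) (I.flat la s) i) \<le> C' / la)"
    using I.layer_estimates[OF p] by blast
  define u where "u = (\<lambda>la. (E.prof la, I.prof la))"
  define u' where "u' = (\<lambda>la. (E.dprof la, I.dprof la))"
  \<comment> \<open>A coordinate with \<open>fst x k = 0\<close> vanishes on both sides. Otherwise
    \<open>x\<close> in \<open>dX\<close> forces a negative speed, and then \<open>phie\<close> is
    minus \<open>eta\<close>.\<close>
  have flatE: "fst (pullback (Llam lami la x)) r = mv l (qe r) (E.flat la r)" if "0 \<le> r" for la r
    unfolding pullback_def fst_conv
  proof (rule mv_cong)
    fix k assume k: "k < l"
    show "Je l lame (fst (Llam lami la x)) r k = E.flat la r k"
    proof (cases "fst x k = 0")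
      case True then show ?thesis using k by (simp add: Je_def Llam_def E.flat_def)
    next
      case False
      then have "lame k 0 < 0" using x(1) by (auto simp: dX_def)
      then have "integral {0..r} (\<lambda>\<sigma>. 1 / \<bar>lame k \<sigma>\<bar>) = integral {0..r} (\<lambda>\<sigma>. - (1 / lame k \<sigma>))"
        using lame_neg[OF k] by (intro integral_cong) (auto simp: abs_if)
      then have "phie lame k r = - E.eta k r" by (simp add: phie_def E.eta_def)
      then show ?thesis using k by (simp add: Je_def Llam_def E.flat_def)
    qed
  qed
  \<comment> \<open>\<open>Ji\<close> divides the travel time by \<open>phii lami j 1\<close>, and
    \<open>Llam\<close> multiplies by the same number in the exponent; the two cancel.\<close>
  have flatI: "snd (pullback (Llam lami la x)) s = mv m (qi s) (I.flat la s)" for la s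
    unfolding pullback_def snd_conv
  proof (rule mv_cong)
    fix j assume j: "j < m"
    have nz: "phii lami j 1 \<noteq> 0"
      using phii_bounds[OF j] lami_nonzero[OF j] c0 c1 by (cases "lami j 0 > 0") (auto simp: field_simps)
    have "I.eta j s = phii lami j s - anchor_i j * phii lami j 1"
      by (simp add: I.eta_def phii_def anchor_i_def)
    moreover have "la * (phii lami j s / phii lami j 1 - 1) * phii lami j 1 = la * (phii lami j s - phii lami j 1)"
      using nz by (simp add: field_simps)
    moreover have "la * (phii lami j s / phii lami j 1) * phii lami j 1 = la * phii lami j s"
      using nz by simp
    ultimately show "Ji m lami (snd (Llam lami la x)) s j = I.flat la s j"
      using j lami_nonzero[OF j] by (auto simp: Ji_def Llam_def I.flat_def anchor_i_def)
  qed
  have main: "W1pair l m p (u la) (u' la)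
      \<and> Xint l m p (speed (u' la) - la *\<^sub>R u la) \<le> ennreal ((C + C') / la)
      \<and> C0C l m (pullback (Llam lami la x))
      \<and> supnorm l m (u la - pullback (Llam lami la x)) \<le> (C + C') / la" if la: "la \<ge> 1" for la
  proof (intro conjI)
    have la0: "la > 0" using la by simp
    have sum: "ennreal (C / la) + ennreal (C' / la) = ennreal ((C + C') / la)"
      using C(1) C'(1) la by (simp add: add_divide_distrib flip: ennreal_plus)
    have fin: "Lint (lebesgue_on {0..}) l p (E.prof la) < \<infinity>" "Lint (lebesgue_on {0..1}) m p (I.prof la) < \<infinity>"
      using C(2)[OF la] C'(2)[OF la] by (auto intro: le_less_trans)
    show "W1pair l m p (u la) (u' la)"
      unfolding W1pair_def
    proof (intro conjI allI impI ballI)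
      show "inX l m p (u la)"
        using E.prof_measurable I.prof_measurable fin by (simp add: inX_iff Xint_Lint u_def)
      show "inX l m p (u' la)"
        using E.dprof_measurable I.dprof_measurable C(2)[OF la] C'(2)[OF la] by (simp add: inX_iff Xint_Lint u'_def)
    qed (use E.prof_has_integral I.prof_has_integral la in \<open>auto simp: u_def u'_def\<close>)
    have eq: "fst (speed (u' la) - la *\<^sub>R u la) = (\<lambda>s i. mv l (cmatr l lame qe qeinv s) (E.dprof la s) i - complex_of_real la * E.prof la s i)"
      "snd (speed (u' la) - la *\<^sub>R u la) = (\<lambda>s i. mv m (cmatr m lami qi qiinv s) (I.dprof la s) i - complex_of_real la * I.prof la s i)"
      by (auto simp: speed_def u_def u'_def fun_eq_iff scaleR_conv_of_real)
    show "Xint l m p (speed (u' la) - la *\<^sub>R u la) \<le> ennreal ((C + C') / la)"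
      unfolding Xint_Lint eq sum[symmetric] using C(2)[OF la] C'(2)[OF la] by (intro add_mono) auto
    show "C0C l m (pullback (Llam lami la x))"
    proof (rule C0C_cong)
      show "C0C l m ((\<lambda>r. mv l (qe r) (E.flat la r)), (\<lambda>s. mv m (qi s) (I.flat la s)))"
        using E.mv_flat_continuous E.mv_flat_tendsto[OF _ refl la0] I.mv_flat_continuous by (simp add: C0C_def)
    qed (use flatE flatI in auto)
    show "supnorm l m (u la - pullback (Llam lami la x)) \<le> (C + C') / la"
    proof (rule supnorm_le)
      fix r :: real assume r: "0 \<le> r"
      have "fst (u la - pullback (Llam lami la x)) r = (\<lambda>i. E.prof la r i - mv l (qe r) (E.flat la r) i)"
        using flatE[OF r] by (simp add: u_def fun_eq_iff)
      then have "vnorm l (fst (u la - pullback (Llam lami la x)) r) \<le> C / la" using C(2)[OF la] r by simp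
      also have "\<dots> \<le> (C + C') / la" using C' la by (intro divide_right_mono) auto
      finally show "vnorm l (fst (u la - pullback (Llam lami la x)) r) \<le> (C + C') / la" .
    next
      fix s :: real assume s: "s \<in> {0..1}"
      have "snd (u la - pullback (Llam lami la x)) s = (\<lambda>i. I.prof la s i - mv m (qi s) (I.flat la s) i)"
        using flatI by (simp add: u_def fun_eq_iff)
      then have "vnorm m (snd (u la - pullback (Llam lami la x)) s) \<le> C' / la" using C'(2)[OF la] s by simp
      also have "\<dots> \<le> (C + C') / la" using C la by (intro divide_right_mono) auto
      finally show "vnorm m (snd (u la - pullback (Llam lami la x)) s) \<le> (C + C') / la" .
    qed
  qed
  have lower: "\<exists>c>0. \<exists>la0\<ge>1. \<forall>la\<ge>la0. ennreal (c / la) \<le> Xint l m p (u la)"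
  proof (cases "fst x = 0")
    case False
    then obtain b where "fst x b \<noteq> 0" by (auto simp: fun_eq_iff)
    moreover from this have "b < l" using x(1) by (auto simp: dX_def)
    ultimately obtain c la0 where c: "c > 0" "la0 \<ge> 1"
      "\<And>la. la \<ge> la0 \<Longrightarrow> ennreal (c / la) \<le> Lint (lebesgue_on {0..}) l p (E.prof la)"
      using E.Lint_prof_ge[OF p] by blast
    have "ennreal (c / la) \<le> Xint l m p (u la)" if "la \<ge> la0" for la
      using c(3)[OF that] by (simp add: Xint_Lint u_def add_increasing2)
    then show ?thesis using c by blast
  next
    case True
    then obtain b where "snd x b \<noteq> 0" using x(2) by (auto simp: prod_eq_iff fun_eq_iff)
    moreover from this have "b < m" using x(1) by (auto simp: dX_def)
    ultimately obtain c la0 where c: "c > 0" "la0 \<ge> 1"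
      "\<And>la. la \<ge> la0 \<Longrightarrow> ennreal (c / la) \<le> Lint (lebesgue_on {0..1}) m p (I.prof la)"
      using I.Lint_prof_ge[OF p] by blast
    have "ennreal (c / la) \<le> Xint l m p (u la)" if "la \<ge> la0" for la
      using c(3)[OF that] by (simp add: Xint_Lint u_def add_increasing)
    then show ?thesis using c by blast
  qed
  show ?thesis
    by (rule exI[of _ "C + C'"], rule conjI, use C(1) C'(1) in simp, rule exI[of _ u], rule exI[of _ u'], rule conjI[OF _ lower])
      (use main in blast)
qed

lemma inX_speed:
  assumes g: "inX l m p g"
  shows "inX l m p (speed g)"
proof -
  have meas_q: "(\<lambda>r. qe r i k) \<in> borel_measurable (lebesgue_on {0..})" if "i < l" "k < l" for i k
  proof (rule continuous_imp_measurable_on_sets_lebesgue)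
    show "continuous_on {0..} (\<lambda>r. qe r i k)"
      by (rule lipschitz_on_continuous_on[of K]) (use qe_lip that K in \<open>auto simp: lipschitz_on_def dist_norm\<close>)
  qed simp
  have meas_q': "(\<lambda>r. qi r i k) \<in> borel_measurable (lebesgue_on {0..1})" if "i < m" "k < m" for i k
  proof (rule continuous_imp_measurable_on_sets_lebesgue)
    show "continuous_on {0..1} (\<lambda>r. qi r i k)"
      by (rule lipschitz_on_continuous_on[of K]) (use qi_lip that K in \<open>auto simp: lipschitz_on_def dist_norm\<close>)
  qed simp
  have meas_qinv: "(\<lambda>r. qeinv r i k) \<in> borel_measurable (lebesgue_on {0..})" if "i < l" "k < l" for i k
  proof (rule measurable_matrix_inverse[where q = qe and n = l and K = K and M = M])
    show "AE r in lebesgue_on {0..}. \<forall>i<l. \<forall>k<l. cmod (qeinv r i k) \<le> M" using qe_bound by eventually_elim auto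
  qed (use qe_lip qe_inv that in auto)
  have meas_qinv': "(\<lambda>r. qiinv r i k) \<in> borel_measurable (lebesgue_on {0..1})" if "i < m" "k < m" for i k
  proof (rule measurable_matrix_inverse[where q = qi and n = m and K = K and M = M])
    show "AE r in lebesgue_on {0..1}. \<forall>i<m. \<forall>k<m. cmod (qiinv r i k) \<le> M" using qi_bound by eventually_elim auto
  qed (use qi_lip qi_inv that in auto)
  have gm: "comp_measurable (lebesgue_on {0..}) l (fst g)" "comp_measurable (lebesgue_on {0..1}) m (snd g)"
    and gf: "Lint (lebesgue_on {0..}) l p (fst g) < \<infinity>" "Lint (lebesgue_on {0..1}) m p (snd g) < \<infinity>"
    using g by (auto simp: inX_iff Xint_Lint)
  have "comp_measurable (lebesgue_on {0..}) l (fst (speed g))"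
    unfolding speed_def fst_conv using gm(1) lame_meas meas_q meas_qinv
    by (intro comp_measurable_mv cmatr_measurable) auto
  moreover have "comp_measurable (lebesgue_on {0..1}) m (snd (speed g))"
    unfolding speed_def snd_conv using gm(2) lami_meas meas_q' meas_qinv'
    by (intro comp_measurable_mv cmatr_measurable) auto
  moreover have "Lint (lebesgue_on {0..}) l p (fst (speed g)) < \<infinity>"
    unfolding speed_def fst_conv
    by (rule Lint_mv_finite[OF p _ cmatr_bound[OF qe_bound, where lam = lame and ?c1.0 = c1] gm(1) gf(1)]) (use lame_bounds c1 M in auto)
  moreover have "Lint (lebesgue_on {0..1}) m p (snd (speed g)) < \<infinity>"
    unfolding speed_def snd_conv
    by (rule Lint_mv_finite[OF p _ cmatr_bound[OF qi_bound, where lam = lami and ?c1.0 = c1] gm(2) gf(2)]) (use lami_bounds c1 M in auto)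
  ultimately show ?thesis by (simp add: inX_iff Xint_Lint)
qed

lemma speed_add: "speed (f + g) = speed f + speed g"
  by (auto simp: speed_def mv_def prod_eq_iff fun_eq_iff sum.distrib distrib_left)

lemma speed_scaleR: "speed (c *\<^sub>R f) = c *\<^sub>R speed f"
  by (auto simp: speed_def mv_def prod_eq_iff fun_eq_iff scaleR_sum_right)

lemma speed_diff: "speed (f - g) = speed f - speed g"
  using speed_add[of f "(-1) *\<^sub>R g"] speed_scaleR[of "-1" g] by simp

end

section \<open>The lower bound\<close>

lemma normX_le_rate:
  assumes p: "1 \<le> p" and C: "0 \<le> C" and la: "0 < la" and le: "Xint l m p f \<le> ennreal (C / la)"
  shows "normX l m p f \<le> C powr (1 / p) * la powr (- 1 / p)"
proof (rule normX_le[OF p])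
  have "(C powr (1 / p) * la powr (- 1 / p)) powr p = C / la"
  proof -
    have "(C powr (1 / p) * la powr (- 1 / p)) powr p = (C powr (1 / p)) powr p * (la powr (- 1 / p)) powr p"
      by (subst powr_mult) auto
    also have "(C powr (1 / p)) powr p = C" using p C by (simp add: powr_powr)
    also have "(la powr (- 1 / p)) powr p = la powr (- 1)" unfolding powr_powr using p by simp
    finally show ?thesis using la by (simp add: powr_minus_divide)
  qed
  then show "Xint l m p f \<le> ennreal ((C powr (1 / p) * la powr (- 1 / p)) powr p)" using le by simp
qed simp

lemma normX_ge_rate:
  assumes p: "1 \<le> p" and c: "0 \<le> c" and la: "0 < la" and f: "inX l m p f" and le: "ennreal (c / la) \<le> Xint l m p f"
  shows "c powr (1 / p) * la powr (- 1 / p) \<le> normX l m p f"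
proof -
  have "c / la \<le> normX l m p f powr p" using le Xint_normX[OF p f] by simp
  then have "(c / la) powr (1 / p) \<le> (normX l m p f powr p) powr (1 / p)"
    using c la p by (intro powr_mono2) auto
  moreover have "(c / la) powr (1 / p) = c powr (1 / p) * la powr (- 1 / p)"
    using c la by (simp add: powr_divide powr_minus_divide)
  ultimately show ?thesis using p by (simp add: powr_powr)
qed

lemma strong_semigroup_normX:
  assumes p: "1 \<le> p" and T: "C0_semigroup l m p T"
  shows "strong_semigroup {f. inX l m p f} (normX l m p) T"
proof -
  interpret complete_seminormed "{f. inX l m p f}" "normX l m p" by (rule complete_seminormed_normX[OF p])
  have closed: "inX l m p (T t f)" if "0 \<le> t" "inX l m p f" for t f
    using T that unfolding C0_semigroup_def by meson
  have add: "normX l m p (T t (f + g) - (T t f + T t g)) = 0" if "0 \<le> t" "inX l m p f" "inX l m p g" for t f g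
    using T that unfolding C0_semigroup_def xdiff_eq xadd_eq by meson
  have homogeneous: "normX l m p (T t (c *\<^sub>R f) - c *\<^sub>R T t f) = 0" if "0 \<le> t" "inX l m p f" for t f c
    using T that unfolding C0_semigroup_def xdiff_eq xscale_eq[symmetric] by meson
  have bounded: "\<exists>M. \<forall>f. inX l m p f \<longrightarrow> normX l m p (T t f) \<le> M * normX l m p f" if "0 \<le> t" for t
    using T that unfolding C0_semigroup_def by meson
  have at_0: "normX l m p (T 0 f - f) = 0" if "inX l m p f" for f
    using T that unfolding C0_semigroup_def xdiff_eq by meson
  have law: "normX l m p (T (t + s) f - T t (T s f)) = 0" if "0 \<le> t" "0 \<le> s" "inX l m p f" for t s f
    using T that unfolding C0_semigroup_def xdiff_eq by meson
  have continuous: "((\<lambda>t. normX l m p (T t f - f)) \<longlongrightarrow> 0) (at_right 0)" if "inX l m p f" for f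
    using T that unfolding C0_semigroup_def xdiff_eq by meson
  show ?thesis
    by unfold_locales (simp_all only: mem_Collect_eq closed add homogeneous bounded at_0 law continuous Ball_def)
qed

text \<open>Real coordinates on the boundary space: \<open>2 * j\<close> and \<open>2 * j + 1\<close> give the real and imaginary
  part of the j-th complex coordinate, the external coordinates coming first.\<close>

definition real_coordinate :: "nat \<Rightarrow> nat \<Rightarrow> cvec \<times> cvec \<Rightarrow> real" where
  "real_coordinate l i y = (let z = (if i div 2 < l then fst y (i div 2) else snd y (i div 2 - l))
     in if even i then Re z else Im z)"

lemma real_coordinate_add: "real_coordinate l i (x + y) = real_coordinate l i x + real_coordinate l i y"
  by (simp add: real_coordinate_def Let_def)

lemma real_coordinate_scaleR: "real_coordinate l i (c *\<^sub>R x) = c * real_coordinate l i x"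
  by (simp add: real_coordinate_def Let_def)

lemma real_coordinate_le:
  assumes "i < 2 * (l + m)" shows "\<bar>real_coordinate l i y\<bar> \<le> normdX l m y"
proof -
  define z where "z = (if i div 2 < l then fst y (i div 2) else snd y (i div 2 - l))"
  have "cmod z \<le> normdX l m y"
  proof (cases "i div 2 < l")
    case True
    then show ?thesis using cmod_le_vnorm[OF True, of "fst y"] by (simp add: z_def normdX_def)
  next
    case False
    moreover have "i div 2 < l + m" using assms by (simp add: less_mult_imp_div_less)
    ultimately have "i div 2 - l < m" by linarith
    then show ?thesis using cmod_le_vnorm[of "i div 2 - l" m "snd y"] False by (simp add: z_def normdX_def)
  qed
  moreover have "real_coordinate l i y = (if even i then Re z else Im z)"
    by (simp only: real_coordinate_def z_def Let_def)
  then have "\<bar>real_coordinate l i y\<bar> \<le> cmod z"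
    using abs_Re_le_cmod[of z] abs_Im_le_cmod[of z] by presburger
  ultimately show ?thesis by linarith
qed

lemma real_coordinate_eq_0:
  assumes y: "y \<in> dX l m lame" and z: "\<And>i. i < 2 * (l + m) \<Longrightarrow> real_coordinate l i y = 0"
  shows "y = 0"
proof -
  have "fst y k = 0" if "k < l" for k
    using z[of "2 * k"] z[of "2 * k + 1"] that by (simp add: real_coordinate_def complex_eq_iff)
  moreover have "snd y j = 0" if "j < m" for j
    using z[of "2 * (l + j)"] z[of "2 * (l + j) + 1"] that by (simp add: real_coordinate_def complex_eq_iff)
  ultimately have "fst y k = 0" "snd y k = 0" for k using y unfolding dX_def by blast+
  then show ?thesis by (simp add: prod_eq_iff fun_eq_iff)
qed

context transport_data
begin

lemma Phibar_eq:
  assumes Phi: "blin_C l m lame Phi" and C: "C0C l m (pullback f)"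
  shows "Phibar l m lame lami qe qi Phi f = Phi (pullback f)"
proof -
  have "C0C l m (fst (pullback f), \<lambda>s j. 0)" "C0C l m (\<lambda>r k. 0, snd (pullback f))"
    using C by (simp_all add: C0C_def)
  from blin_C_add[OF Phi this]
  have "Phi ((fst (pullback f), \<lambda>s j. 0) + (\<lambda>r k. 0, snd (pullback f)))
      = Phi (fst (pullback f), \<lambda>s j. 0) + Phi (\<lambda>r k. 0, snd (pullback f))" .
  moreover have "(fst (pullback f), \<lambda>s j. 0) + (\<lambda>r k. 0, snd (pullback f)) = pullback f"
    by (simp add: prod_eq_iff fun_eq_iff)
  ultimately show ?thesis by (simp add: Phibar_def badd_eq pullback_def)
qed

lemma supnorm_Llam_le:
  assumes la: "0 \<le> la"
  shows "supnorm l m (Llam lami la x) \<le> normdX l m x"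
proof (rule supnorm_le)
  fix r :: real assume r: "0 \<le> r"
  show "vnorm l (fst (Llam lami la x) r) \<le> normdX l m x"
  proof (rule vnorm_le)
    fix k assume k: "k < l"
    have "cmod (fst (Llam lami la x) r k) = exp (- la * r) * cmod (fst x k)" by (simp add: Llam_def norm_mult)
    also have "\<dots> \<le> 1 * cmod (fst x k)" using la r by (intro mult_right_mono) auto
    also have "\<dots> \<le> normdX l m x" using cmod_le_vnorm[OF k, of "fst x"] by (simp add: normdX_def)
    finally show "cmod (fst (Llam lami la x) r k) \<le> normdX l m x" .
  qed simp
next
  fix s :: real assume s: "s \<in> {0..1}"
  show "vnorm m (snd (Llam lami la x) s) \<le> normdX l m x"
  proof (rule vnorm_le)
    fix j assume j: "j < m"
    have pos: "0 < 1 / c0" "0 < 1 / c1" using c0 c1 by auto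
    have "cmod (snd (Llam lami la x) s j) \<le> 1 * cmod (snd x j)"
    proof (cases "lami j 0 > 0")
      case True
      then have "0 \<le> phii lami j 1" using phii_bounds(1)[OF j True] pos by linarith
      then have "la * (s - 1) * phii lami j 1 \<le> 0" using la s by (simp add: mult_nonneg_nonpos mult_nonpos_nonneg)
      then have "exp (la * (s - 1) * phii lami j 1) * cmod (snd x j) \<le> 1 * cmod (snd x j)"
        by (intro mult_right_mono) auto
      then show ?thesis using True by (simp add: Llam_def norm_mult)
    next
      case False
      then have neg: "lami j 0 < 0" using lami_nonzero[OF j] by linarith
      then have "phii lami j 1 \<le> 0" using phii_bounds(2)[OF j neg] pos by linarith
      then have "la * s * phii lami j 1 \<le> 0" using la s by (simp add: mult_nonneg_nonpos)
      then have "exp (la * s * phii lami j 1) * cmod (snd x j) \<le> 1 * cmod (snd x j)"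
        by (intro mult_right_mono) auto
      then show ?thesis using False neg by (simp add: Llam_def norm_mult)
    qed
    also have "\<dots> \<le> normdX l m x" using cmod_le_vnorm[OF j, of "snd x"] by (simp add: normdX_def)
    finally show "cmod (snd (Llam lami la x) s j) \<le> normdX l m x" .
  qed simp
qed

text \<open>At the evaluation points of \<open>Lop\<close> the exponentials equal 1. In the
  decomposition of Phi-bar this turns the last term at \<open>Llam lami la x\<close> into
  \<open>V x\<close>.\<close>

lemma Lop_Llam:
  assumes x: "x \<in> dX l m lame"
  shows "Lop l m lame lami (Llam lami la x) = x"
proof -
  have "fst (Lop l m lame lami (Llam lami la x)) k = fst x k" for k
    using x by (auto simp: Lop_def Llam_def dX_def)
  moreover have "snd (Lop l m lame lami (Llam lami la x)) j = snd x j" for j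
    using x lami_nonzero[of j] by (cases "j < m") (auto simp: Lop_def Llam_def dX_def)
  ultimately show ?thesis by (simp add: prod_eq_iff fun_eq_iff)
qed

lemma Grel_iff: "Grel l m p lame lami qe qeinv qi qiinv Phi f y \<longleftrightarrow>
    (\<exists>g. W1pair l m p f g \<and> Phi f = 0 \<and> y = speed g)"
  unfolding Grel_def speed_def bzero_eq by (rule refl)

text \<open>Generation enters twice: density of the domain yields small corrections into the kernel
  of \<open>Phi\<close>, and the resolvent estimate bounds the corrected layer.\<close>

lemma pullback_lower_bound:
  assumes Phi: "blin_C l m lame Phi" and gen: "generates_C0 l m p (Grel l m p lame lami qe qeinv qi qiinv Phi)"
    and x: "x \<in> dX l m lame" "x \<noteq> 0"
  shows "eventually (\<lambda>la. Z < la powr (1 / p) * normdX l m (Phi (pullback (Llam lami la x)))) at_top"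
proof (rule ccontr)
  assume "\<not> ?thesis"
  \<comment> \<open>Only arbitrarily large \<open>la\<close> are available. That suffices, because
    all thresholds below are fixed before \<open>la\<close> is picked.\<close>
  then have freq: "frequently (\<lambda>la. la powr (1 / p) * normdX l m (Phi (pullback (Llam lami la x))) \<le> Z) at_top"
    by (simp add: not_eventually not_less)
  obtain T where T: "C0_semigroup l m p T" and isgen: "is_generator l m p T (Grel l m p lame lami qe qeinv qi qiinv Phi)"
    using gen by (auto simp: generates_C0_def)
  define N where "N = normX l m p"
  interpret strong_semigroup "{f. inX l m p f}" N T unfolding N_def by (rule strong_semigroup_normX[OF p T])
  have gen_eq: "generator_at f y \<longleftrightarrow> ((\<lambda>h. normX l m p (xdiff (xscale (complex_of_real (1 / h)) (xdiff (T h f) f)) y)) \<longlongrightarrow> 0) (at_right 0)" for f y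
    unfolding generator_at_def by (simp only: N_def xdiff_eq xscale_eq)
  have dom: "generator_at f (speed g)" if "W1pair l m p f g" "Phi f = 0" for f g
  proof -
    have "inX l m p f" using that by (simp add: W1pair_def)
    moreover have "Grel l m p lame lami qe qeinv qi qiinv Phi f (speed g)" using that unfolding Grel_iff by blast
    moreover have "normX l m p (xdiff f f) = 0" using N_zero by (simp add: xdiff_eq N_def)
    ultimately show ?thesis using isgen unfolding is_generator_def gen_eq by blast
  qed
  \<comment> \<open>The derivative is determined only almost everywhere. Pairing it with the
    function makes \<open>speed\<close> of the derivative linear in the pair, so that
    \<open>R\<close> is a seminorm to which \<open>small_preimage\<close> applies.\<close>
  define E where "E = {e. W1pair l m p (fst e) (snd e)}"
  define N1 where "N1 = (\<lambda>e::(cfun \<times> cfun) \<times> (cfun \<times> cfun). N (fst e))"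
  define R where "R = (\<lambda>e::(cfun \<times> cfun) \<times> (cfun \<times> cfun). N (speed (snd e)))"
  define n where "n = 2 * (l + m)"
  define L where "L = (\<lambda>i (e::(cfun \<times> cfun) \<times> (cfun \<times> cfun)). real_coordinate l i (Phi (fst e)))"
  have EW: "e \<in> E \<Longrightarrow> W1pair l m p (fst e) (snd e)" for e by (auto simp: E_def)
  have EX: "e \<in> E \<Longrightarrow> inX l m p (fst e)" "e \<in> E \<Longrightarrow> inX l m p (snd e)" for e by (auto simp: E_def W1pair_def)
  have EC: "e \<in> E \<Longrightarrow> C0C l m (fst e)" for e using W1pair_C0C[OF p EW] .
  have W0: "W1pair l m p 0 0" using inX_0[of p l m] p by (simp add: W1pair_def)
  have subE: "subspace E"
    unfolding subspace_def E_def mem_Collect_eq using W0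
    by (simp only: fst_zero snd_zero fst_add snd_add fst_scaleR snd_scaleR) (blast intro: W1pair_add[OF p] W1pair_scaleR)
  have N1: "seminormed E N1"
    by unfold_locales (use subE EX triangle scale in \<open>auto simp: N1_def\<close>)
  have R: "seminormed E R"
    by unfold_locales (use subE EX inX_speed triangle scale in \<open>auto simp: R_def speed_add speed_scaleR\<close>)
  interpret E1: seminormed E N1 by (rule N1)
  have dense: "\<exists>k\<in>E. (\<forall>i<n. L i k = 0) \<and> N1 (e - k) \<le> d" if e: "e \<in> E" and d: "d > 0" for e d
  proof -
    obtain f y where f: "inX l m p f" "inX l m p y" "generator_at f y" "N (fst e - f) \<le> d"
      using generator_dense[of "fst e" d] EX(1)[OF e] d by auto
    \<comment> \<open>The generator determines its arguments only up to null functions;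
      \<open>f'\<close> is the representative at which \<open>Phi\<close> vanishes.\<close>
    obtain f' y' where f': "Grel l m p lame lami qe qeinv qi qiinv Phi f' y'" "N (f - f') = 0"
    proof -
      have "(\<exists>y. inX l m p y \<and> generator_at f y) \<longleftrightarrow>
          (\<exists>f' y. Grel l m p lame lami qe qeinv qi qiinv Phi f' y \<and> normX l m p (xdiff f f') = 0)"
        unfolding gen_eq by (rule conjunct1[OF isgen[unfolded is_generator_def], rule_format, OF f(1)])
      then show thesis using f(2,3) that unfolding xdiff_eq N_def by blast
    qed
    obtain g where g: "W1pair l m p f' g" "Phi f' = 0" using f'(1) unfolding Grel_iff by blast
    have "N (fst e - f') = N (fst e - f)"
      using N_null_right[of "fst e" f f'] f' f g EX(1)[OF e] by (simp add: W1pair_def)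
    moreover have "real_coordinate l i 0 = 0" for i by (simp add: real_coordinate_def)
    ultimately show ?thesis using f g by (intro bexI[of _ "(f', g)"]) (auto simp: L_def N1_def E_def)
  qed
  have lift: "\<exists>C\<ge>0. \<forall>u\<in>E. \<exists>w\<in>E. (\<forall>i<n. L i w = L i u) \<and> N1 w \<le> d * (\<Sum>i<n. \<bar>L i u\<bar>) \<and> R w \<le> C * (\<Sum>i<n. \<bar>L i u\<bar>)"
    if "d > 0" for d
  proof (rule small_preimage[OF N1 R _ _ dense that])
    show "L i (e + e') = L i e + L i e'" if "e \<in> E" "e' \<in> E" for i e e'
      using blin_C_add[OF Phi EC[OF that(1)] EC[OF that(2)]] by (simp add: L_def real_coordinate_add)
    show "L i (c *\<^sub>R e) = c * L i e" if "e \<in> E" for i e c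
      using blin_C_scaleR[OF Phi EC[OF that]] by (simp add: L_def real_coordinate_scaleR)
  qed
  obtain M1 where M1: "M1 \<ge> 1" "\<forall>t\<in>{0..1}. \<forall>x\<in>{f. inX l m p f}. N (T t x) \<le> M1 * N x" using bounded_on_unit by blast
  obtain MP where MP: "MP \<ge> 0" "\<And>f. C0C l m f \<Longrightarrow> normdX l m (Phi f) \<le> MP * supnorm l m f"
    using blin_C_bound[OF Phi] by blast
  obtain C u u' c la0 where C: "C \<ge> 0" and u: "\<And>la. la \<ge> 1 \<Longrightarrow> W1pair l m p (u la) (u' la)"
      "\<And>la. la \<ge> 1 \<Longrightarrow> Xint l m p (speed (u' la) - la *\<^sub>R u la) \<le> ennreal (C / la)"
      "\<And>la. la \<ge> 1 \<Longrightarrow> C0C l m (pullback (Llam lami la x))"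
      "\<And>la. la \<ge> 1 \<Longrightarrow> supnorm l m (u la - pullback (Llam lami la x)) \<le> C / la"
    and c: "c > 0" "la0 \<ge> 1" "\<And>la. la \<ge> la0 \<Longrightarrow> ennreal (c / la) \<le> Xint l m p (u la)"
    using boundary_layer_pair[OF x] by blast
  define C2 where "C2 = C powr (1 / p)"
  define C3 where "C3 = \<bar>Z\<bar> + MP * C"
  define c' where "c' = c powr (1 / p)"
  have pos: "C2 \<ge> 0" "C3 \<ge> 0" "c' > 0" using MP(1) C c(1) by (auto simp: C2_def C3_def c'_def)
  \<comment> \<open>Makes the contributions of \<open>fst w\<close>, collected in
    \<open>dle\<close>, at most \<open>c' / 4\<close>; the added 1 keeps the divisor positive if
    \<open>C3\<close> is 0.\<close>
  define d where "d = c' / (4 * (2 * M1 + 1) * (real n * C3 + 1))"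
  have d: "d > 0" using pos M1(1) by (simp add: d_def add_nonneg_pos)
  have dle: "(2 * M1 + 1) * (d * (real n * C3)) \<le> c' / 4"
  proof -
    have nz: "2 * M1 + 1 > 0" "real n * C3 + 1 > 0" using pos M1(1) by (auto simp: add_nonneg_pos)
    have "(2 * M1 + 1) * (d * (real n * C3)) \<le> (2 * M1 + 1) * (d * (real n * C3 + 1))"
      using nz d by (intro mult_left_mono) auto
    also have "\<dots> = c' / 4" using nz unfolding d_def by (simp add: divide_simps)
    finally show ?thesis .
  qed
  obtain Cd where Cd: "Cd \<ge> 0" "\<forall>u\<in>E. \<exists>w\<in>E. (\<forall>i<n. L i w = L i u) \<and> N1 w \<le> d * (\<Sum>i<n. \<bar>L i u\<bar>) \<and> R w \<le> Cd * (\<Sum>i<n. \<bar>L i u\<bar>)"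
    using lift[OF d] by blast
  \<comment> \<open>\<open>Cd\<close> depends on \<open>d\<close>, hence this choice comes last. The
    entries give the layer estimates, the lower bound for \<open>u\<close>,
    \<open>M1 * exp (- la) <= 1 / 2\<close>, and a term of at most \<open>c' / 4\<close> from the
    defects divided by \<open>la\<close>.\<close>
  define la1 where "la1 = Max {1, la0, 2 * M1, 8 * M1 * (C2 + Cd * (real n * C3)) / c'}"
  have "frequently (\<lambda>la. la powr (1 / p) * normdX l m (Phi (pullback (Llam lami la x))) \<le> Z \<and> la \<ge> la1) at_top"
    using freq eventually_ge_at_top[of la1] by (rule frequently_eventually_frequently)
  from frequently_ex[OF this] obtain la where la: "la powr (1 / p) * normdX l m (Phi (pullback (Llam lami la x))) \<le> Z" "la \<ge> la1"
    by blast
  have las: "la \<ge> 1" "la \<ge> la0" "la \<ge> 2 * M1" "8 * M1 * (C2 + Cd * (real n * C3)) / c' \<le> la" "la > 0"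
    using la(2) by (auto simp: la1_def)
  \<comment> \<open>The common order of all quantities. Since \<open>p >= 1\<close> and
    \<open>la >= 1\<close>, also \<open>1 / la <= t\<close>, which covers the error of freezing
    \<open>q\<close>.\<close>
  define t where "t = la powr (- 1 / p)"
  have t: "t > 0" "1 / la \<le> t" "t * la powr (1 / p) = 1"
  proof -
    show "t > 0" using las by (simp add: t_def)
    have "la powr (- 1) \<le> la powr (- 1 / p)" using las p by (intro powr_mono) auto
    then show "1 / la \<le> t" using las by (simp add: t_def powr_minus_divide)
    show "t * la powr (1 / p) = 1" using las by (simp add: t_def flip: powr_add)
  qed
  define e where "e = (u la, u' la)"
  have eE: "e \<in> E" using u(1)[OF las(1)] by (simp add: E_def e_def)
  have uX: "inX l m p (u la)" "inX l m p (u' la)" using u(1)[OF las(1)] by (auto simp: W1pair_def)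
  have uC: "C0C l m (u la)" using W1pair_C0C[OF p u(1)[OF las(1)]] .
  have P: "normdX l m (Phi (u la)) \<le> C3 * t"
  proof -
    define h where "h = pullback (Llam lami la x)"
    have hC: "C0C l m h" using u(3)[OF las(1)] by (simp add: h_def)
    have "normdX l m (Phi (u la)) = normdX l m (Phi h + Phi (u la - h))"
      using blin_C_diff[OF Phi uC hC] by simp
    also have "\<dots> \<le> normdX l m (Phi h) + normdX l m (Phi (u la - h))" by (rule normdX_triangle)
    also have "normdX l m (Phi (u la - h)) \<le> MP * supnorm l m (u la - h)" by (rule MP(2)[OF C0C_diff[OF uC hC]])
    also have "\<dots> \<le> MP * (C / la)" using u(4)[OF las(1)] MP(1) by (intro mult_left_mono) (simp_all add: h_def)
    also have "\<dots> = MP * C * (1 / la)" by simp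
    also have "\<dots> \<le> MP * C * t" using t MP(1) C by (intro mult_left_mono) auto
    also have "normdX l m (Phi h) = t * (la powr (1 / p) * normdX l m (Phi h))"
      using t(3) by (simp flip: mult.assoc)
    also have "\<dots> \<le> t * \<bar>Z\<bar>" using la(1) t(1) by (intro mult_left_mono) (auto simp: h_def)
    finally show ?thesis by (simp add: C3_def algebra_simps)
  qed
  have S: "(\<Sum>i<n. \<bar>L i e\<bar>) \<le> real n * C3 * t"
  proof -
    have "(\<Sum>i<n. \<bar>L i e\<bar>) \<le> (\<Sum>i<n. C3 * t)"
      using real_coordinate_le[of _ l m "Phi (u la)"] P
      by (intro sum_mono) (auto simp: L_def e_def n_def intro: order_trans)
    then show ?thesis by simp
  qed
  obtain w where w: "w \<in> E" "\<forall>i<n. L i w = L i e" "N1 w \<le> d * (\<Sum>i<n. \<bar>L i e\<bar>)" "R w \<le> Cd * (\<Sum>i<n. \<bar>L i e\<bar>)"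
    using Cd(2) eE by blast
  have wX: "inX l m p (fst w)" "inX l m p (snd w)" using EX[OF w(1)] by auto
  have Nw: "N (fst w) \<le> d * (real n * C3) * t"
  proof -
    have "N (fst w) \<le> d * (\<Sum>i<n. \<bar>L i e\<bar>)" using w(3) by (simp add: N1_def)
    also have "\<dots> \<le> d * (real n * C3 * t)" using S d by (intro mult_left_mono) auto
    finally show ?thesis by (simp only: mult.assoc)
  qed
  have Rw: "N (speed (snd w)) \<le> Cd * (real n * C3) * t"
  proof -
    have "N (speed (snd w)) \<le> Cd * (\<Sum>i<n. \<bar>L i e\<bar>)" using w(4) by (simp add: R_def)
    also have "\<dots> \<le> Cd * (real n * C3 * t)" using S Cd(1) by (intro mult_left_mono)
    finally show ?thesis by (simp only: mult.assoc)
  qed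
  define v where "v = u la - fst w"
  define v' where "v' = u' la - snd w"
  have "e - w \<in> E" using eE w(1) by simp
  then have vW: "W1pair l m p v v'" by (simp add: E_def e_def v_def v'_def)
  have vX: "inX l m p v" "inX l m p (speed v')" using vW inX_speed by (auto simp: W1pair_def)
  have "Phi v = 0"
  proof (rule real_coordinate_eq_0)
    show "Phi v \<in> dX l m lame" using Phi W1pair_C0C[OF p vW] by (simp add: blin_C_def del: split_paired_All)
    have "Phi v = Phi (u la) - Phi (fst w)" unfolding v_def by (rule blin_C_diff[OF Phi uC EC[OF w(1)]])
    then have "Phi (u la) = Phi v + Phi (fst w)" by simp
    then have "real_coordinate l i (Phi (u la)) = real_coordinate l i (Phi v) + real_coordinate l i (Phi (fst w))" for i
      by (simp only: real_coordinate_add)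
    then show "real_coordinate l i (Phi v) = 0" if "i < 2 * (l + m)" for i
      using w(2) that by (simp add: L_def e_def n_def)
  qed
  then have gv: "generator_at v (speed v')" using dom vW by blast
  have small: "M1 * exp (- la) \<le> 1 / 2"
  proof -
    have "2 * M1 \<le> exp la" using exp_ge_add_one_self[of la] las by linarith
    then show ?thesis using M1(1) by (simp add: exp_minus field_simps)
  qed
  have sX: "inX l m p (speed (u' la) - la *\<^sub>R u la)" "inX l m p (speed (snd w))" "inX l m p (speed (u' la))"
    using inX_speed uX wX inX_diff[OF p] inX_scaleR by blast+
  have res: "N v \<le> 2 * M1 / la * N (la *\<^sub>R v - speed v')"
    using M1 vX gv las small by (intro resolvent_estimate) auto
  \<comment> \<open>The defect of \<open>u\<close> and the contribution of \<open>w\<close> are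
    separated. In the latter, \<open>la\<close> times \<open>fst w\<close> has no gain in
    \<open>la\<close>: it is small only through \<open>d\<close>.\<close>
  have split: "la *\<^sub>R v - speed v' = (speed (snd w) - la *\<^sub>R fst w) - (speed (u' la) - la *\<^sub>R u la)"
    by (simp add: v_def v'_def speed_diff scaleR_diff_right)
  have wS: "speed (snd w) \<in> {f. inX l m p f}" "la *\<^sub>R fst w \<in> {f. inX l m p f}"
    using sX(2) inX_scaleR[OF wX(1), of la] by simp_all
  have uS: "speed (u' la) - la *\<^sub>R u la \<in> {f. inX l m p f}" using sX(1) by simp
  have "N (la *\<^sub>R v - speed v') \<le> N (speed (snd w) - la *\<^sub>R fst w) + N (speed (u' la) - la *\<^sub>R u la)"
    unfolding split by (rule N_diff[OF S_diff[OF wS] uS])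
  moreover have "N (speed (snd w) - la *\<^sub>R fst w) \<le> N (speed (snd w)) + N (la *\<^sub>R fst w)"
    by (rule N_diff[OF wS])
  moreover have "N (la *\<^sub>R fst w) = la * N (fst w)" using wX(1) las(5) by (subst scale) simp_all
  moreover have "N (speed (u' la) - la *\<^sub>R u la) \<le> C2 * t"
    using normX_le_rate[OF p C las(5) u(2)[OF las(1)]] by (simp add: N_def C2_def t_def)
  moreover have "la * N (fst w) \<le> la * (d * (real n * C3) * t)" using Nw las(5) by (intro mult_left_mono) auto
  ultimately have "N (la *\<^sub>R v - speed v') \<le> Cd * (real n * C3) * t + la * (d * (real n * C3) * t) + C2 * t"
    using Rw by linarith
  then have "2 * M1 / la * N (la *\<^sub>R v - speed v') \<le> 2 * M1 / la * (Cd * (real n * C3) * t + la * (d * (real n * C3) * t) + C2 * t)"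
    using M1(1) las by (intro mult_left_mono) auto
  also have "\<dots> = (2 * M1 * (C2 + Cd * (real n * C3)) / la + 2 * M1 * (d * (real n * C3))) * t"
    using las by (simp add: field_simps)
  finally have Nv: "N v \<le> (2 * M1 * (C2 + Cd * (real n * C3)) / la + 2 * M1 * (d * (real n * C3))) * t"
    using res by linarith
  have "c' * t \<le> N (u la)"
    using normX_ge_rate[OF p less_imp_le[OF c(1)] las(5) uX(1) c(3)[OF las(2)]] by (simp add: N_def c'_def t_def)
  also have "u la = v + fst w" by (simp add: v_def)
  also have "N (v + fst w) \<le> N v + N (fst w)" using vX wX by (intro triangle) auto
  also have "\<dots> \<le> (2 * M1 * (C2 + Cd * (real n * C3)) / la + (2 * M1 + 1) * (d * (real n * C3))) * t"
    using Nv Nw by (simp add: distrib_right algebra_simps)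
  finally have "c' \<le> 2 * M1 * (C2 + Cd * (real n * C3)) / la + (2 * M1 + 1) * (d * (real n * C3))"
    using t(1) by simp
  moreover have "2 * M1 * (C2 + Cd * (real n * C3)) / la \<le> c' / 4"
    using las(4,5) pos(3) by (simp add: field_simps)
  \<comment> \<open>Both error terms are at most \<open>c' / 4\<close>, so \<open>c'\<close> would
    be at most half of itself.\<close>
  ultimately show False using dle pos(3) by linarith
qed

end

section \<open>Uniform constants and proof of the theorem\<close>

lemma uniform_bound:
  fixes lam :: "nat \<Rightarrow> real \<Rightarrow> real"
  assumes "\<forall>k<n. \<exists>M. \<forall>r\<in>D. \<bar>lam k r\<bar> \<le> M"
  shows "\<exists>c>0. \<forall>k<n. \<forall>r\<in>D. \<bar>lam k r\<bar> \<le> c"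
  using assms
proof (induction n)
  case 0 show ?case by (intro exI[of _ 1]) simp
next
  case (Suc n)
  then obtain c M where "c > 0" "\<forall>k<n. \<forall>r\<in>D. \<bar>lam k r\<bar> \<le> c" "\<forall>r\<in>D. \<bar>lam n r\<bar> \<le> M" by auto
  then show ?case by (intro exI[of _ "max c M"]) (auto simp: less_Suc_eq le_max_iff_disj)
qed

lemma lower_speed_bound:
  fixes y z c e :: real
  assumes "e \<le> y * z" "\<bar>y\<bar> \<le> c" "0 < c"
  shows "e / c \<le> \<bar>z\<bar>"
proof -
  have "e \<le> \<bar>y\<bar> * \<bar>z\<bar>" using assms(1) by (metis abs_ge_self abs_mult order_trans)
  also have "\<dots> \<le> c * \<bar>z\<bar>" using assms(2) by (intro mult_right_mono) auto
  finally show ?thesis using assms(3) by (simp add: field_simps)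
qed

theorem theorem2p12:
  fixes p :: real and l m :: nat
    and lame lami :: "nat \<Rightarrow> real \<Rightarrow> real"
    and qe qeinv qi qiinv :: "real \<Rightarrow> cmat"
    and Phi Phi0 B :: "cfun \<times> cfun \<Rightarrow> cvec \<times> cvec"
    and V :: "cvec \<times> cvec \<Rightarrow> cvec \<times> cvec"
  assumes p: "1 \<le> p"
    and lm: "0 < l + m"
    and lame_meas: "\<forall>k<l. lame k \<in> borel_measurable (lebesgue_on {0..})"
    and lami_meas: "\<forall>j<m. lami j \<in> borel_measurable (lebesgue_on {0..1})"
    and lame_bdd: "\<forall>k<l. \<exists>M. \<forall>r\<ge>0. \<bar>lame k r\<bar> \<le> M"
    and lami_bdd: "\<forall>j<m. \<exists>M. \<forall>s\<in>{0..1}. \<bar>lami j s\<bar> \<le> M"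
    and eps: "\<exists>\<epsilon>>0. (\<forall>k<l. \<forall>r\<ge>0. \<epsilon> \<le> lame k 0 * lame k r) \<and>
                     (\<forall>j<m. \<forall>s\<in>{0..1}. \<epsilon> \<le> lami j 0 * lami j s)"
    and qe_lip: "\<exists>K. \<forall>r\<ge>0. \<forall>r'\<ge>0. \<forall>a<l. \<forall>b<l. cmod (qe r a b - qe r' a b) \<le> K * \<bar>r - r'\<bar>"
    and qi_lip: "\<exists>K. \<forall>s\<in>{0..1}. \<forall>s'\<in>{0..1}. \<forall>a<m. \<forall>b<m. cmod (qi s a b - qi s' a b) \<le> K * \<bar>s - s'\<bar>"
    and qe_inv: "\<forall>r\<ge>0. \<forall>a<l. \<forall>b<l.
                   (\<Sum>k<l. qe r a k * qeinv r k b) = (if a = b then 1 else 0) \<and>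
                   (\<Sum>k<l. qeinv r a k * qe r k b) = (if a = b then 1 else 0)"
    and qi_inv: "\<forall>s\<in>{0..1}. \<forall>a<m. \<forall>b<m.
                   (\<Sum>k<m. qi s a k * qiinv s k b) = (if a = b then 1 else 0) \<and>
                   (\<Sum>k<m. qiinv s a k * qi s k b) = (if a = b then 1 else 0)"
    and qe_bdd: "\<exists>M. AE r in lebesgue_on {0..}. \<forall>a<l. \<forall>b<l. cmod (qe r a b) \<le> M"
    and qeinv_bdd: "\<exists>M. AE r in lebesgue_on {0..}. \<forall>a<l. \<forall>b<l. cmod (qeinv r a b) \<le> M"
    and qi_bdd: "\<exists>M. AE s in lebesgue_on {0..1}. \<forall>a<m. \<forall>b<m. cmod (qi s a b) \<le> M"
    and qiinv_bdd: "\<exists>M. AE s in lebesgue_on {0..1}. \<forall>a<m. \<forall>b<m. cmod (qiinv s a b) \<le> M"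
    and Phi: "blin_C l m lame Phi"
    and Phi0: "blin_C l m lame Phi0"
    and B: "blin_X l m p lame B"
    and V: "lin_dX l m lame V"
    and V_noninv: "\<not> bij_betw V (dX l m lame) (dX l m lame)"
    and decomp: "\<forall>f g. W1pair l m p f g \<longrightarrow>
                   Phibar l m lame lami qe qi Phi f
                   = badd (badd (Phi0 f) (B f)) (V (Lop l m lame lami f))"
    and gen: "generates_C0 l m p (Grel l m p lame lami qe qeinv qi qiinv Phi)"
  shows "filterlim
           (\<lambda>la. la powr (1 / p) *
              (SUP x\<in>{x \<in> dX l m lame. normdX l m x \<le> 1}. normdX l m (Phi0 (Llam lami la x))))
           at_top at_top"
proof -
  have ball: "(\<forall>r\<ge>0. P r) \<longleftrightarrow> (\<forall>r\<in>{0..}. P r)" for P :: "real \<Rightarrow> bool" by auto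
  obtain \<epsilon> where eps_pos: "\<epsilon> > 0" and eps_e: "\<forall>k<l. \<forall>r\<ge>0. \<epsilon> \<le> lame k 0 * lame k r"
    and eps_i: "\<forall>j<m. \<forall>s\<in>{0..1}. \<epsilon> \<le> lami j 0 * lami j s" using eps by blast
  obtain ce where ce: "ce > 0" "\<forall>k<l. \<forall>r\<in>{0..}. \<bar>lame k r\<bar> \<le> ce"
    using uniform_bound[of l "{0..}" lame] lame_bdd unfolding ball by blast
  obtain ci where ci: "ci > 0" "\<forall>j<m. \<forall>s\<in>{0..1}. \<bar>lami j s\<bar> \<le> ci"
    using uniform_bound[of m "{0..1}" lami] lami_bdd by blast
  define c1 where "c1 = max ce ci"
  \<comment> \<open>From \<open>\<epsilon> <= lam 0 * lam r\<close> and \<open>|lam 0| <= c1\<close>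
    follows \<open>\<epsilon> / c1 <= |lam r|\<close>.\<close>
  define c0 where "c0 = \<epsilon> / c1"
  have c: "c0 > 0" "c1 > 0" using ce ci eps_pos by (auto simp: c0_def c1_def less_max_iff_disj)
  have lame_b: "c0 \<le> \<bar>lame k r\<bar> \<and> \<bar>lame k r\<bar> \<le> c1" if "k < l" "0 \<le> r" for k r
  proof -
    have "\<bar>lame k r'\<bar> \<le> c1" if "0 \<le> r'" for r' using ce(2) \<open>k < l\<close> that by (auto simp: c1_def le_max_iff_disj)
    then show ?thesis using lower_speed_bound[of \<epsilon> "lame k 0" "lame k r" c1] eps_e c that by (simp add: c0_def)
  qed
  have lami_b: "c0 \<le> \<bar>lami j s\<bar> \<and> \<bar>lami j s\<bar> \<le> c1" if "j < m" "s \<in> {0..1}" for j s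
  proof -
    have "\<bar>lami j s'\<bar> \<le> c1" if "s' \<in> {0..1}" for s' using ci(2) \<open>j < m\<close> that by (auto simp: c1_def le_max_iff_disj)
    then show ?thesis using lower_speed_bound[of \<epsilon> "lami j 0" "lami j s" c1] eps_i c that by (simp add: c0_def)
  qed
  have lame_s: "0 < lame k 0 * lame k r" if "k < l" "0 \<le> r" for k r
    using eps_e eps_pos that less_le_trans by blast
  have lami_s: "0 < lami j 0 * lami j s" if "j < m" "s \<in> {0..1}" for j s
    using eps_i eps_pos that less_le_trans by blast
  obtain Ke where Ke: "\<forall>r\<ge>0. \<forall>r'\<ge>0. \<forall>a<l. \<forall>b<l. cmod (qe r a b - qe r' a b) \<le> Ke * \<bar>r - r'\<bar>" using qe_lip by blast
  obtain Ki where Ki: "\<forall>s\<in>{0..1}. \<forall>s'\<in>{0..1}. \<forall>a<m. \<forall>b<m. cmod (qi s a b - qi s' a b) \<le> Ki * \<bar>s - s'\<bar>" using qi_lip by blast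
  \<comment> \<open>The given constants may be negative, for instance if a component has dimension
    0; the maximum with 0 makes them usable as bounds, and likewise for \<open>M\<close>
    below.\<close>
  define K where "K = max 0 (max Ke Ki)"
  have K: "0 \<le> K" "Ke * \<bar>y\<bar> \<le> K * \<bar>y\<bar>" "Ki * \<bar>y\<bar> \<le> K * \<bar>y\<bar>" for y :: real
    by (auto simp: K_def intro!: mult_right_mono)
  obtain Me Me' Mi Mi' where
    Me: "AE r in lebesgue_on {0..}. \<forall>a<l. \<forall>b<l. cmod (qe r a b) \<le> Me"
      "AE r in lebesgue_on {0..}. \<forall>a<l. \<forall>b<l. cmod (qeinv r a b) \<le> Me'" and
    Mi: "AE s in lebesgue_on {0..1}. \<forall>a<m. \<forall>b<m. cmod (qi s a b) \<le> Mi"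
      "AE s in lebesgue_on {0..1}. \<forall>a<m. \<forall>b<m. cmod (qiinv s a b) \<le> Mi'"
    using qe_bdd qeinv_bdd qi_bdd qiinv_bdd by blast
  define M where "M = max 0 (max (max Me Me') (max Mi Mi'))"
  have M: "0 \<le> M" "Me \<le> M" "Me' \<le> M" "Mi \<le> M" "Mi' \<le> M" by (auto simp: M_def)
  interpret transport_data p l m lame lami qe qeinv qi qiinv c0 c1 K M
  proof
    show "1 \<le> p" "0 < c0" "0 < c1" "0 \<le> K" "0 \<le> M" using p c K M by auto
    show "lame k r < 0" if "k < l" "0 \<le> r" "lame k 0 < 0" for k r
      using lame_s[OF that(1,2)] that(3) by (simp add: zero_less_mult_iff)
    show "lami j s < 0" if "j < m" "s \<in> {0..1}" "lami j 0 < 0" for j s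
      using lami_s[OF that(1,2)] that(3) by (simp add: zero_less_mult_iff)
    show "lami j s > 0" if "j < m" "s \<in> {0..1}" "lami j 0 > 0" for j s
      using lami_s[OF that(1,2)] that(3) by (simp add: zero_less_mult_iff)
    show "cmod (qe r i k - qe r' i k) \<le> K * \<bar>r - r'\<bar>" if "0 \<le> r" "0 \<le> r'" "i < l" "k < l" for r r' i k
      by (rule order_trans[OF Ke[rule_format, OF that] K(2)])
    show "cmod (qi s i k - qi s' i k) \<le> K * \<bar>s - s'\<bar>" if "s \<in> {0..1}" "s' \<in> {0..1}" "i < m" "k < m" for s s' i k
      by (rule order_trans[OF Ki[rule_format, OF that] K(3)])
    show "AE r in lebesgue_on {0..}. \<forall>i<l. \<forall>k<l. cmod (qe r i k) \<le> M \<and> cmod (qeinv r i k) \<le> M"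
      using Me
    proof eventually_elim
      case (elim r)
      show ?case
      proof (intro allI impI conjI)
        fix i k assume "i < l" "k < l"
        then have *: "cmod (qe r i k) \<le> Me" "cmod (qeinv r i k) \<le> Me'" using elim by blast+
        show "cmod (qe r i k) \<le> M" by (rule order_trans[OF *(1) M(2)])
        show "cmod (qeinv r i k) \<le> M" by (rule order_trans[OF *(2) M(3)])
      qed
    qed
    show "AE s in lebesgue_on {0..1}. \<forall>i<m. \<forall>k<m. cmod (qi s i k) \<le> M \<and> cmod (qiinv s i k) \<le> M"
      using Mi
    proof eventually_elim
      case (elim r)
      show ?case
      proof (intro allI impI conjI)
        fix i k assume "i < m" "k < m"
        then have *: "cmod (qi r i k) \<le> Mi" "cmod (qiinv r i k) \<le> Mi'" using elim by blast+
        show "cmod (qi r i k) \<le> M" by (rule order_trans[OF *(1) M(4)])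
        show "cmod (qiinv r i k) \<le> M" by (rule order_trans[OF *(2) M(5)])
      qed
    qed
    show "lame k \<in> borel_measurable (lebesgue_on {0..})" if "k < l" for k
      using lame_meas that by simp
    show "lami j \<in> borel_measurable (lebesgue_on {0..1})" if "j < m" for j
      using lami_meas that by simp
    show "c0 \<le> \<bar>lame k r\<bar> \<and> \<bar>lame k r\<bar> \<le> c1" if "k < l" "0 \<le> r" for k r
      by (rule lame_b[OF that])
    show "c0 \<le> \<bar>lami j s\<bar> \<and> \<bar>lami j s\<bar> \<le> c1" if "j < m" "s \<in> {0..1}" for j s
      by (rule lami_b[OF that])
    show "(\<Sum>j<l. qe r i j * qeinv r j k) = (if i = k then 1 else 0) \<and>
        (\<Sum>j<l. qeinv r i j * qe r j k) = (if i = k then 1 else 0)" if "0 \<le> r" "i < l" "k < l" for r i k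
      by (rule qe_inv[rule_format, OF that])
    show "(\<Sum>j<m. qi s i j * qiinv s j k) = (if i = k then 1 else 0) \<and>
        (\<Sum>j<m. qiinv s i j * qi s j k) = (if i = k then 1 else 0)" if "s \<in> {0..1}" "i < m" "k < m" for s i k
      by (rule qi_inv[rule_format, OF that])
  qed
  obtain x0 where x0: "x0 \<in> dX l m lame" "x0 \<noteq> 0" "V x0 = 0" using lin_dX_kernel[OF V V_noninv] by blast
  have x0_pos: "normdX l m x0 > 0" by (rule normdX_pos[OF x0(1,2)])
  \<comment> \<open>A kernel vector of \<open>V\<close>, normalized so that it competes in the
    supremum over the unit ball.\<close>
  define x where "x = (1 / normdX l m x0) *\<^sub>R x0"
  have x: "x \<in> dX l m lame" "x \<noteq> 0" "normdX l m x \<le> 1" "V x = 0"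
  proof -
    show "x \<in> dX l m lame" unfolding x_def using subspace_dX x0(1) by (rule subspace_scale)
    show "x \<noteq> 0" "normdX l m x \<le> 1" using x0 x0_pos by (auto simp: x_def normdX_scaleR)
    have "V (bscale (complex_of_real (1 / normdX l m x0)) x0) = bscale (complex_of_real (1 / normdX l m x0)) (V x0)"
      using V x0(1) unfolding lin_dX_def by blast
    then show "V x = 0" unfolding bscale_eq x_def x0(3) by simp
  qed
  obtain MB where MB: "MB \<ge> 0" "\<And>f. inX l m p f \<Longrightarrow> normdX l m (B f) \<le> MB * normX l m p f"
    using blin_X_bound[OF B] by blast
  obtain M0 where M0: "M0 \<ge> 0" "\<And>f. C0C l m f \<Longrightarrow> normdX l m (Phi0 f) \<le> M0 * supnorm l m f"
    using blin_C_bound[OF Phi0] by blast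
  obtain C where C: "C \<ge> 0" "\<And>la. la \<ge> 1 \<Longrightarrow> Xint l m p (Llam lami la x) \<le> ennreal (C / la)"
      "\<And>la. la \<ge> 1 \<Longrightarrow> \<exists>g. W1pair l m p (Llam lami la x) g" using Llam_W1pair[OF x(1)] by blast
  have pb: "\<And>la. la \<ge> 1 \<Longrightarrow> C0C l m (pullback (Llam lami la x))"
    using boundary_layer_pair[OF x(1,2)] by blast
  \<comment> \<open>A bound for \<open>la powr (1 / p)\<close> times the norm of
    \<open>B (Llam lami la x)\<close>.\<close>
  define C2 where "C2 = MB * C powr (1 / p)"
  show ?thesis
    unfolding filterlim_at_top
  proof
    fix Z :: real
    \<comment> \<open>Raising the target by \<open>C2\<close> in advance makes up for the loss
      through \<open>B\<close>.\<close>
    have "eventually (\<lambda>la. Z + C2 < la powr (1 / p) * normdX l m (Phi (pullback (Llam lami la x)))) at_top"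
      by (rule pullback_lower_bound[OF Phi gen x(1,2)])
    then show "eventually (\<lambda>la. Z \<le> la powr (1 / p) *
        (SUP x\<in>{x \<in> dX l m lame. normdX l m x \<le> 1}. normdX l m (Phi0 (Llam lami la x)))) at_top"
      using eventually_ge_at_top[of 1]
    proof eventually_elim
      case (elim la)
      then have la: "la \<ge> 1" "la > 0" by auto
      define f where "f = Llam lami la x"
      obtain g where g: "W1pair l m p f g" using C(3)[OF la(1)] unfolding f_def by blast
      have fX: "inX l m p f" using g by (simp add: W1pair_def)
      have "Phi (pullback f) = Phi0 f + B f + V (Lop l m lame lami f)"
      proof -
        have "Phibar l m lame lami qe qi Phi f = badd (badd (Phi0 f) (B f)) (V (Lop l m lame lami f))"
          using decomp g by blast
        moreover have "Phibar l m lame lami qe qi Phi f = Phi (pullback f)"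
          unfolding f_def by (rule Phibar_eq[OF Phi pb[OF la(1)]])
        ultimately show ?thesis by (simp add: badd_eq)
      qed
      also have "V (Lop l m lame lami f) = 0" using Lop_Llam[OF x(1)] x(4) by (simp add: f_def)
      finally have "normdX l m (Phi (pullback f)) \<le> normdX l m (Phi0 f) + normdX l m (B f)"
        using normdX_triangle[of l m "Phi0 f" "B f"] by simp
      also have "normdX l m (B f) \<le> MB * normX l m p f" by (rule MB(2)[OF fX])
      also have "\<dots> \<le> MB * (C powr (1 / p) * la powr (- 1 / p))"
        using normX_le_rate[OF p C(1) la(2) C(2)[OF la(1)]] MB(1) by (intro mult_left_mono) (simp_all add: f_def)
      also have "normdX l m (Phi0 f) \<le> (SUP x\<in>{x \<in> dX l m lame. normdX l m x \<le> 1}. normdX l m (Phi0 (Llam lami la x)))"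
        unfolding f_def
      proof (rule cSUP_upper)
        show "x \<in> {x \<in> dX l m lame. normdX l m x \<le> 1}" using x by simp
        \<comment> \<open>An upper bound is required for the supremum to dominate its members;
          \<open>Llam\<close> does not increase the norm, so the bound of \<open>Phi0\<close> serves
          for every \<open>la\<close>.\<close>
        show "bdd_above ((\<lambda>x. normdX l m (Phi0 (Llam lami la x))) ` {x \<in> dX l m lame. normdX l m x \<le> 1})"
        proof (rule bdd_aboveI2)
          fix y assume "y \<in> {x \<in> dX l m lame. normdX l m x \<le> 1}"
          then have "supnorm l m (Llam lami la y) \<le> 1" using supnorm_Llam_le[of la y] la by simp
          then have "M0 * supnorm l m (Llam lami la y) \<le> M0 * 1" using M0(1) by (intro mult_left_mono)
          then show "normdX l m (Phi0 (Llam lami la y)) \<le> M0"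
            using M0(2)[OF C0C_Llam[OF la(2), of l m lami y]] by simp
        qed
      qed
      finally have le: "normdX l m (Phi (pullback f)) \<le> (SUP x\<in>{x \<in> dX l m lame. normdX l m x \<le> 1}. normdX l m (Phi0 (Llam lami la x)))
          + MB * (C powr (1 / p) * la powr (- 1 / p))" by simp
      have "la powr (1 / p) * la powr (- 1 / p) = 1" using la by (simp flip: powr_add)
      then have e: "la powr (1 / p) * (MB * (C powr (1 / p) * la powr (- 1 / p))) = C2"
        by (simp add: C2_def mult_ac)
      have "la powr (1 / p) * normdX l m (Phi (pullback f)) \<le> la powr (1 / p) *
        ((SUP x\<in>{x \<in> dX l m lame. normdX l m x \<le> 1}. normdX l m (Phi0 (Llam lami la x)))
          + MB * (C powr (1 / p) * la powr (- 1 / p)))" using le by (intro mult_left_mono) auto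
      then show ?case using elim(1) e by (simp add: f_def distrib_left)
    qed
  qed
qed

end
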